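(* Let $G$ be a finite group and let $M$ be a $G$-lattice. Then for all $n\in\mathbb{Z}$: $$\hat H^{n-1}(G,DM)\simeq D\hat H^{-n}(G,M),$$ $$\hat H^{n}(G,DM)\simeq \hat H^{n+1}(G,M^* ),$$ $$\hat H^{n}(G,M^* )\simeq D\hat H^{-n}(G,M).$$
   Context: A $G$-lattice is a $\mathbb{Z}G$-module whose underlying abelian group is free of finite rank. $M^*=\mathrm{Hom}_{\mathbb{Z}}(M,\mathbb{Z})$ and $DM=\mathrm{Hom}_{\mathbb{Z}}(M,\mathbb{Q}/\mathbb{Z})$, where $G$ acts by $(gf)(u)=f(g^{-1}u)$; for an abelian group $A$ likewise $DA=\mathrm{Hom}_{\mathbb{Z}}(A,\mathbb{Q}/\mathbb{Z})$. $\hat H^n(G,-)$ denotes Tate cohomology; the isomorphisms are of abelian groups. *)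

theory Defs
  imports "HOL-Algebra.Bij" "HOL-Algebra.Product_Groups" "HOL-Algebra.Free_Abelian_Groups"
begin

text \<open>
  All groups, including the underlying abelian groups of modules, are records in the
  multiplicative notation of HOL-Algebra: a sum is a \<open>finprod\<close>, and the multiple of \<open>a\<close> by an
  integer \<open>z\<close> is \<open>a [^] z\<close>.

  A \<open>\<int>G\<close>-module is an abelian group \<open>A\<close> with a homomorphism \<open>\<phi>\<close> from \<open>G\<close> to the group of
  automorphisms of \<open>A\<close>; \<open>\<phi> g a\<close> is the (left) action of \<open>g\<close> on \<open>a\<close>.
\<close>

locale G_module = group_hom G "AutoGroup A" \<phi> + A: comm_group A
  for G :: "('g, 'b) monoid_scheme" (structure)
    and A :: "('a, 'c) monoid_scheme"
    and \<phi> :: "'g \<Rightarrow> 'a \<Rightarrow> 'a"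

locale G_lattice = G_module +
  assumes free_of_finite_rank: "\<exists>r::nat. A \<cong> free_Abelian_group {..<r}"


definition hom_group ::
    "('a, 'c) monoid_scheme \<Rightarrow> ('b, 'd) monoid_scheme \<Rightarrow> ('a \<Rightarrow> 'b) monoid" where
  "hom_group A B =
     \<lparr>carrier = hom A B \<inter> extensional (carrier A),
      monoid.mult = (\<lambda>f f'. \<lambda>u\<in>carrier A. f u \<otimes>\<^bsub>B\<^esub> f' u),
      one = (\<lambda>u\<in>carrier A. \<one>\<^bsub>B\<^esub>)\<rparr>"

definition rational_group :: "rat monoid" where
  "rational_group = \<lparr>carrier = UNIV, monoid.mult = (+), one = 0\<rparr>"

definition rationals_mod_integers :: "rat set monoid" where
  "rationals_mod_integers = rational_group Mod \<int>"

definition integral_dual :: "('a, 'c) monoid_scheme \<Rightarrow> ('a \<Rightarrow> int) monoid" where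
  "integral_dual A = hom_group A integer_group"

definition torsion_dual :: "('a, 'c) monoid_scheme \<Rightarrow> ('a \<Rightarrow> rat set) monoid" where
  "torsion_dual A = hom_group A rationals_mod_integers"

text \<open>The action of \<open>G\<close> on \<open>Hom(A, B)\<close> for trivial action on \<open>B\<close>. It is restricted to the
  carriers because \<open>AutoGroup\<close> consists of extensional functions.\<close>

definition contragredient ::
    "('g, 'b) monoid_scheme \<Rightarrow> ('a, 'c) monoid_scheme \<Rightarrow> ('e, 'd) monoid_scheme \<Rightarrow>
     ('g \<Rightarrow> 'a \<Rightarrow> 'a) \<Rightarrow> 'g \<Rightarrow> ('a \<Rightarrow> 'e) \<Rightarrow> 'a \<Rightarrow> 'e" where
  "contragredient G A B \<phi> g =
     (\<lambda>f\<in>carrier (hom_group A B). \<lambda>u\<in>carrier A. f (\<phi> (inv\<^bsub>G\<^esub> g) u))"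

abbreviation integral_dual_action ::
    "('g, 'b) monoid_scheme \<Rightarrow> ('a, 'c) monoid_scheme \<Rightarrow> ('g \<Rightarrow> 'a \<Rightarrow> 'a) \<Rightarrow>
     'g \<Rightarrow> ('a \<Rightarrow> int) \<Rightarrow> 'a \<Rightarrow> int" where
  "integral_dual_action G A \<equiv> contragredient G A integer_group"

abbreviation torsion_dual_action ::
    "('g, 'b) monoid_scheme \<Rightarrow> ('a, 'c) monoid_scheme \<Rightarrow> ('g \<Rightarrow> 'a \<Rightarrow> 'a) \<Rightarrow>
     'g \<Rightarrow> ('a \<Rightarrow> rat set) \<Rightarrow> 'a \<Rightarrow> rat set" where
  "torsion_dual_action G A \<equiv> contragredient G A rationals_mod_integers"


text \<open>
  Tate cohomology of a finite group \<open>G\<close> is the cohomology of the complete standard complex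
  \<open>\<dots> \<rightarrow> C\<^sub>1 \<rightarrow> C\<^sub>0 \<rightarrow> C\<^sup>0 \<rightarrow> C\<^sup>1 \<rightarrow> \<dots>\<close>,
  in which the inhomogeneous bar chains are spliced to the inhomogeneous bar cochains by the
  norm map; \<open>C\<^sup>k\<close> is in degree \<open>k\<close> and \<open>C\<^sub>k\<close> in degree \<open>- k - 1\<close>.
  Since \<open>G\<close> is finite, both \<open>C\<^sup>k\<close> and \<open>C\<^sub>k\<close> are groups of arbitrary functions \<open>G\<^sup>k \<rightarrow> A\<close>,
  a chain \<open>f\<close> standing for the sum of \<open>f(g\<^sub>1,\<dots>,g\<^sub>k) \<otimes> [g\<^sub>1|\<dots>|g\<^sub>k]\<close> over all tuples.
  Elements of \<open>G\<^sup>k\<close> are lists of length \<open>k\<close>.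
\<close>

definition tuples :: "('g, 'b) monoid_scheme \<Rightarrow> nat \<Rightarrow> 'g list set" where
  "tuples G k = {gs. set gs \<subseteq> carrier G \<and> length gs = k}"

text \<open>The faces of \<open>[g\<^sub>1|\<dots>|g\<^sub>k]\<close>: drop \<open>g\<^sub>1\<close> for \<open>i = 0\<close>, drop \<open>g\<^sub>k\<close> for \<open>i = k\<close>, and replace
  \<open>g\<^sub>i, g\<^bsub>i+1\<^esub>\<close> by their product for \<open>0 < i < k\<close> (list positions count from zero).\<close>

definition bar_face :: "('g, 'b) monoid_scheme \<Rightarrow> nat \<Rightarrow> 'g list \<Rightarrow> 'g list" where
  "bar_face G i gs =
     (if i = 0 then tl gs
      else if i = length gs then butlast gs
      else take (i - 1) gs @ (gs ! (i - 1) \<otimes>\<^bsub>G\<^esub> gs ! i) # drop (i + 1) gs)"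

text \<open>From \<open>C\<^sup>k\<close> to \<open>C\<^bsup>k+1\<^esup>\<close>:
  \<open>(\<delta>f)(g\<^sub>1,\<dots>,g\<^bsub>k+1\<^esub>) = g\<^sub>1 f(g\<^sub>2,\<dots>,g\<^bsub>k+1\<^esub>) + \<Sum>\<^sub>i (-1)\<^sup>i f(\<dots>,g\<^sub>i g\<^bsub>i+1\<^esub>,\<dots>) + (-1)\<^bsup>k+1\<^esup> f(g\<^sub>1,\<dots>,g\<^sub>k)\<close>.\<close>

definition bar_coboundary ::
    "('g, 'b) monoid_scheme \<Rightarrow> ('a, 'c) monoid_scheme \<Rightarrow> ('g \<Rightarrow> 'a \<Rightarrow> 'a) \<Rightarrow> nat \<Rightarrow>
     ('g list \<Rightarrow> 'a) \<Rightarrow> 'g list \<Rightarrow> 'a" where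
  "bar_coboundary G A \<phi> k f =
     (\<lambda>gs\<in>tuples G (Suc k).
        \<Otimes>\<^bsub>A\<^esub>i\<in>{..Suc k}.
          (if i = 0 then \<phi> (hd gs) (f (bar_face G i gs)) else f (bar_face G i gs))
            [^]\<^bsub>A\<^esub> ((-1) ^ i :: int))"

text \<open>From \<open>C\<^bsub>k+1\<^esub>\<close> to \<open>C\<^sub>k\<close>:
  \<open>\<partial>(a \<otimes> [g\<^sub>1|\<dots>|g\<^bsub>k+1\<^esub>]) = g\<^sub>1\<^sup>-\<^sup>1a \<otimes> [g\<^sub>2|\<dots>|g\<^bsub>k+1\<^esub>]
     + \<Sum>\<^sub>i (-1)\<^sup>i a \<otimes> [\<dots>|g\<^sub>i g\<^bsub>i+1\<^esub>|\<dots>] + (-1)\<^bsup>k+1\<^esup> a \<otimes> [g\<^sub>1|\<dots>|g\<^sub>k]\<close>,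
  where \<open>g\<^sub>1\<^sup>-\<^sup>1a\<close> is the right action \<open>a g\<^sub>1\<close>; the value at \<open>hs\<close> collects the coefficients of
  the tuples having \<open>hs\<close> as a face.\<close>

definition bar_boundary ::
    "('g, 'b) monoid_scheme \<Rightarrow> ('a, 'c) monoid_scheme \<Rightarrow> ('g \<Rightarrow> 'a \<Rightarrow> 'a) \<Rightarrow> nat \<Rightarrow>
     ('g list \<Rightarrow> 'a) \<Rightarrow> 'g list \<Rightarrow> 'a" where
  "bar_boundary G A \<phi> k f =
     (\<lambda>hs\<in>tuples G k.
        \<Otimes>\<^bsub>A\<^esub>i\<in>{..Suc k}. \<Otimes>\<^bsub>A\<^esub>gs\<in>{gs \<in> tuples G (Suc k). bar_face G i gs = hs}.
          (if i = 0 then \<phi> (inv\<^bsub>G\<^esub> (hd gs)) (f gs) else f gs) [^]\<^bsub>A\<^esub> ((-1) ^ i :: int))"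

definition norm_map ::
    "('g, 'b) monoid_scheme \<Rightarrow> ('a, 'c) monoid_scheme \<Rightarrow> ('g \<Rightarrow> 'a \<Rightarrow> 'a) \<Rightarrow>
     ('g list \<Rightarrow> 'a) \<Rightarrow> 'g list \<Rightarrow> 'a" where
  "norm_map G A \<phi> f = (\<lambda>gs\<in>tuples G 0. \<Otimes>\<^bsub>A\<^esub>g\<in>carrier G. \<phi> g (f gs))"

definition tate_cochains ::
    "('g, 'b) monoid_scheme \<Rightarrow> ('a, 'c) monoid_scheme \<Rightarrow> int \<Rightarrow> ('g list \<Rightarrow> 'a) monoid" where
  "tate_cochains G A n =
     product_group (tuples G (if n \<ge> 0 then nat n else nat (- n - 1))) (\<lambda>_. A)"

definition tate_differential ::
    "('g, 'b) monoid_scheme \<Rightarrow> ('a, 'c) monoid_scheme \<Rightarrow> ('g \<Rightarrow> 'a \<Rightarrow> 'a) \<Rightarrow> int \<Rightarrow>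
     ('g list \<Rightarrow> 'a) \<Rightarrow> 'g list \<Rightarrow> 'a" where
  "tate_differential G A \<phi> n =
     (if n \<ge> 0 then bar_coboundary G A \<phi> (nat n)
      else if n = -1 then norm_map G A \<phi>
      else bar_boundary G A \<phi> (nat (- n - 2)))"

definition tate_cohomology ::
    "('g, 'b) monoid_scheme \<Rightarrow> ('a, 'c) monoid_scheme \<Rightarrow> ('g \<Rightarrow> 'a \<Rightarrow> 'a) \<Rightarrow> int \<Rightarrow>
     ('g list \<Rightarrow> 'a) set monoid" where
  "tate_cohomology G A \<phi> n =
     (tate_cochains G A n)
       \<lparr>carrier := kernel (tate_cochains G A n) (tate_cochains G A (n + 1))
                    (tate_differential G A \<phi> n)\<rparr>
     Mod (tate_differential G A \<phi> (n - 1) ` carrier (tate_cochains G A (n - 1)))"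

end

(*
  Over the integral group ring, the complete standard complex is given by matrices: one matrix in
  each degree, whose transpose (with g replaced by its inverse) is the matrix in the dual degree.
  Evaluation therefore identifies the complex of Hom(M, B) with Hom(-, B) applied to the complex
  of M, for B = Z and B = Q/Z.  Since Q/Z is injective, Hom(-, Q/Z) commutes with cohomology,
  which is the first isomorphism.

  Summation over an additional last argument is a contracting homotopy s up to the factor
  N = |G|, that is, d s + s d = N.  Hence an integral cocycle f defines the character
  c |-> f(s c) / N mod Z on cocycles c, and this induces the third isomorphism; for injectivity
  and surjectivity, characters of free groups are lifted to Q.  The second isomorphism combines
  the other two.
*)

theory Submission
  imports Defs
begin

section \<open>Finite products and homomorphisms of abelian groups\<close>

text \<open>Degrees k and -k-1 of the complete complex are indexed by tuples of the same length, so
  the evaluation pairing matches exactly these; this is the origin of the shift between n-1 and -n.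
  An integral cocycle f of degree n therefore pairs with cochains of degree -n-1, while the third
  isomorphism needs characters in degree -n. The homotopy s bridges this gap at the cost of the
  factor N, which the division by N compensates: on a coboundary c = d b the value f(s c) / N is the
  integer f(b), and for f = d g and a cocycle c it is the integer g(c). Inserting a last argument
  describes s only on the cochain side. At the splice s is the identity, because the sum of a - 1
  over all a in G is the norm element minus N; on the chain side it is obtained by transposition.
  Both dualities are instances of one statement about pairings, whose hypotheses say which elements
  annihilate which.\<close>

lemma (in comm_monoid) finprod_swap:
  assumes "finite I" "finite J" "\<And>i j. \<lbrakk>i \<in> I; j \<in> J\<rbrakk> \<Longrightarrow> f i j \<in> carrier G"
  shows "(\<Otimes>i\<in>I. \<Otimes>j\<in>J. f i j) = (\<Otimes>j\<in>J. \<Otimes>i\<in>I. f i j)"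
  using assms(1,3)
proof (induction I)
  case (insert i I)
  then have "(\<Otimes>j\<in>J. \<Otimes>i\<in>insert i I. f i j) = (\<Otimes>j\<in>J. f i j \<otimes> (\<Otimes>i\<in>I. f i j))"
    by (intro finprod_cong') (auto simp: Pi_iff)
  with insert show ?case
    by (simp add: Pi_iff)
qed simp

lemma (in comm_group) finprod_int_pow:
  assumes "f \<in> I \<rightarrow> carrier G"
  shows "(\<Otimes>i\<in>I. f i) [^] (k::int) = (\<Otimes>i\<in>I. f i [^] k)"
  using assms by (induction I rule: infinite_finite_induct) (auto simp: int_pow_distrib Pi_iff)

lemma (in comm_group) int_pow_sum:
  assumes "x \<in> carrier G" "finite I"
  shows "x [^] (\<Sum>i\<in>I. k i :: int) = (\<Otimes>i\<in>I. x [^] k i)"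
  using assms(2,1) by (induction I) (auto simp: int_pow_mult)

lemma (in comm_monoid) finprod_indicator:
  assumes "finite I" "i \<in> I" "f i \<in> carrier G"
  shows "(\<Otimes>j\<in>I. if j = i then f j else \<one>) = f i"
proof -
  have "(\<Otimes>j\<in>I. if j = i then f j else \<one>) = (\<Otimes>j\<in>{i}. f j)"
    using assms by (intro finprod_mono_neutral_cong_right) auto
  then show ?thesis
    using assms by simp
qed

lemma hom_finprod:
  assumes "comm_group A" "comm_group B" "h \<in> hom A B" "f \<in> I \<rightarrow> carrier A"
  shows "h (finprod A f I) = finprod B (\<lambda>i. h (f i)) I"
proof -
  interpret A: comm_group A by fact
  interpret B: comm_group B by fact
  interpret h: group_hom A B h
    using assms by unfold_locales
  show ?thesis
    using assms(4) by (induction I rule: infinite_finite_induct) (auto simp: Pi_iff)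
qed

section \<open>Product groups and homomorphism groups\<close>

lemma comm_group_product_group:
  assumes "\<And>i. i \<in> I \<Longrightarrow> comm_group (A i)"
  shows "comm_group (product_group I A)"
proof (rule group.group_comm_groupI)
  show "group (product_group I A)"
    using assms by (simp add: comm_group_def)
qed (use assms in \<open>auto intro!: restrict_ext comm_monoid.m_comm
       simp: comm_group_def PiE_iff\<close>)

lemma comm_group_hom_group:
  assumes "group A" "comm_group B"
  shows "comm_group (hom_group A B)"
proof -
  interpret A: group A by fact
  interpret B: comm_group B by fact
  have hom: "f u \<in> carrier B" "f (u \<otimes>\<^bsub>A\<^esub> v) = f u \<otimes>\<^bsub>B\<^esub> f v"
    if "f \<in> hom A B" "u \<in> carrier A" "v \<in> carrier A" for f u v
    using that by (auto simp: hom_def Pi_iff)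
  show ?thesis
  proof (rule comm_groupI)
    fix f assume f: "f \<in> carrier (hom_group A B)"
    interpret f: group_hom A B f
      using f by unfold_locales (simp add: hom_group_def)
    show "\<exists>g\<in>carrier (hom_group A B). g \<otimes>\<^bsub>hom_group A B\<^esub> f = \<one>\<^bsub>hom_group A B\<^esub>"
      by (rule bexI[where x = "\<lambda>u\<in>carrier A. inv\<^bsub>B\<^esub> f u"])
        (auto simp: hom_group_def B.inv_mult intro!: homI restrict_ext)
    show "\<one>\<^bsub>hom_group A B\<^esub> \<otimes>\<^bsub>hom_group A B\<^esub> f = f"
      using f by (auto simp: hom_group_def extensional_def restrict_def fun_eq_iff)
  next
    fix f g assume "f \<in> carrier (hom_group A B)" "g \<in> carrier (hom_group A B)"
    then show "f \<otimes>\<^bsub>hom_group A B\<^esub> g \<in> carrier (hom_group A B)"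
      by (auto simp: hom_group_def hom B.m_ac intro!: homI)
  qed (auto simp: hom_group_def hom B.m_ac intro!: homI restrict_ext)
qed

lemma hom_groupD:
  assumes "f \<in> carrier (hom_group A B)"
  shows "f \<in> hom A B" "\<And>u. u \<in> carrier A \<Longrightarrow> f u \<in> carrier B"
  using assms by (auto simp: hom_group_def hom_def)

lemma hom_group_eqI:
  assumes "f \<in> carrier (hom_group A B)" "f' \<in> carrier (hom_group A B)"
    and "\<And>u. u \<in> carrier A \<Longrightarrow> f u = f' u"
  shows "f = f'"
  using assms by (auto simp: hom_group_def intro: extensionalityI)

lemma restrict_hom_group:
  assumes "group A" "f \<in> hom A B"
  shows "restrict f (carrier A) \<in> carrier (hom_group A B)"
proof -
  interpret group A by fact
  show ?thesis
    using assms(2) by (auto simp: hom_group_def hom_def)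
qed

lemma evaluation_hom:
  assumes "u \<in> carrier A"
  shows "(\<lambda>f. f u) \<in> hom (hom_group A B) B"
  using assms by (auto simp: hom_group_def intro!: homI dest: hom_in_carrier)

lemma finprod_hom_group_apply:
  assumes "group A" "comm_group B" "F \<in> I \<rightarrow> carrier (hom_group A B)" "u \<in> carrier A"
  shows "(finprod (hom_group A B) F I) u = finprod B (\<lambda>i. F i u) I"
  using hom_finprod[OF comm_group_hom_group[OF assms(1,2)] assms(2) evaluation_hom[OF assms(4)] assms(3)] .

lemma int_pow_hom_group_apply:
  assumes "group A" "comm_group B" "f \<in> carrier (hom_group A B)" "u \<in> carrier A"
  shows "(f [^]\<^bsub>hom_group A B\<^esub> (k::int)) u = f u [^]\<^bsub>B\<^esub> k"
proof -
  interpret H: comm_group "hom_group A B"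
    using assms by (intro comm_group_hom_group)
  interpret B: comm_group B by fact
  interpret group_hom "hom_group A B" B "\<lambda>f. f u"
    using evaluation_hom[OF assms(4)] by unfold_locales
  show ?thesis
    by (rule hom_int_pow[OF assms(3)])
qed

section \<open>Extension of homomorphisms to divisible groups\<close>

text \<open>Two elements of the union already lie in a common member of the chain. This provides the
  upper bounds for Zorn's lemma in \<open>hom_extension_divisible\<close>.\<close>

lemma chain_Union_subgroup:
  assumes "group P" "C \<noteq> {}" "subset.chain A C" "\<And>R. R \<in> C \<Longrightarrow> subgroup R P"
  shows "subgroup (\<Union>C) P"
proof -
  interpret group P by fact
  show ?thesis
  proof (rule subgroupI)
    show "\<Union>C \<subseteq> carrier P"
      using assms(4) subgroup.subset by blast
    show "\<Union>C \<noteq> {}"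
      using assms(2,4) subgroup.one_closed by blast
    show "inv\<^bsub>P\<^esub> a \<in> \<Union>C" if "a \<in> \<Union>C" for a
    proof -
      from that obtain R where "R \<in> C" "a \<in> R"
        by blast
      then show ?thesis
        using subgroup.m_inv_closed[OF assms(4)[of R]] by blast
    qed
    fix a b assume "a \<in> \<Union>C" "b \<in> \<Union>C"
    then obtain R S where "R \<in> C" "a \<in> R" "S \<in> C" "b \<in> S"
      by blast
    moreover have "R \<subseteq> S \<or> S \<subseteq> R"
      using assms(3) \<open>R \<in> C\<close> \<open>S \<in> C\<close> by (auto simp: subset.chain_def)
    ultimately show "a \<otimes>\<^bsub>P\<^esub> b \<in> \<Union>C"
      using assms(4) by (meson UnionI subgroup.m_closed subsetD)
  qed
qed

lemma int_pow_DirProd: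
  assumes "group A" "group B" "a \<in> carrier A" "b \<in> carrier B"
  shows "(a, b) [^]\<^bsub>A \<times>\<times> B\<^esub> (k::int) = (a [^]\<^bsub>A\<^esub> k, b [^]\<^bsub>B\<^esub> k)"
proof -
  interpret A: group A by fact
  interpret B: group B by fact
  interpret P: group "A \<times>\<times> B"
    using assms by (intro DirProd_group)
  interpret f: group_hom "A \<times>\<times> B" A fst
    by unfold_locales (auto intro: homI)
  interpret s: group_hom "A \<times>\<times> B" B snd
    by unfold_locales (auto intro: homI)
  have "fst ((a, b) [^]\<^bsub>A \<times>\<times> B\<^esub> k) = a [^]\<^bsub>A\<^esub> k" "snd ((a, b) [^]\<^bsub>A \<times>\<times> B\<^esub> k) = b [^]\<^bsub>B\<^esub> k"
    using assms f.hom_int_pow[of "(a, b)" k] s.hom_int_pow[of "(a, b)" k] by auto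
  then show ?thesis
    by (metis prod.collapse)
qed

text \<open>By commutativity the products r p^k are closed under multiplication and inversion. With
  R a graph and p = (a, d) this is the extension of a partial homomorphism by the value d at
  a.\<close>

lemma (in comm_group) subgroup_insert_powers:
  assumes "subgroup R G" "p \<in> carrier G"
  shows "subgroup {r \<otimes> p [^] k |r k::int. r \<in> R} G"
proof -
  interpret R: subgroup R G by fact
  note [simp] = assms(2)
  show ?thesis
  proof (rule subgroupI)
    show "{r \<otimes> p [^] k |r k::int. r \<in> R} \<noteq> {}"
      using R.one_closed by blast
    show "inv a \<in> {r \<otimes> p [^] k |r k::int. r \<in> R}"
      if "a \<in> {r \<otimes> p [^] k |r k::int. r \<in> R}" for a
    proof -
      obtain r k where "a = r \<otimes> p [^] (k::int)" "r \<in> R"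
        using \<open>a \<in> _\<close> by blast
      then have "inv a = inv r \<otimes> p [^] (- k)"
        by (simp add: inv_mult int_pow_neg)
      then show ?thesis
        using \<open>r \<in> R\<close> by blast
    qed
    fix a b assume "a \<in> {r \<otimes> p [^] k |r k::int. r \<in> R}" "b \<in> {r \<otimes> p [^] k |r k::int. r \<in> R}"
    then obtain r k s l where "a = r \<otimes> p [^] (k::int)" "r \<in> R" "b = s \<otimes> p [^] (l::int)" "s \<in> R"
      by blast
    then have "a \<otimes> b = (r \<otimes> s) \<otimes> p [^] (k + l)" "r \<otimes> s \<in> R"
      by (simp_all add: int_pow_mult m_ac)
    then show "a \<otimes> b \<in> {r \<otimes> p [^] k |r k::int. r \<in> R}"
      by blast
  qed auto
qed

text \<open>A homomorphism defined on a subgroup is identified with its graph, a subgroup \<open>R\<close> of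
  \<open>A \<times> D\<close> that meets \<open>1 \<times> D\<close> trivially. Divisibility provides a value at a new element \<open>a\<close>.\<close>

lemma divisible_value:
  assumes "comm_group A" "comm_group D"
    and div: "\<And>y k. \<lbrakk>y \<in> carrier D; k > 0\<rbrakk> \<Longrightarrow> \<exists>x\<in>carrier D. x [^]\<^bsub>D\<^esub> (k::int) = y"
    and R: "subgroup R (A \<times>\<times> D)" "\<And>y. (\<one>\<^bsub>A\<^esub>, y) \<in> R \<Longrightarrow> y = \<one>\<^bsub>D\<^esub>"
    and a: "a \<in> carrier A"
  obtains d where "d \<in> carrier D" "\<And>m y. (a [^]\<^bsub>A\<^esub> (m::int), y) \<in> R \<Longrightarrow> d [^]\<^bsub>D\<^esub> m = y"
proof -
  interpret A: comm_group A by fact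
  interpret D: comm_group D by fact
  interpret P: group "A \<times>\<times> D"
    by (intro DirProd_group A.group_axioms D.group_axioms)
  interpret R: subgroup R "A \<times>\<times> D" by fact
  have R_carrier: "x \<in> carrier A" "y \<in> carrier D" if "(x, y) \<in> R" for x y
    using that R.subset by auto
  have R_mult: "(x \<otimes>\<^bsub>A\<^esub> x', y \<otimes>\<^bsub>D\<^esub> y') \<in> R" if "(x, y) \<in> R" "(x', y') \<in> R" for x y x' y'
    using R.m_closed[OF that] by simp
  have R_inv: "(inv\<^bsub>A\<^esub> x, inv\<^bsub>D\<^esub> y) \<in> R" if "(x, y) \<in> R" for x y
    using R.m_inv_closed[OF that] R_carrier[OF that] A.group_axioms D.group_axioms by simp
  \<comment> \<open>Two values at the same x differ by an element of R over the identity of A, so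
    trivial intersection with the second factor makes R single-valued.\<close>
  have R_unique: "y = y'" if "(x, y) \<in> R" "(x, y') \<in> R" for x y y'
  proof -
    have "(x \<otimes>\<^bsub>A\<^esub> inv\<^bsub>A\<^esub> x, y \<otimes>\<^bsub>D\<^esub> inv\<^bsub>D\<^esub> y') \<in> R"
      using R_mult[OF that(1) R_inv[OF that(2)]] .
    then have "y \<otimes>\<^bsub>D\<^esub> inv\<^bsub>D\<^esub> y' = \<one>\<^bsub>D\<^esub>"
      using R(2) R_carrier that by simp
    then show ?thesis
      using R_carrier that D.inv_unique' D.inv_equality by (metis D.inv_closed D.inv_inv)
  qed
  have R_pow: "(x [^]\<^bsub>A\<^esub> k, y [^]\<^bsub>D\<^esub> k) \<in> R" if "(x, y) \<in> R" for x y and k :: int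
    using P.subgroup_int_pow_closed[OF R(1) that, of k] R_carrier[OF that]
    by (simp add: int_pow_DirProd A.group_axioms D.group_axioms)
  \<comment> \<open>The exponents m for which a^m lies in the domain of R form a subgroup of the
    integers; \<open>Q\<close> picks out its positive members.\<close>
  define Q where "Q k \<longleftrightarrow> k > 0 \<and> (\<exists>y. (a [^]\<^bsub>A\<^esub> int k, y) \<in> R)" for k
  show thesis
  proof (cases "\<exists>k. Q k")
    case False
    show thesis
    proof (rule that[of "\<one>\<^bsub>D\<^esub>"])
      fix m :: int and y assume my: "(a [^]\<^bsub>A\<^esub> m, y) \<in> R"
      \<comment> \<open>Multiplying a nonzero exponent by its sign would give a positive one,
        contrary to the case assumption. Hence no power of a other than the trivial one imposes a
        condition, and the identity serves as value at a.\<close>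
      have "m = 0"
      proof (rule ccontr)
        assume "m \<noteq> 0"
        have "(a [^]\<^bsub>A\<^esub> (m * sgn m), y [^]\<^bsub>D\<^esub> sgn m) \<in> R"
          using R_pow[OF my, of "sgn m"] a by (simp add: A.int_pow_pow)
        then have "(a [^]\<^bsub>A\<^esub> int (nat \<bar>m\<bar>), y [^]\<^bsub>D\<^esub> sgn m) \<in> R"
          by (simp only: abs_sgn[symmetric] int_nat_eq abs_ge_zero if_True)
        with \<open>m \<noteq> 0\<close> have "Q (nat \<bar>m\<bar>)"
          by (auto simp: Q_def simp del: int_nat_eq)
        with False show False
          by blast
      qed
      with my show "\<one>\<^bsub>D\<^esub> [^]\<^bsub>D\<^esub> m = y"
        using R(2) by simp
    qed simp
  next
    case True
    then obtain k where "Q k" and least: "\<And>l. Q l \<Longrightarrow> k \<le> l"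
      using exists_least_iff[of Q] by (metis linorder_not_le)
    then obtain y0 where k: "k > 0" and y0: "(a [^]\<^bsub>A\<^esub> int k, y0) \<in> R"
      by (auto simp: Q_def)
    \<comment> \<open>The value at a has to be a k-th root of the value prescribed at a^k, where k
      generates the group of admissible exponents. Divisibility supplies one.\<close>
    obtain d where d: "d \<in> carrier D" "d [^]\<^bsub>D\<^esub> int k = y0"
      using div[of y0 "int k"] R_carrier[OF y0] k by auto
    show thesis
    proof (rule that[OF d(1)])
      fix m :: int and y assume my: "(a [^]\<^bsub>A\<^esub> m, y) \<in> R"
      \<comment> \<open>Division with remainder: a^(m mod k) is again in the domain, so minimality
        of k forces m mod k = 0.\<close>
      let ?q = "m div int k"
      have pow: "(a [^]\<^bsub>A\<^esub> (int k * ?q), d [^]\<^bsub>D\<^esub> (int k * ?q)) \<in> R"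
        using R_pow[OF y0, of ?q] D.int_pow_pow[OF d(1), of "int k" ?q] a d(2)
        by (simp add: A.int_pow_pow)
      have "(a [^]\<^bsub>A\<^esub> (m - int k * ?q), y \<otimes>\<^bsub>D\<^esub> inv\<^bsub>D\<^esub> (d [^]\<^bsub>D\<^esub> (int k * ?q))) \<in> R"
        using R_mult[OF my R_inv[OF pow]] a by (simp add: A.int_pow_diff)
      then have "(a [^]\<^bsub>A\<^esub> int (nat (m mod int k)), y \<otimes>\<^bsub>D\<^esub> inv\<^bsub>D\<^esub> (d [^]\<^bsub>D\<^esub> (int k * ?q))) \<in> R"
        using k by (simp add: minus_mult_div_eq_mod)
      then have "Q (nat (m mod int k)) \<or> nat (m mod int k) = 0"
        by (auto simp: Q_def simp del: int_nat_eq)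
      moreover have "nat (m mod int k) < k"
        using k by (simp add: nat_less_iff)
      ultimately have "nat (m mod int k) = 0"
        using least by (meson leD)
      then have "m mod int k = 0"
        using k pos_mod_sign[of "int k" m] by linarith
      then have "int k * ?q = m"
        using mult_div_mod_eq[of "int k" m] by linarith
      with pow have "(a [^]\<^bsub>A\<^esub> m, d [^]\<^bsub>D\<^esub> m) \<in> R"
        by (simp only:)
      then show "d [^]\<^bsub>D\<^esub> m = y"
        using my R_unique by blast
    qed
  qed
qed

text \<open>Divisible groups are injective. Zorn's lemma yields a maximal single-valued subgroup of
  A x D containing the graph of f; if it had no value at some a, the pair (a, d) from
  \<open>divisible_value\<close> could be adjoined.\<close>

lemma hom_extension_divisible:
  assumes "comm_group A" "comm_group D"
    and div: "\<And>y k. \<lbrakk>y \<in> carrier D; k > 0\<rbrakk> \<Longrightarrow> \<exists>x\<in>carrier D. x [^]\<^bsub>D\<^esub> (k::int) = y"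
    and H: "subgroup H A" and f: "f \<in> hom (A\<lparr>carrier := H\<rparr>) D"
  obtains F where "F \<in> hom A D" "\<And>x. x \<in> H \<Longrightarrow> F x = f x"
proof -
  interpret A: comm_group A by fact
  interpret D: comm_group D by fact
  interpret P: comm_group "A \<times>\<times> D"
    using DirProd_group[OF A.group_axioms D.group_axioms]
    by (rule group.group_comm_groupI) (auto simp: A.m_comm D.m_comm)
  interpret H: subgroup H A by fact
  have grp_H: "group (A\<lparr>carrier := H\<rparr>)"
    using A.subgroup_imp_group[OF H] .
  interpret f: group_hom "A\<lparr>carrier := H\<rparr>" D f
    using f grp_H by (simp add: group_hom_def group_hom_axioms_def D.group_axioms)
  have f_one: "f \<one>\<^bsub>A\<^esub> = \<one>\<^bsub>D\<^esub>"
    using f.hom_one by simp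
  define S where "S = {R. subgroup R (A \<times>\<times> D) \<and> (\<forall>y. (\<one>\<^bsub>A\<^esub>, y) \<in> R \<longrightarrow> y = \<one>\<^bsub>D\<^esub>) \<and>
    (\<forall>x\<in>H. (x, f x) \<in> R)}"
  have "(\<lambda>x. (x, f x)) ` H \<in> S"
  proof -
    have "subgroup ((\<lambda>x. (x, f x)) ` H) (A \<times>\<times> D)"
    proof (rule P.subgroupI)
      show "(\<lambda>x. (x, f x)) ` H \<subseteq> carrier (A \<times>\<times> D)"
        using H.subset f.hom_closed by auto
      show "(\<lambda>x. (x, f x)) ` H \<noteq> {}"
        using H.one_closed by blast
      show "inv\<^bsub>A \<times>\<times> D\<^esub> a \<in> (\<lambda>x. (x, f x)) ` H" if "a \<in> (\<lambda>x. (x, f x)) ` H" for a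
      proof -
        from that obtain x where x: "x \<in> H" "a = (x, f x)"
          by blast
        then have "f (inv\<^bsub>A\<^esub> x) = inv\<^bsub>D\<^esub> f x"
          using f.hom_inv[of x] A.m_inv_consistent[OF H x(1)] by simp
        then have "inv\<^bsub>A \<times>\<times> D\<^esub> a = (inv\<^bsub>A\<^esub> x, f (inv\<^bsub>A\<^esub> x))"
          using x f.hom_closed[of x] by (simp add: A.group_axioms D.group_axioms)
        then show ?thesis
          using x by blast
      qed
      show "a \<otimes>\<^bsub>A \<times>\<times> D\<^esub> b \<in> (\<lambda>x. (x, f x)) ` H"
        if ab: "a \<in> (\<lambda>x. (x, f x)) ` H" "b \<in> (\<lambda>x. (x, f x)) ` H" for a b
      proof -
        obtain x y where "x \<in> H" "a = (x, f x)" "y \<in> H" "b = (y, f y)"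
          using ab by blast
        then show ?thesis
          using f.hom_mult[of x y] by (auto intro!: image_eqI[where x = "x \<otimes>\<^bsub>A\<^esub> y"])
      qed
    qed
    then show ?thesis
      using f_one by (auto simp: S_def)
  qed
  moreover have "\<Union>C \<in> S" if C: "C \<noteq> {}" "subset.chain S C" for C
  proof -
    have "C \<subseteq> S"
      using C(2) by (simp add: subset.chain_def)
    then show ?thesis
      using chain_Union_subgroup[OF P.group_axioms C] C(1) by (auto simp: S_def subset_iff)
  qed
  ultimately obtain R where "R \<in> S" and max: "\<And>X. \<lbrakk>X \<in> S; R \<subseteq> X\<rbrakk> \<Longrightarrow> X = R"
    using subset_Zorn_nonempty[of S] by blast
  then have R: "subgroup R (A \<times>\<times> D)" "\<And>y. (\<one>\<^bsub>A\<^esub>, y) \<in> R \<Longrightarrow> y = \<one>\<^bsub>D\<^esub>"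
    and graph: "\<And>x. x \<in> H \<Longrightarrow> (x, f x) \<in> R"
    by (auto simp: S_def)
  interpret R: subgroup R "A \<times>\<times> D" by fact
  have R_carrier: "x \<in> carrier A" "y \<in> carrier D" if "(x, y) \<in> R" for x y
    using that R.subset by auto
  have R_unique: "y = y'" if "(x, y) \<in> R" "(x, y') \<in> R" for x y y'
  proof -
    have "(x, y) \<otimes>\<^bsub>A \<times>\<times> D\<^esub> inv\<^bsub>A \<times>\<times> D\<^esub> (x, y') \<in> R"
      using that by (intro R.m_closed R.m_inv_closed)
    then have "y \<otimes>\<^bsub>D\<^esub> inv\<^bsub>D\<^esub> y' = \<one>\<^bsub>D\<^esub>"
      using R(2) R_carrier that A.group_axioms D.group_axioms by simp
    then show ?thesis
      using R_carrier that by (metis D.inv_closed D.inv_inv D.inv_equality)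
  qed
  have total: "\<exists>y. (a, y) \<in> R" if a: "a \<in> carrier A" for a
  proof -
    obtain d where d: "d \<in> carrier D"
      and val: "\<And>m y. (a [^]\<^bsub>A\<^esub> (m::int), y) \<in> R \<Longrightarrow> d [^]\<^bsub>D\<^esub> m = y"
      using divisible_value[OF assms(1,2) div R a] by blast
    let ?R = "{r \<otimes>\<^bsub>A \<times>\<times> D\<^esub> (a, d) [^]\<^bsub>A \<times>\<times> D\<^esub> k |r k::int. r \<in> R}"
    have ad: "(a, d) \<in> carrier (A \<times>\<times> D)"
      using a d by simp
    have "R \<subseteq> ?R"
    proof
      fix r assume "r \<in> R"
      then have "r = r \<otimes>\<^bsub>A \<times>\<times> D\<^esub> (a, d) [^]\<^bsub>A \<times>\<times> D\<^esub> (0::int)"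
        using P.r_one[OF R.mem_carrier] by (simp only: int_pow_0)
      then show "r \<in> ?R"
        using \<open>r \<in> R\<close> by blast
    qed
    \<comment> \<open>An element of the enlarged relation over the identity comes from (u, v) in R
      with a^k the inverse of u. Then a^k lies in the domain of R, so d^k is its value there, the
      inverse of v, and the second coordinate cancels.\<close>
    moreover have "y = \<one>\<^bsub>D\<^esub>" if "(\<one>\<^bsub>A\<^esub>, y) \<in> ?R" for y
    proof -
      from that obtain u v and k :: int
        where uv: "(u, v) \<in> R" and "(\<one>\<^bsub>A\<^esub>, y) = (u, v) \<otimes>\<^bsub>A \<times>\<times> D\<^esub> (a, d) [^]\<^bsub>A \<times>\<times> D\<^esub> k"
        by auto
      then have one: "u \<otimes>\<^bsub>A\<^esub> a [^]\<^bsub>A\<^esub> k = \<one>\<^bsub>A\<^esub>" and y: "y = v \<otimes>\<^bsub>D\<^esub> d [^]\<^bsub>D\<^esub> k"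
        using a d by (simp_all add: int_pow_DirProd A.group_axioms D.group_axioms)
      have "inv\<^bsub>A\<^esub> u = a [^]\<^bsub>A\<^esub> k"
        using one R_carrier[OF uv] a by (metis A.inv_equality A.m_comm A.int_pow_closed)
      then have "(a [^]\<^bsub>A\<^esub> k, inv\<^bsub>D\<^esub> v) \<in> R"
        using R.m_inv_closed[OF uv] R_carrier[OF uv] A.group_axioms D.group_axioms by simp
      then have "d [^]\<^bsub>D\<^esub> k = inv\<^bsub>D\<^esub> v"
        by (rule val)
      then show "y = \<one>\<^bsub>D\<^esub>"
        using y R_carrier[OF uv] by simp
    qed
    moreover have "(x, f x) \<in> ?R" if "x \<in> H" for x
      using graph[OF that] \<open>R \<subseteq> ?R\<close> by (rule rev_subsetD)
    ultimately have "?R \<in> S"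
      unfolding S_def using P.subgroup_insert_powers[OF R(1) ad] by blast
    \<comment> \<open>Maximality shows that the enlarged relation, which contains (a, d), was
      already R.\<close>
    then have "?R = R"
      using max \<open>R \<subseteq> ?R\<close> by blast
    moreover have "(a, d) = \<one>\<^bsub>A \<times>\<times> D\<^esub> \<otimes>\<^bsub>A \<times>\<times> D\<^esub> (a, d) [^]\<^bsub>A \<times>\<times> D\<^esub> (1::int)"
      using P.l_one[OF ad] P.int_pow_1[OF ad] by (simp del: one_DirProd)
    then have "(a, d) \<in> ?R"
      using R.one_closed by blast
    ultimately show ?thesis
      by blast
  qed
  define F where "F x = (THE y. (x, y) \<in> R)" for x
  have F_eq: "F x = y" if "(x, y) \<in> R" for x y
    unfolding F_def using that R_unique by blast
  have F: "(x, F x) \<in> R" if "x \<in> carrier A" for x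
    using total[OF that] F_eq by metis
  show thesis
  proof (rule that)
    show "F \<in> hom A D"
    proof (rule homI)
      show "F x \<in> carrier D" if "x \<in> carrier A" for x
        using F[OF that] R_carrier by blast
      show "F (x \<otimes>\<^bsub>A\<^esub> y) = F x \<otimes>\<^bsub>D\<^esub> F y" if "x \<in> carrier A" "y \<in> carrier A" for x y
        using R.m_closed[OF F[OF that(1)] F[OF that(2)]] by (intro F_eq) simp
    qed
    show "F x = f x" if "x \<in> H" for x
      using graph[OF that] by (rule F_eq)
  qed
qed

text \<open>Exactness of Hom(-, D): a homomorphism killing the kernel of d is defined on the image
  of d, and injectivity of D extends it to all of B.\<close>

lemma hom_factor_divisible:
  assumes "comm_group A" "comm_group B" "comm_group D"
    and div: "\<And>y k. \<lbrakk>y \<in> carrier D; k > 0\<rbrakk> \<Longrightarrow> \<exists>x\<in>carrier D. x [^]\<^bsub>D\<^esub> (k::int) = y"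
    and d: "d \<in> hom A B" and f: "f \<in> hom A D"
    and ker: "\<And>x. \<lbrakk>x \<in> carrier A; d x = \<one>\<^bsub>B\<^esub>\<rbrakk> \<Longrightarrow> f x = \<one>\<^bsub>D\<^esub>"
  obtains F where "F \<in> hom B D" "\<And>x. x \<in> carrier A \<Longrightarrow> f x = F (d x)"
proof -
  interpret A: comm_group A by fact
  interpret B: comm_group B by fact
  interpret D: comm_group D by fact
  interpret d: group_hom A B d
    using d by unfold_locales
  interpret f: group_hom A D f
    using f by unfold_locales
  have cong: "f x = f y" if "x \<in> carrier A" "y \<in> carrier A" "d x = d y" for x y
  proof -
    have "f (x \<otimes>\<^bsub>A\<^esub> inv\<^bsub>A\<^esub> y) = \<one>\<^bsub>D\<^esub>"
      using that by (intro ker) auto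
    then have "f x \<otimes>\<^bsub>D\<^esub> inv\<^bsub>D\<^esub> f y = \<one>\<^bsub>D\<^esub>"
      using that by simp
    then show ?thesis
      using that by (metis D.inv_closed D.inv_equality D.inv_inv f.hom_closed)
  qed
  \<comment> \<open>Only the values of \<open>g\<close> on the image of d are controlled; everywhere
    else it is arbitrary, so it is used solely as a homomorphism on that image.\<close>
  obtain g where g: "\<And>x. x \<in> carrier A \<Longrightarrow> f x = g (d x)"
    using function_factors_left_gen[of "\<lambda>x. x \<in> carrier A" d f] cong by blast
  have "g \<in> hom (B\<lparr>carrier := d ` carrier A\<rparr>) D"
  proof (rule homI)
    fix x y assume "x \<in> carrier (B\<lparr>carrier := d ` carrier A\<rparr>)" "y \<in> carrier (B\<lparr>carrier := d ` carrier A\<rparr>)"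
    then obtain x' y' where "x' \<in> carrier A" "x = d x'" "y' \<in> carrier A" "y = d y'"
      by auto
    then show "g (x \<otimes>\<^bsub>B\<lparr>carrier := d ` carrier A\<rparr>\<^esub> y) = g x \<otimes>\<^bsub>D\<^esub> g y"
      using g[of "x' \<otimes>\<^bsub>A\<^esub> y'"] g[of x'] g[of y'] by simp
  qed (auto simp flip: g)
  then obtain F where "F \<in> hom B D" "\<And>x. x \<in> d ` carrier A \<Longrightarrow> F x = g x"
    using hom_extension_divisible[OF assms(2,3) div d.img_is_subgroup] by metis
  with g that show thesis
    by simp
qed

section \<open>Duals of quotients\<close>

text \<open>The common frame of both dualities: X consists of the cocycles of the dual complex, K
  and N of the cocycles and coboundaries of the original one. Since \<beta> x kills N, it induces a
  character of K/N; the map so obtained has kernel I and is onto by the last hypothesis, and the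
  first isomorphism theorem applies.\<close>

lemma quotient_pairing_iso:
  assumes "group X" "comm_group K" "subgroup N K" "comm_group B"
    and \<beta>: "\<And>x. x \<in> carrier X \<Longrightarrow> \<beta> x \<in> hom K B"
    and mult: "\<And>x y k. \<lbrakk>x \<in> carrier X; y \<in> carrier X; k \<in> carrier K\<rbrakk> \<Longrightarrow>
      \<beta> (x \<otimes>\<^bsub>X\<^esub> y) k = \<beta> x k \<otimes>\<^bsub>B\<^esub> \<beta> y k"
    and N: "\<And>x k. \<lbrakk>x \<in> carrier X; k \<in> N\<rbrakk> \<Longrightarrow> \<beta> x k = \<one>\<^bsub>B\<^esub>"
    and ker: "I = {x \<in> carrier X. \<forall>k\<in>carrier K. \<beta> x k = \<one>\<^bsub>B\<^esub>}"
    and surj: "\<And>\<chi>. \<lbrakk>\<chi> \<in> hom K B; \<And>k. k \<in> N \<Longrightarrow> \<chi> k = \<one>\<^bsub>B\<^esub>\<rbrakk> \<Longrightarrow>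
      \<exists>x\<in>carrier X. \<forall>k\<in>carrier K. \<beta> x k = \<chi> k"
  shows "X Mod I \<cong> hom_group (K Mod N) B"
proof -
  interpret X: group X by fact
  interpret K: comm_group K by fact
  interpret B: comm_group B by fact
  interpret N: normal N K
    using assms(3) by (simp add: K.normal_iff_subgroup)
  interpret Q: comm_group "K Mod N"
    using K.abelian_FactGroup[OF assms(3)] .
  interpret H: comm_group "hom_group (K Mod N) B"
    by (intro comm_group_hom_group) unfold_locales
  let ?P = "\<lambda>x g. g \<in> carrier (hom_group (K Mod N) B) \<and> (\<forall>k\<in>carrier K. g (N #>\<^bsub>K\<^esub> k) = \<beta> x k)"
  have ex: "\<exists>g. ?P x g" if x: "x \<in> carrier X" for x
  proof -
    interpret \<beta>: group_hom K B "\<beta> x"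
      using \<beta>[OF x] by unfold_locales
    have "N \<subseteq> kernel K B (\<beta> x)"
      using N[OF x] by (auto simp: kernel_def)
    then obtain g where g: "g \<in> hom (K Mod N) B" "\<And>k. k \<in> carrier K \<Longrightarrow> g (N #>\<^bsub>K\<^esub> k) = \<beta> x k"
      using \<beta>.FactGroup_universal_kernel[OF N.normal_axioms] by blast
    then show ?thesis
      using restrict_hom_group[OF Q.group_axioms g(1)]
      by (intro exI[where x = "restrict g (carrier (K Mod N))"]) (auto simp: carrier_FactGroup)
  qed
  \<comment> \<open>The choice is forced: an element of \<open>hom_group (K Mod N) B\<close> is
    determined by its values on the cosets of N. This uniqueness (\<open>eqI\<close>) is also what
    makes \<Theta> multiplicative.\<close>
  define \<Theta> where "\<Theta> x = (SOME g. ?P x g)" for x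
  have \<Theta>: "\<Theta> x \<in> carrier (hom_group (K Mod N) B)"
    "\<And>k. k \<in> carrier K \<Longrightarrow> \<Theta> x (N #>\<^bsub>K\<^esub> k) = \<beta> x k" if "x \<in> carrier X" for x
    using someI_ex[OF ex[OF that]] by (auto simp: \<Theta>_def)
  have eqI: "g = g'" if "g \<in> carrier (hom_group (K Mod N) B)" "g' \<in> carrier (hom_group (K Mod N) B)"
    "\<And>k. k \<in> carrier K \<Longrightarrow> g (N #>\<^bsub>K\<^esub> k) = g' (N #>\<^bsub>K\<^esub> k)" for g g'
    by (rule hom_group_eqI[OF that(1,2)]) (auto simp: carrier_FactGroup that(3))
  have mult_apply: "(g \<otimes>\<^bsub>hom_group (K Mod N) B\<^esub> g') (N #>\<^bsub>K\<^esub> k) = g (N #>\<^bsub>K\<^esub> k) \<otimes>\<^bsub>B\<^esub> g' (N #>\<^bsub>K\<^esub> k)"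
    if "k \<in> carrier K" for g g' k
    using that by (simp add: hom_group_def carrier_FactGroup)
  have one_apply: "\<one>\<^bsub>hom_group (K Mod N) B\<^esub> (N #>\<^bsub>K\<^esub> k) = \<one>\<^bsub>B\<^esub>" if "k \<in> carrier K" for k
    using that by (simp add: hom_group_def carrier_FactGroup)
  interpret \<Theta>: group_hom X "hom_group (K Mod N) B" \<Theta>
    by unfold_locales (auto intro!: homI eqI simp: \<Theta> mult_apply mult)
  have "\<Theta> ` carrier X = carrier (hom_group (K Mod N) B)"
  proof (intro equalityI subsetI)
    fix g assume g: "g \<in> carrier (hom_group (K Mod N) B)"
    have hom: "(\<lambda>k. g (N #>\<^bsub>K\<^esub> k)) \<in> hom K B"
      using hom_compose[OF N.r_coset_hom_Mod hom_groupD(1)[OF g]] by (simp add: comp_def)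
    have "N #>\<^bsub>K\<^esub> k = \<one>\<^bsub>K Mod N\<^esub>" if "k \<in> N" for k
      using K.coset_join2[OF N.mem_carrier[OF that] assms(3) that] by simp
    moreover have "g \<one>\<^bsub>K Mod N\<^esub> = \<one>\<^bsub>B\<^esub>"
      using hom_one[OF hom_groupD(1)[OF g] Q.group_axioms B.group_axioms] .
    ultimately have "\<exists>x\<in>carrier X. \<forall>k\<in>carrier K. \<beta> x k = g (N #>\<^bsub>K\<^esub> k)"
      using surj[OF hom] by simp
    then obtain x where "x \<in> carrier X" "\<And>k. k \<in> carrier K \<Longrightarrow> \<beta> x k = g (N #>\<^bsub>K\<^esub> k)"
      by blast
    then have "\<Theta> x = g"
      by (intro eqI) (auto simp: \<Theta> g)
    then show "g \<in> \<Theta> ` carrier X"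
      using \<open>x \<in> carrier X\<close> by blast
  qed (auto simp: \<Theta>)
  then have "X Mod kernel X (hom_group (K Mod N) B) \<Theta> \<cong> hom_group (K Mod N) B"
    by (rule \<Theta>.FactGroup_iso)
  moreover have "kernel X (hom_group (K Mod N) B) \<Theta> = I"
  proof -
    have "\<Theta> x = \<one>\<^bsub>hom_group (K Mod N) B\<^esub> \<longleftrightarrow> (\<forall>k\<in>carrier K. \<beta> x k = \<one>\<^bsub>B\<^esub>)" if "x \<in> carrier X" for x
    proof
      assume "\<Theta> x = \<one>\<^bsub>hom_group (K Mod N) B\<^esub>"
      then show "\<forall>k\<in>carrier K. \<beta> x k = \<one>\<^bsub>B\<^esub>"
        using \<Theta>(2)[OF that] one_apply by metis
    next
      assume "\<forall>k\<in>carrier K. \<beta> x k = \<one>\<^bsub>B\<^esub>"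
      then show "\<Theta> x = \<one>\<^bsub>hom_group (K Mod N) B\<^esub>"
        using that by (intro eqI) (auto simp: \<Theta> one_apply)
    qed
    then show ?thesis
      by (auto simp: kernel_def ker)
  qed
  ultimately show ?thesis
    by simp
qed

section \<open>Rational numbers modulo integers\<close>

lemma carrier_rational_group [simp]: "carrier rational_group = UNIV"
  and mult_rational_group [simp]: "x \<otimes>\<^bsub>rational_group\<^esub> y = x + y"
  and one_rational_group [simp]: "\<one>\<^bsub>rational_group\<^esub> = 0"
  by (simp_all add: rational_group_def)

lemma comm_group_rational_group: "comm_group rational_group"
proof (rule comm_groupI)
  fix x assume "x \<in> carrier rational_group"
  show "\<exists>y\<in>carrier rational_group. y \<otimes>\<^bsub>rational_group\<^esub> x = \<one>\<^bsub>rational_group\<^esub>"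
    by (intro bexI[where x = "- x"]) auto
qed auto

lemma inv_rational_group [simp]: "inv\<^bsub>rational_group\<^esub> x = - x"
  using comm_group_rational_group by (intro group.inv_equality) (auto simp: comm_group_def)

lemma subgroup_Ints: "subgroup \<int> rational_group"
  using comm_group_rational_group by (intro group.subgroupI) (auto simp: comm_group_def)

lemma comm_group_rationals_mod_integers: "comm_group rationals_mod_integers"
  unfolding rationals_mod_integers_def
  by (intro comm_group.abelian_FactGroup comm_group_rational_group subgroup_Ints)

text \<open>The projection from the rationals to Q/Z; its value is a whole coset, not a
  representative in the unit interval.\<close>

definition fractional_part :: "rat \<Rightarrow> rat set" where
  "fractional_part q = \<int> #>\<^bsub>rational_group\<^esub> q"

lemma fractional_part_hom: "fractional_part \<in> hom rational_group rationals_mod_integers"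
proof -
  interpret normal \<int> rational_group
    using comm_group.normal_iff_subgroup[OF comm_group_rational_group] subgroup_Ints by simp
  show ?thesis
    using r_coset_hom_Mod by (simp add: fractional_part_def[abs_def] rationals_mod_integers_def)
qed

lemma fractional_part_surj:
  "fractional_part ` carrier rational_group = carrier rationals_mod_integers"
  by (auto simp: fractional_part_def rationals_mod_integers_def carrier_FactGroup)

lemma fractional_part_eq_one_iff: "fractional_part q = \<one>\<^bsub>rationals_mod_integers\<^esub> \<longleftrightarrow> q \<in> \<int>"
proof -
  interpret comm_group rational_group
    by (rule comm_group_rational_group)
  have "\<int> #>\<^bsub>rational_group\<^esub> q = \<int> \<longleftrightarrow> q \<in> \<int>"
    using rcos_self[OF _ subgroup_Ints, of q] coset_join2[OF _ subgroup_Ints, of q] by fastforce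
  then show ?thesis
    by (simp add: fractional_part_def rationals_mod_integers_def)
qed

interpretation fractional_part:
  group_hom rational_group rationals_mod_integers fractional_part
  using comm_group_rational_group comm_group_rationals_mod_integers fractional_part_hom
  by (simp add: group_hom_def group_hom_axioms_def comm_group_def)

lemma int_pow_rational_group [simp]: "q [^]\<^bsub>rational_group\<^esub> (k::int) = of_int k * q"
proof -
  interpret comm_group rational_group
    by (rule comm_group_rational_group)
  have nat: "q [^]\<^bsub>rational_group\<^esub> (n::nat) = of_nat n * q" for n
    by (induction n) (auto simp: algebra_simps)
  show ?thesis
    by (auto simp: int_pow_def2 nat)
qed

lemma rationals_mod_integers_divisible:
  assumes "y \<in> carrier rationals_mod_integers" "(k::int) > 0"
  shows "\<exists>x\<in>carrier rationals_mod_integers. x [^]\<^bsub>rationals_mod_integers\<^esub> k = y"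
proof -
  obtain q where q: "y = fractional_part q"
    using assms(1) fractional_part_surj by blast
  have "fractional_part (q / of_int k) [^]\<^bsub>rationals_mod_integers\<^esub> k = y"
    using fractional_part.hom_int_pow[of "q / of_int k" k] assms(2) by (simp add: q)
  then show ?thesis
    using fractional_part.hom_closed by force
qed

section \<open>Lifting homomorphisms from free abelian groups\<close>

lemma free_Abelian_group_hom_eqI:
  assumes "group B" "f \<in> hom (free_Abelian_group S) B" "g \<in> hom (free_Abelian_group S) B"
    and gen: "\<And>s. s \<in> S \<Longrightarrow> f (frag_of s) = g (frag_of s)"
    and x: "x \<in> carrier (free_Abelian_group S)"
  shows "f x = g x"
proof -
  interpret f: group_hom "free_Abelian_group S" B f
    using assms by (simp add: group_hom_def group_hom_axioms_def)
  interpret g: group_hom "free_Abelian_group S" B g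
    using assms by (simp add: group_hom_def group_hom_axioms_def)
  have "Poly_Mapping.keys x \<subseteq> S"
    using x by simp
  then show ?thesis
  proof (rule free_Abelian_group_induct)
    show "f 0 = g 0"
      using f.hom_one g.hom_one by simp
    fix a b assume keys: "Poly_Mapping.keys a \<subseteq> S" "Poly_Mapping.keys b \<subseteq> S" and eq: "f a = g a" "f b = g b"
    show "f (a - b) = g (a - b)"
      using keys eq f.hom_mult[of a "- b"] g.hom_mult[of a "- b"] f.hom_inv[of b] g.hom_inv[of b]
      by simp
  qed (rule gen)
qed

text \<open>Free abelian groups are projective: preimages under p of the values on a basis extend by
  the universal property. It will be applied with p the projection of the rationals onto Q/Z, and
  this is how freeness of the lattice enters.\<close>

lemma free_hom_lift:
  assumes "group A" "A \<cong> free_Abelian_group S" "comm_group B" "group C"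
    and p: "p \<in> hom B C" "p ` carrier B = carrier C" and f: "f \<in> hom A C"
  obtains F where "F \<in> hom A B" "\<And>x. x \<in> carrier A \<Longrightarrow> p (F x) = f x"
proof -
  interpret A: group A by fact
  obtain i where i: "i \<in> iso A (free_Abelian_group S)"
    using assms(2) by (auto simp: is_iso_def)
  let ?j = "inv_into (carrier A) i"
  have j: "?j \<in> hom (free_Abelian_group S) A"
    using A.iso_set_sym[OF i] by (simp add: iso_def)
  have "\<exists>b\<in>carrier B. p b = f (?j (frag_of s))" if "s \<in> S" for s
  proof -
    have "f (?j (frag_of s)) \<in> carrier C"
      using hom_in_carrier[OF f hom_in_carrier[OF j]] that by simp
    then show ?thesis
      using p(2) by (metis imageE)
  qed
  then obtain b where b: "\<And>s. s \<in> S \<Longrightarrow> b s \<in> carrier B \<and> p (b s) = f (?j (frag_of s))"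
    by metis
  obtain h where h: "h \<in> hom (free_Abelian_group S) B" "\<And>s. s \<in> S \<Longrightarrow> h (frag_of s) = b s"
    using comm_group.free_Abelian_group_universal[OF assms(3), of b S] b
    by (metis image_subsetI)
  have "(p \<circ> h) y = (f \<circ> ?j) y" if "y \<in> carrier (free_Abelian_group S)" for y
    by (rule free_Abelian_group_hom_eqI[OF assms(4) hom_compose[OF h(1) p(1)] hom_compose[OF j f] _ that])
      (simp add: b h)
  moreover have i_hom: "i \<in> hom A (free_Abelian_group S)"
    using i by (simp add: iso_def)
  moreover have "?j (i x) = x" if "x \<in> carrier A" for x
    using i that by (auto simp: iso_def bij_betw_def)
  ultimately have "p ((h \<circ> i) x) = f x" if "x \<in> carrier A" for x
    using that hom_in_carrier[OF i_hom that] by simp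
  then show thesis
    by (rule that[OF hom_compose[OF i_hom h(1)]])
qed

section \<open>Matrices over the integral group ring\<close>

text \<open>The entry \<open>m y x\<close> stands for the element of the integral group ring with
  coefficient \<open>m y x g\<close> at g. The inner sum is the product of two such elements,
  written as a convolution.\<close>

definition mat_mult ::
    "('g, 'b) monoid_scheme \<Rightarrow> 'z set \<Rightarrow> ('y \<Rightarrow> 'z \<Rightarrow> 'g \<Rightarrow> int) \<Rightarrow> ('z \<Rightarrow> 'x \<Rightarrow> 'g \<Rightarrow> int) \<Rightarrow>
     'y \<Rightarrow> 'x \<Rightarrow> 'g \<Rightarrow> int" where
  "mat_mult G Z m m' y x g = (\<Sum>z\<in>Z. \<Sum>h\<in>carrier G. m y z h * m' z x (inv\<^bsub>G\<^esub> h \<otimes>\<^bsub>G\<^esub> g))"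

definition mat_transpose ::
    "('g, 'b) monoid_scheme \<Rightarrow> ('y \<Rightarrow> 'x \<Rightarrow> 'g \<Rightarrow> int) \<Rightarrow> 'x \<Rightarrow> 'y \<Rightarrow> 'g \<Rightarrow> int" where
  "mat_transpose G m x y g = m y x (inv\<^bsub>G\<^esub> g)"

definition mat_scalar :: "('g, 'b) monoid_scheme \<Rightarrow> int \<Rightarrow> 'x \<Rightarrow> 'x \<Rightarrow> 'g \<Rightarrow> int" where
  "mat_scalar G k y x g = (if y = x \<and> g = \<one>\<^bsub>G\<^esub> then k else 0)"

text \<open>The product of the matrix m with the column c, where the group ring acts on A through
  \<phi>; in multiplicative notation the integral coefficients become exponents.\<close>

definition mat_map ::
    "('g, 'b) monoid_scheme \<Rightarrow> ('a, 'c) monoid_scheme \<Rightarrow> ('g \<Rightarrow> 'a \<Rightarrow> 'a) \<Rightarrow> 'x set \<Rightarrow> 'y set \<Rightarrow>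
     ('y \<Rightarrow> 'x \<Rightarrow> 'g \<Rightarrow> int) \<Rightarrow> ('x \<Rightarrow> 'a) \<Rightarrow> 'y \<Rightarrow> 'a" where
  "mat_map G A \<phi> X Y m c =
     (\<lambda>y\<in>Y. \<Otimes>\<^bsub>A\<^esub>x\<in>X. \<Otimes>\<^bsub>A\<^esub>g\<in>carrier G. \<phi> g (c x) [^]\<^bsub>A\<^esub> m y x g)"

text \<open>Inversion of group elements is an anti-automorphism of the group ring, so the transpose
  reverses products. The substitution is h -> g h.\<close>

lemma mat_mult_transpose:
  assumes "group G" "g \<in> carrier G"
  shows "mat_transpose G (mat_mult G Z m m') x y g =
    mat_mult G Z (mat_transpose G m') (mat_transpose G m) x y g"
proof -
  interpret group G by fact
  have "(\<Sum>h\<in>carrier G. m y z h * m' z x (inv\<^bsub>G\<^esub> h \<otimes>\<^bsub>G\<^esub> inv\<^bsub>G\<^esub> g)) =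
    (\<Sum>h\<in>carrier G. m' z x (inv\<^bsub>G\<^esub> h) * m y z (inv\<^bsub>G\<^esub> (inv\<^bsub>G\<^esub> h \<otimes>\<^bsub>G\<^esub> g)))" for z
    using assms(2)
    by (intro sum.reindex_bij_witness[where i = "\<lambda>h. inv\<^bsub>G\<^esub> g \<otimes>\<^bsub>G\<^esub> h" and j = "\<lambda>h. g \<otimes>\<^bsub>G\<^esub> h"])
      (auto simp: inv_mult_group m_assoc[symmetric])
  then show ?thesis
    by (simp add: mat_transpose_def mat_mult_def)
qed

lemma mat_transpose_transpose:
  assumes "group G" "g \<in> carrier G"
  shows "mat_transpose G (mat_transpose G m) x y g = m x y g"
  using assms by (simp add: mat_transpose_def group.inv_inv)

lemma mat_transpose_scalar:
  assumes "group G" "g \<in> carrier G"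
  shows "mat_transpose G (mat_scalar G k) x y g = mat_scalar G k x y g"
  using assms by (auto simp: mat_transpose_def mat_scalar_def group.inv_eq_1_iff)

lemma mat_mult_cong:
  assumes "group G" "g \<in> carrier G"
    and "\<And>z h. \<lbrakk>z \<in> Z; h \<in> carrier G\<rbrakk> \<Longrightarrow> m y z h = n y z h"
    and "\<And>z h. \<lbrakk>z \<in> Z; h \<in> carrier G\<rbrakk> \<Longrightarrow> m' z x h = n' z x h"
  shows "mat_mult G Z m m' y x g = mat_mult G Z n n' y x g"
proof -
  interpret group G by fact
  show ?thesis
    using assms by (auto simp: mat_mult_def intro!: sum.cong)
qed

text \<open>General enough to contain the lattice together with its duals: Hom(M, Q/Z) is a G-module
  too, but in general not a lattice, and the same complex has to be formed for it.\<close>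

locale finite_G_module = G_module +
  assumes finite_G: "finite (carrier G)"
begin

declare hom_mult [simp del] hom_one [simp del] hom_inv [simp del]

lemma action_hom: "g \<in> carrier G \<Longrightarrow> \<phi> g \<in> hom A A"
  using hom_closed by (auto simp: AutoGroup_def auto_def)

lemma action_closed [simp]: "\<lbrakk>g \<in> carrier G; a \<in> carrier A\<rbrakk> \<Longrightarrow> \<phi> g a \<in> carrier A"
  using action_hom hom_in_carrier by metis

lemma action_group_hom: "g \<in> carrier G \<Longrightarrow> group_hom A A (\<phi> g)"
  using action_hom by unfold_locales

lemma action_mult:
  assumes "g \<in> carrier G" "h \<in> carrier G" "a \<in> carrier A"
  shows "\<phi> (g \<otimes> h) a = \<phi> g (\<phi> h a)"
  using assms hom_closed[of g] hom_closed[of h] hom_mult[of g h]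
  by (simp add: AutoGroup_def BijGroup_def auto_def compose_def)

lemma action_one: "a \<in> carrier A \<Longrightarrow> \<phi> \<one> a = a"
  using hom_one by (simp add: AutoGroup_def BijGroup_def)

lemma action_finprod:
  assumes "g \<in> carrier G" "f \<in> I \<rightarrow> carrier A"
  shows "\<phi> g (finprod A f I) = (\<Otimes>\<^bsub>A\<^esub>i\<in>I. \<phi> g (f i))"
  using hom_finprod[OF A.comm_group_axioms A.comm_group_axioms action_hom[OF assms(1)] assms(2)] .

lemma action_int_pow:
  assumes "g \<in> carrier G" "a \<in> carrier A"
  shows "\<phi> g (a [^]\<^bsub>A\<^esub> (k::int)) = \<phi> g a [^]\<^bsub>A\<^esub> k"
  using group_hom.hom_int_pow[OF action_group_hom] assms by metis

lemma mat_map_cong: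
  assumes "c \<in> X \<rightarrow> carrier A"
    and "\<And>y x g. \<lbrakk>y \<in> Y; x \<in> X; g \<in> carrier G\<rbrakk> \<Longrightarrow> m y x g = n y x g"
  shows "mat_map G A \<phi> X Y m c = mat_map G A \<phi> X Y n c"
  unfolding mat_map_def using assms
  by (intro restrict_ext A.finprod_cong') (auto simp: Pi_iff)

lemma mat_map_closed:
  assumes "c \<in> X \<rightarrow> carrier A"
  shows "mat_map G A \<phi> X Y m c \<in> (\<Pi>\<^sub>E y\<in>Y. carrier A)"
  using assms by (auto simp: mat_map_def Pi_iff intro!: A.finprod_closed)

lemma mat_map_hom:
  assumes "finite X"
  shows "mat_map G A \<phi> X Y m \<in> hom (product_group X (\<lambda>_. A)) (product_group Y (\<lambda>_. A))"
proof (rule homI)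
  fix c c' assume "c \<in> carrier (product_group X (\<lambda>_. A))" "c' \<in> carrier (product_group X (\<lambda>_. A))"
  then have c: "c x \<in> carrier A" "c' x \<in> carrier A" if "x \<in> X" for x
    using that by auto
  have "mat_map G A \<phi> X Y m (\<lambda>x\<in>X. c x \<otimes>\<^bsub>A\<^esub> c' x) y =
    mat_map G A \<phi> X Y m c y \<otimes>\<^bsub>A\<^esub> mat_map G A \<phi> X Y m c' y" if y: "y \<in> Y" for y
  proof -
    have "(\<Otimes>\<^bsub>A\<^esub>x\<in>X. \<Otimes>\<^bsub>A\<^esub>g\<in>carrier G. \<phi> g ((\<lambda>x\<in>X. c x \<otimes>\<^bsub>A\<^esub> c' x) x) [^]\<^bsub>A\<^esub> m y x g) =
      (\<Otimes>\<^bsub>A\<^esub>x\<in>X. (\<Otimes>\<^bsub>A\<^esub>g\<in>carrier G. \<phi> g (c x) [^]\<^bsub>A\<^esub> m y x g) \<otimes>\<^bsub>A\<^esub>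
        (\<Otimes>\<^bsub>A\<^esub>g\<in>carrier G. \<phi> g (c' x) [^]\<^bsub>A\<^esub> m y x g))"
      by (intro A.finprod_cong')
        (auto simp: c Pi_iff A.int_pow_distrib Group.hom_mult[OF action_hom] simp flip: A.finprod_multf
          intro!: A.finprod_cong')
    then show ?thesis
      using y by (simp add: mat_map_def c Pi_iff)
  qed
  then show "mat_map G A \<phi> X Y m (c \<otimes>\<^bsub>product_group X (\<lambda>_. A)\<^esub> c') =
    mat_map G A \<phi> X Y m c \<otimes>\<^bsub>product_group Y (\<lambda>_. A)\<^esub> mat_map G A \<phi> X Y m c'"
    by (auto simp: mat_map_def fun_eq_iff)
next
  fix c assume "c \<in> carrier (product_group X (\<lambda>_. A))"
  then show "mat_map G A \<phi> X Y m c \<in> carrier (product_group Y (\<lambda>_. A))"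
    using mat_map_closed[of c X Y m] by auto
qed

lemma mat_map_zero:
  "mat_map G A \<phi> X Y (\<lambda>_ _ _. 0) c = \<one>\<^bsub>product_group Y (\<lambda>_. A)\<^esub>"
  by (auto simp: mat_map_def)

lemma mat_map_add:
  assumes "c \<in> X \<rightarrow> carrier A"
  shows "mat_map G A \<phi> X Y (\<lambda>y x g. m y x g + n y x g) c =
    mat_map G A \<phi> X Y m c \<otimes>\<^bsub>product_group Y (\<lambda>_. A)\<^esub> mat_map G A \<phi> X Y n c"
proof -
  have c: "c x \<in> carrier A" if "x \<in> X" for x
    using assms that by auto
  have "(\<Otimes>\<^bsub>A\<^esub>x\<in>X. \<Otimes>\<^bsub>A\<^esub>g\<in>carrier G. \<phi> g (c x) [^]\<^bsub>A\<^esub> (m y x g + n y x g)) =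
      (\<Otimes>\<^bsub>A\<^esub>x\<in>X. (\<Otimes>\<^bsub>A\<^esub>g\<in>carrier G. \<phi> g (c x) [^]\<^bsub>A\<^esub> m y x g) \<otimes>\<^bsub>A\<^esub>
        (\<Otimes>\<^bsub>A\<^esub>g\<in>carrier G. \<phi> g (c x) [^]\<^bsub>A\<^esub> n y x g))" for y
    by (intro A.finprod_cong')
      (auto simp: c Pi_iff A.int_pow_mult simp flip: A.finprod_multf intro!: A.finprod_cong')
  then show ?thesis
    by (auto simp: mat_map_def c Pi_iff intro!: restrict_ext)
qed

lemma mat_map_scalar:
  assumes "finite X" "c \<in> X \<rightarrow> carrier A"
  shows "mat_map G A \<phi> X X (mat_scalar G k) c = (\<lambda>x\<in>X. c x [^]\<^bsub>A\<^esub> k)"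
proof (unfold mat_map_def, rule restrict_ext)
  fix y assume y: "y \<in> X"
  have c: "c x \<in> carrier A" if "x \<in> X" for x
    using assms that by auto
  have "(\<Otimes>\<^bsub>A\<^esub>g\<in>carrier G. \<phi> g (c x) [^]\<^bsub>A\<^esub> mat_scalar G k y x g) =
    (if x = y then c x [^]\<^bsub>A\<^esub> k else \<one>\<^bsub>A\<^esub>)" if "x \<in> X" for x
  proof -
    have "(\<Otimes>\<^bsub>A\<^esub>g\<in>carrier G. \<phi> g (c x) [^]\<^bsub>A\<^esub> mat_scalar G k y x g) =
      (\<Otimes>\<^bsub>A\<^esub>g\<in>carrier G. if g = \<one> then (if x = y then \<phi> g (c x) [^]\<^bsub>A\<^esub> k else \<one>\<^bsub>A\<^esub>) else \<one>\<^bsub>A\<^esub>)"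
      using c[OF that] by (intro A.finprod_cong') (auto simp: mat_scalar_def)
    then show ?thesis
      using c[OF that] A.finprod_indicator[OF finite_G G.one_closed,
          of "\<lambda>g. if x = y then \<phi> g (c x) [^]\<^bsub>A\<^esub> k else \<one>\<^bsub>A\<^esub>"]
      by (cases "x = y") (simp_all add: action_one)
  qed
  then have "(\<Otimes>\<^bsub>A\<^esub>x\<in>X. \<Otimes>\<^bsub>A\<^esub>g\<in>carrier G. \<phi> g (c x) [^]\<^bsub>A\<^esub> mat_scalar G k y x g) =
    (\<Otimes>\<^bsub>A\<^esub>x\<in>X. if x = y then c x [^]\<^bsub>A\<^esub> k else \<one>\<^bsub>A\<^esub>)"
    using c by (intro A.finprod_cong') auto
  then show "(\<Otimes>\<^bsub>A\<^esub>x\<in>X. \<Otimes>\<^bsub>A\<^esub>g\<in>carrier G. \<phi> g (c x) [^]\<^bsub>A\<^esub> mat_scalar G k y x g) = c y [^]\<^bsub>A\<^esub> k"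
    using A.finprod_indicator[OF assms(1) y, of "\<lambda>x. c x [^]\<^bsub>A\<^esub> k"] c[OF y] by simp
qed

text \<open>Associativity of the action of the group ring. Via this lemma identities between
  matrices become identities between maps on cochains, for every module at once.\<close>

lemma mat_map_mult:
  assumes "finite X" "finite Z" "c \<in> X \<rightarrow> carrier A"
  shows "mat_map G A \<phi> Z Y m (mat_map G A \<phi> X Z m' c) = mat_map G A \<phi> X Y (mat_mult G Z m m') c"
proof -
  have c: "c x \<in> carrier A" if "x \<in> X" for x
    using assms that by auto
  have "(\<Otimes>\<^bsub>A\<^esub>z\<in>Z. \<Otimes>\<^bsub>A\<^esub>h\<in>carrier G. \<phi> h (mat_map G A \<phi> X Z m' c z) [^]\<^bsub>A\<^esub> m y z h) =
    (\<Otimes>\<^bsub>A\<^esub>x\<in>X. \<Otimes>\<^bsub>A\<^esub>g\<in>carrier G. \<phi> g (c x) [^]\<^bsub>A\<^esub> mat_mult G Z m m' y x g)" for y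
  proof -
    have "\<phi> h (mat_map G A \<phi> X Z m' c z) [^]\<^bsub>A\<^esub> m y z h =
      (\<Otimes>\<^bsub>A\<^esub>x\<in>X. \<Otimes>\<^bsub>A\<^esub>g\<in>carrier G. \<phi> g (c x) [^]\<^bsub>A\<^esub> (m y z h * m' z x (inv h \<otimes> g)))"
      if z: "z \<in> Z" and h: "h \<in> carrier G" for z h
    proof -
      have "\<phi> h (mat_map G A \<phi> X Z m' c z) [^]\<^bsub>A\<^esub> m y z h =
        (\<Otimes>\<^bsub>A\<^esub>x\<in>X. \<phi> h (\<Otimes>\<^bsub>A\<^esub>g\<in>carrier G. \<phi> g (c x) [^]\<^bsub>A\<^esub> m' z x g)) [^]\<^bsub>A\<^esub> m y z h"
        using z h c by (simp add: mat_map_def action_finprod Pi_iff)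
      also have "\<dots> =
        (\<Otimes>\<^bsub>A\<^esub>x\<in>X. (\<phi> h (\<Otimes>\<^bsub>A\<^esub>g\<in>carrier G. \<phi> g (c x) [^]\<^bsub>A\<^esub> m' z x g)) [^]\<^bsub>A\<^esub> m y z h)"
        using h c by (intro A.finprod_int_pow) (auto simp: Pi_iff)
      also have "\<dots> = (\<Otimes>\<^bsub>A\<^esub>x\<in>X. \<Otimes>\<^bsub>A\<^esub>g\<in>carrier G. \<phi> g (c x) [^]\<^bsub>A\<^esub> (m y z h * m' z x (inv h \<otimes> g)))"
      proof (rule A.finprod_cong'[OF refl])
        fix x assume x: "x \<in> X"
        have "(\<phi> h (\<Otimes>\<^bsub>A\<^esub>g\<in>carrier G. \<phi> g (c x) [^]\<^bsub>A\<^esub> m' z x g)) [^]\<^bsub>A\<^esub> m y z h =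
          (\<Otimes>\<^bsub>A\<^esub>g\<in>carrier G. \<phi> h (\<phi> g (c x) [^]\<^bsub>A\<^esub> m' z x g)) [^]\<^bsub>A\<^esub> m y z h"
          using x h c by (simp add: action_finprod Pi_iff)
        also have "\<dots> = (\<Otimes>\<^bsub>A\<^esub>g\<in>carrier G. \<phi> h (\<phi> g (c x) [^]\<^bsub>A\<^esub> m' z x g) [^]\<^bsub>A\<^esub> m y z h)"
          using x h c by (intro A.finprod_int_pow) (auto simp: Pi_iff)
        \<comment> \<open>The composite of \<phi> h and \<phi> g is \<phi> (h g). Replacing g by
          h^(-1) g makes the acting element g and moves h into the coefficient of m', as in a
          convolution.\<close>
        also have "\<dots> = (\<Otimes>\<^bsub>A\<^esub>g\<in>carrier G.
          (\<lambda>g. \<phi> g (c x) [^]\<^bsub>A\<^esub> (m y z h * m' z x (inv h \<otimes> g))) (h \<otimes> g))"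
          using x h c
          by (intro A.finprod_cong')
            (auto simp: action_int_pow action_mult A.int_pow_pow mult.commute G.m_assoc[symmetric])
        also have "\<dots> = (\<Otimes>\<^bsub>A\<^esub>g\<in>(\<lambda>g. h \<otimes> g) ` carrier G.
          \<phi> g (c x) [^]\<^bsub>A\<^esub> (m y z h * m' z x (inv h \<otimes> g)))"
          using x h c by (intro A.finprod_reindex[symmetric]) (auto simp: inj_on_def)
        also have "(\<lambda>g. h \<otimes> g) ` carrier G = carrier G"
          using h by (rule G.surj_const_mult)
        finally show "(\<phi> h (\<Otimes>\<^bsub>A\<^esub>g\<in>carrier G. \<phi> g (c x) [^]\<^bsub>A\<^esub> m' z x g)) [^]\<^bsub>A\<^esub> m y z h =
          (\<Otimes>\<^bsub>A\<^esub>g\<in>carrier G. \<phi> g (c x) [^]\<^bsub>A\<^esub> (m y z h * m' z x (inv h \<otimes> g)))" .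
      qed (use c in \<open>auto simp: Pi_iff\<close>)
      finally show ?thesis .
    qed
    then have "(\<Otimes>\<^bsub>A\<^esub>z\<in>Z. \<Otimes>\<^bsub>A\<^esub>h\<in>carrier G. \<phi> h (mat_map G A \<phi> X Z m' c z) [^]\<^bsub>A\<^esub> m y z h) =
      (\<Otimes>\<^bsub>A\<^esub>z\<in>Z. \<Otimes>\<^bsub>A\<^esub>h\<in>carrier G.
        \<Otimes>\<^bsub>A\<^esub>x\<in>X. \<Otimes>\<^bsub>A\<^esub>g\<in>carrier G. \<phi> g (c x) [^]\<^bsub>A\<^esub> (m y z h * m' z x (inv h \<otimes> g)))"
      using c by (intro A.finprod_cong') (auto simp: Pi_iff)
    also have "\<dots> = (\<Otimes>\<^bsub>A\<^esub>x\<in>X. \<Otimes>\<^bsub>A\<^esub>z\<in>Z. \<Otimes>\<^bsub>A\<^esub>h\<in>carrier G.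
        \<Otimes>\<^bsub>A\<^esub>g\<in>carrier G. \<phi> g (c x) [^]\<^bsub>A\<^esub> (m y z h * m' z x (inv h \<otimes> g)))"
      using c assms(1,2) finite_G
      by (subst (2) A.finprod_swap)
        (auto simp: Pi_iff intro!: A.finprod_cong' A.finprod_swap)
    \<comment> \<open>With x and g outermost, all factors for a fixed pair are powers of the same
      element, so their exponents add up to the entry of the product matrix.\<close>
    also have "\<dots> = (\<Otimes>\<^bsub>A\<^esub>x\<in>X. \<Otimes>\<^bsub>A\<^esub>g\<in>carrier G. \<phi> g (c x) [^]\<^bsub>A\<^esub> mat_mult G Z m m' y x g)"
    proof (rule A.finprod_cong'[OF refl])
      fix x assume x: "x \<in> X"
      have "(\<Otimes>\<^bsub>A\<^esub>z\<in>Z. \<Otimes>\<^bsub>A\<^esub>h\<in>carrier G.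
        \<Otimes>\<^bsub>A\<^esub>g\<in>carrier G. \<phi> g (c x) [^]\<^bsub>A\<^esub> (m y z h * m' z x (inv h \<otimes> g))) =
        (\<Otimes>\<^bsub>A\<^esub>z\<in>Z. \<Otimes>\<^bsub>A\<^esub>g\<in>carrier G.
        \<Otimes>\<^bsub>A\<^esub>h\<in>carrier G. \<phi> g (c x) [^]\<^bsub>A\<^esub> (m y z h * m' z x (inv h \<otimes> g)))"
        using c[OF x] finite_G by (intro A.finprod_cong' A.finprod_swap) (auto simp: Pi_iff)
      also have "\<dots> = (\<Otimes>\<^bsub>A\<^esub>g\<in>carrier G. \<Otimes>\<^bsub>A\<^esub>z\<in>Z.
        \<Otimes>\<^bsub>A\<^esub>h\<in>carrier G. \<phi> g (c x) [^]\<^bsub>A\<^esub> (m y z h * m' z x (inv h \<otimes> g)))"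
        using c[OF x] finite_G assms(2) by (intro A.finprod_swap) (auto simp: Pi_iff)
      also have "\<dots> = (\<Otimes>\<^bsub>A\<^esub>g\<in>carrier G. \<phi> g (c x) [^]\<^bsub>A\<^esub> mat_mult G Z m m' y x g)"
        using c[OF x] finite_G assms(2)
        by (intro A.finprod_cong') (auto simp: mat_mult_def A.int_pow_sum)
      finally show "(\<Otimes>\<^bsub>A\<^esub>z\<in>Z. \<Otimes>\<^bsub>A\<^esub>h\<in>carrier G.
        \<Otimes>\<^bsub>A\<^esub>g\<in>carrier G. \<phi> g (c x) [^]\<^bsub>A\<^esub> (m y z h * m' z x (inv h \<otimes> g))) =
        (\<Otimes>\<^bsub>A\<^esub>g\<in>carrier G. \<phi> g (c x) [^]\<^bsub>A\<^esub> mat_mult G Z m m' y x g)" .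
    qed (use c in \<open>auto simp: Pi_iff\<close>)
    finally show ?thesis .
  qed
  then show ?thesis
    unfolding mat_map_def[of G A \<phi> Z Y] mat_map_def[of G A \<phi> X Y] by (intro restrict_ext)
qed

text \<open>If row y is a sum of monomials, with \<epsilon> i times \<gamma> i placed in column
  \<open>s i\<close>, only these terms survive. This matches the shape of
  \<open>bar_coboundary\<close>, where y has one term for each face.\<close>

lemma mat_map_monomials:
  assumes "finite X" "finite I" "c \<in> X \<rightarrow> carrier A" "y \<in> Y"
    and "\<And>i. i \<in> I \<Longrightarrow> s i \<in> X" "\<And>i. i \<in> I \<Longrightarrow> \<gamma> i \<in> carrier G"
    and m: "\<And>x g. \<lbrakk>x \<in> X; g \<in> carrier G\<rbrakk> \<Longrightarrow>
      m y x g = (\<Sum>i\<in>I. if s i = x \<and> \<gamma> i = g then \<epsilon> i else 0)"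
  shows "mat_map G A \<phi> X Y m c y = (\<Otimes>\<^bsub>A\<^esub>i\<in>I. \<phi> (\<gamma> i) (c (s i)) [^]\<^bsub>A\<^esub> \<epsilon> i)"
proof -
  have c: "c x \<in> carrier A" if "x \<in> X" for x
    using assms that by auto
  let ?t = "\<lambda>i x g. \<phi> g (c x) [^]\<^bsub>A\<^esub> (if s i = x \<and> \<gamma> i = g then \<epsilon> i else 0)"
  have "mat_map G A \<phi> X Y m c y = (\<Otimes>\<^bsub>A\<^esub>x\<in>X. \<Otimes>\<^bsub>A\<^esub>g\<in>carrier G. \<Otimes>\<^bsub>A\<^esub>i\<in>I. ?t i x g)"
    using c assms(2,4) by (auto simp: mat_map_def m A.int_pow_sum intro!: A.finprod_cong')
  also have "\<dots> = (\<Otimes>\<^bsub>A\<^esub>x\<in>X. \<Otimes>\<^bsub>A\<^esub>i\<in>I. \<Otimes>\<^bsub>A\<^esub>g\<in>carrier G. ?t i x g)"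
    using c assms(2) finite_G by (intro A.finprod_cong' A.finprod_swap) (auto simp: Pi_iff)
  also have "\<dots> = (\<Otimes>\<^bsub>A\<^esub>i\<in>I. \<Otimes>\<^bsub>A\<^esub>x\<in>X. \<Otimes>\<^bsub>A\<^esub>g\<in>carrier G. ?t i x g)"
    using c assms(1,2) by (intro A.finprod_swap) (auto simp: Pi_iff)
  also have "\<dots> = (\<Otimes>\<^bsub>A\<^esub>i\<in>I. \<phi> (\<gamma> i) (c (s i)) [^]\<^bsub>A\<^esub> \<epsilon> i)"
  proof (rule A.finprod_cong'[OF refl])
    fix i assume i: "i \<in> I"
    have "(\<Otimes>\<^bsub>A\<^esub>x\<in>X. \<Otimes>\<^bsub>A\<^esub>g\<in>carrier G. ?t i x g) =
      (\<Otimes>\<^bsub>A\<^esub>x\<in>X. if x = s i then \<phi> (\<gamma> i) (c x) [^]\<^bsub>A\<^esub> \<epsilon> i else \<one>\<^bsub>A\<^esub>)"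
    proof (rule A.finprod_cong'[OF refl])
      fix x assume x: "x \<in> X"
      have "(\<Otimes>\<^bsub>A\<^esub>g\<in>carrier G. ?t i x g) =
        (\<Otimes>\<^bsub>A\<^esub>g\<in>carrier G. if g = \<gamma> i then (if x = s i then \<phi> g (c x) [^]\<^bsub>A\<^esub> \<epsilon> i else \<one>\<^bsub>A\<^esub>) else \<one>\<^bsub>A\<^esub>)"
        using c[OF x] by (intro A.finprod_cong') auto
      then show "(\<Otimes>\<^bsub>A\<^esub>g\<in>carrier G. ?t i x g) = (if x = s i then \<phi> (\<gamma> i) (c x) [^]\<^bsub>A\<^esub> \<epsilon> i else \<one>\<^bsub>A\<^esub>)"
        using c[OF x] assms(6)[OF i] A.finprod_indicator[OF finite_G assms(6)[OF i],
          of "\<lambda>g. if x = s i then \<phi> g (c x) [^]\<^bsub>A\<^esub> \<epsilon> i else \<one>\<^bsub>A\<^esub>"]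
        by (cases "x = s i") simp_all
    qed (use c assms(6)[OF i] in auto)
    then show "(\<Otimes>\<^bsub>A\<^esub>x\<in>X. \<Otimes>\<^bsub>A\<^esub>g\<in>carrier G. ?t i x g) = \<phi> (\<gamma> i) (c (s i)) [^]\<^bsub>A\<^esub> \<epsilon> i"
      using A.finprod_indicator[OF assms(1) assms(5)[OF i],
          of "\<lambda>x. \<phi> (\<gamma> i) (c x) [^]\<^bsub>A\<^esub> \<epsilon> i"] c[OF assms(5)[OF i]] assms(6)[OF i] by simp
  qed (use c assms(5,6) in auto)
  finally show ?thesis .
qed

text \<open>Here the columns are sums of monomials, the i-th one of column x sitting in row
  \<open>t i x\<close>. Row y then collects the fibre of \<open>t i\<close> over y, which is the
  shape of \<open>bar_boundary\<close>.\<close>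

lemma mat_map_transpose_monomials:
  assumes "finite X" "finite I" "c \<in> X \<rightarrow> carrier A" "y \<in> Y"
    and "\<And>i x. \<lbrakk>i \<in> I; x \<in> X\<rbrakk> \<Longrightarrow> \<gamma> i x \<in> carrier G"
    and m: "\<And>x g. \<lbrakk>x \<in> X; g \<in> carrier G\<rbrakk> \<Longrightarrow>
      m y x g = (\<Sum>i\<in>I. if t i x = y \<and> \<gamma> i x = g then \<epsilon> i else 0)"
  shows "mat_map G A \<phi> X Y m c y =
    (\<Otimes>\<^bsub>A\<^esub>i\<in>I. \<Otimes>\<^bsub>A\<^esub>x\<in>{x \<in> X. t i x = y}. \<phi> (\<gamma> i x) (c x) [^]\<^bsub>A\<^esub> \<epsilon> i)"
proof -
  have c: "c x \<in> carrier A" if "x \<in> X" for x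
    using assms that by auto
  let ?t = "\<lambda>i x g. \<phi> g (c x) [^]\<^bsub>A\<^esub> (if t i x = y \<and> \<gamma> i x = g then \<epsilon> i else 0)"
  have "mat_map G A \<phi> X Y m c y = (\<Otimes>\<^bsub>A\<^esub>x\<in>X. \<Otimes>\<^bsub>A\<^esub>g\<in>carrier G. \<Otimes>\<^bsub>A\<^esub>i\<in>I. ?t i x g)"
    using c assms(2,4) by (auto simp: mat_map_def m A.int_pow_sum intro!: A.finprod_cong')
  also have "\<dots> = (\<Otimes>\<^bsub>A\<^esub>x\<in>X. \<Otimes>\<^bsub>A\<^esub>i\<in>I. \<Otimes>\<^bsub>A\<^esub>g\<in>carrier G. ?t i x g)"
    using c assms(2) finite_G by (intro A.finprod_cong' A.finprod_swap) (auto simp: Pi_iff)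
  also have "\<dots> = (\<Otimes>\<^bsub>A\<^esub>i\<in>I. \<Otimes>\<^bsub>A\<^esub>x\<in>X. \<Otimes>\<^bsub>A\<^esub>g\<in>carrier G. ?t i x g)"
    using c assms(1,2) by (intro A.finprod_swap) (auto simp: Pi_iff)
  also have "\<dots> = (\<Otimes>\<^bsub>A\<^esub>i\<in>I. \<Otimes>\<^bsub>A\<^esub>x\<in>{x \<in> X. t i x = y}. \<phi> (\<gamma> i x) (c x) [^]\<^bsub>A\<^esub> \<epsilon> i)"
  proof (rule A.finprod_cong'[OF refl])
    fix i assume i: "i \<in> I"
    show "(\<Otimes>\<^bsub>A\<^esub>x\<in>X. \<Otimes>\<^bsub>A\<^esub>g\<in>carrier G. ?t i x g) =
      (\<Otimes>\<^bsub>A\<^esub>x\<in>{x \<in> X. t i x = y}. \<phi> (\<gamma> i x) (c x) [^]\<^bsub>A\<^esub> \<epsilon> i)"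
    proof (rule A.finprod_mono_neutral_cong_right[OF assms(1)])
      fix x assume "x \<in> {x \<in> X. t i x = y}"
      then have x: "x \<in> X" "t i x = y"
        by auto
      have "(\<Otimes>\<^bsub>A\<^esub>g\<in>carrier G. ?t i x g) =
        (\<Otimes>\<^bsub>A\<^esub>g\<in>carrier G. if g = \<gamma> i x then \<phi> g (c x) [^]\<^bsub>A\<^esub> \<epsilon> i else \<one>\<^bsub>A\<^esub>)"
        using c[OF x(1)] x(2) by (intro A.finprod_cong') auto
      then show "(\<Otimes>\<^bsub>A\<^esub>g\<in>carrier G. ?t i x g) = \<phi> (\<gamma> i x) (c x) [^]\<^bsub>A\<^esub> \<epsilon> i"
        using c[OF x(1)] assms(5)[OF i x(1)] A.finprod_indicator[OF finite_G assms(5)[OF i x(1)],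
          of "\<lambda>g. \<phi> g (c x) [^]\<^bsub>A\<^esub> \<epsilon> i"] by simp
    qed (use c in \<open>auto intro!: A.finprod_closed\<close>)
  qed (use c assms(5) in \<open>auto intro!: A.finprod_closed\<close>)
  finally show ?thesis .
qed

end

section \<open>The bar resolution as integral matrices\<close>

lemma bar_face_0 [simp]: "bar_face G 0 gs = tl gs"
  by (simp add: bar_face_def)

text \<open>With the neighbouring rules this computes faces by recursion on the tuple: an index of
  at least 2 leaves the leading entry alone and acts on the tail with index one less.\<close>

lemma bar_face_Suc_0 [simp]:
  "bar_face G (Suc 0) [g] = []"
  "bar_face G (Suc 0) (g # h # gs) = (g \<otimes>\<^bsub>G\<^esub> h) # gs"
  by (simp_all add: bar_face_def)

lemma bar_face_Suc_Suc [simp]: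
  "gs \<noteq> [] \<Longrightarrow> bar_face G (Suc (Suc i)) (g # gs) = g # bar_face G (Suc i) gs"
  by (auto simp: bar_face_def)

text \<open>The homotopy needs the faces of a tuple with an appended entry. Early faces do not see
  it, the next to last one multiplies it into its neighbour, and the last one drops it; the two
  lemmas that follow treat the late faces.\<close>

lemma bar_face_append:
  assumes "i < length gs"
  shows "bar_face G i (gs @ [g]) = bar_face G i gs @ [g]"
  using assms by (auto simp: bar_face_def nth_append)

lemma bar_face_penultimate: "bar_face G (Suc (length gs)) (gs @ [a, b]) = gs @ [a \<otimes>\<^bsub>G\<^esub> b]"
  by (simp add: bar_face_def nth_append)

lemma bar_face_last: "gs \<noteq> [] \<Longrightarrow> bar_face G (length gs) gs = butlast gs"
  by (simp add: bar_face_def)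

lemma length_bar_face:
  assumes "i \<le> length gs"
  shows "length (bar_face G i gs) = length gs - 1"
  using assms by (auto simp: bar_face_def)

lemma bar_face_tuples:
  assumes "group G" "gs \<in> tuples G (Suc k)" "i \<le> Suc k"
  shows "bar_face G i gs \<in> tuples G k"
proof -
  interpret group G by fact
  have gs: "set gs \<subseteq> carrier G" "length gs = Suc k"
    using assms(2) by (auto simp: tuples_def)
  have nth: "gs ! j \<in> carrier G" if "j < Suc k" for j
    using that gs by (metis nth_mem subsetD)
  have "set (bar_face G i gs) \<subseteq> carrier G"
    using gs assms(3) nth[of i] nth[of "i - 1"] set_drop_subset[of 1 gs]
    by (auto simp: bar_face_def subset_iff drop_Suc dest: in_set_takeD in_set_dropD in_set_butlastD)
  then show ?thesis
    using gs assms(3) length_bar_face[of i gs G] by (simp add: tuples_def)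
qed

text \<open>The simplicial identity for faces. By induction on the tuple only i = 0 and i = 1 need
  inspection, since larger indices leave the first entry fixed.\<close>

lemma bar_face_bar_face:
  assumes "group G" "set gs \<subseteq> carrier G" "i < j" "j \<le> length gs" "2 \<le> length gs"
  shows "bar_face G i (bar_face G j gs) = bar_face G (j - 1) (bar_face G i gs)"
  using assms(2-)
proof (induction gs arbitrary: i j)
  case (Cons g gs)
  interpret group G by fact
  obtain h r where gs: "gs = h # r"
    using Cons.prems by (cases gs) auto
  consider "i = 0" | "i = 1" | i' where "i = Suc (Suc i')"
    by (metis One_nat_def not0_implies_Suc)
  then show ?case
  proof cases
    case 1
    with Cons.prems gs show ?thesis
      by (cases j rule: nat.exhaust; cases "j - 1") auto
  next
    \<comment> \<open>The two faces can overlap only for j = 2, where the first three entries are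
      multiplied together in two ways; this is associativity in G.\<close>
    case 2
    then obtain j' where j: "j = Suc (Suc j')"
      using Cons.prems by (metis One_nat_def Suc_le_D Suc_leI Suc_le_mono)
    show ?thesis
    proof (cases j')
      case 0
      with Cons.prems gs 2 j show ?thesis
        by (cases r) (auto simp: m_assoc)
    next
      case (Suc j'')
      with Cons.prems gs 2 j show ?thesis
        by (cases r) (auto simp: m_assoc)
    qed
  next
    case (3 i')
    then obtain j' where j: "j = Suc (Suc j')" "Suc i' < Suc j'" "0 < j'"
      using Cons.prems by (metis One_nat_def Suc_le_D Suc_leI Suc_le_mono Suc_less_eq gr0I not_less0)
    then have r: "r \<noteq> []"
      using Cons.prems gs by auto
    have "bar_face G (Suc i') (bar_face G (Suc j') gs) = bar_face G j' (bar_face G (Suc i') gs)"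
      using Cons.IH[of "Suc i'" "Suc j'"] Cons.prems j r gs by (cases r) auto
    moreover have "bar_face G (Suc j') gs \<noteq> []" "bar_face G (Suc i') gs \<noteq> []"
      using length_bar_face[of "Suc j'" gs G] length_bar_face[of "Suc i'" gs G] Cons.prems 3 j r gs
      by (cases r; force)+
    ultimately show ?thesis
      using 3 j gs by (cases j') auto
  qed
qed simp

text \<open>The group element in front of the i-th face in the bar differential: only the face that
  drops the first entry carries a coefficient, namely that entry.\<close>

definition bar_coefficient :: "('g, 'b) monoid_scheme \<Rightarrow> nat \<Rightarrow> 'g list \<Rightarrow> 'g" where
  "bar_coefficient G i gs = (if i = 0 then hd gs else \<one>\<^bsub>G\<^esub>)"

text \<open>Row gs lists the signed faces of gs with their coefficients. It is a sum over i because
  different faces of one tuple may coincide.\<close>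

definition bar_matrix ::
    "('g, 'b) monoid_scheme \<Rightarrow> nat \<Rightarrow> 'g list \<Rightarrow> 'g list \<Rightarrow> 'g \<Rightarrow> int" where
  "bar_matrix G k gs hs g =
     (\<Sum>i\<le>Suc k. if bar_face G i gs = hs \<and> bar_coefficient G i gs = g then (-1) ^ i else 0)"

lemma bar_coefficient_closed:
  assumes "group G" "gs \<in> tuples G (Suc k)"
  shows "bar_coefficient G i gs \<in> carrier G"
  using assms by (cases gs) (auto simp: bar_coefficient_def tuples_def group.is_monoid)

text \<open>The simplicial identity for coefficients. The interesting case is i = 0, j = 1:
  multiplying the first two entries and then splitting off their product agrees with splitting them
  off one after the other.\<close>

lemma bar_coefficient_bar_face:
  assumes "group G" "gs \<in> tuples G (Suc (Suc k))" "i < j" "j \<le> Suc (Suc k)"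
  shows "bar_coefficient G j gs \<otimes>\<^bsub>G\<^esub> bar_coefficient G i (bar_face G j gs) =
    bar_coefficient G i gs \<otimes>\<^bsub>G\<^esub> bar_coefficient G (j - 1) (bar_face G i gs)"
proof -
  interpret group G by fact
  obtain g h r where "gs = g # h # r" "g \<in> carrier G" "h \<in> carrier G"
    using assms(2) by (auto simp: tuples_def length_Suc_conv)
  moreover obtain j' where "j = Suc j'"
    using assms(3) by (cases j) auto
  ultimately show ?thesis
    using assms(3) by (cases j') (auto simp: bar_coefficient_def)
qed

lemma finite_tuples: "finite (carrier G) \<Longrightarrow> finite (tuples G k)"
  unfolding tuples_def by (rule finite_lists_length_eq)

text \<open>The pairs with i < j are matched with those with j \<le> i by (j, i) -> (i, j - 1). This
  changes the parity of i + j and preserves F, so everything cancels.\<close>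

lemma alternating_double_sum_eq_0:
  assumes "\<And>i j. \<lbrakk>i < j; j \<le> Suc n\<rbrakk> \<Longrightarrow> F j i = F i (j - 1)"
  shows "(\<Sum>j\<le>Suc n. \<Sum>i\<le>n. (-1) ^ j * ((-1) ^ i * F j i)) = (0::int)"
proof -
  let ?f = "\<lambda>(j, i). (-1) ^ j * ((-1) ^ i * F j i)"
  let ?L = "{(j, i). j \<le> Suc n \<and> i \<le> n \<and> i < j}" and ?U = "{(j, i). j \<le> Suc n \<and> i \<le> n \<and> j \<le> i}"
  have fin: "finite ?L" "finite ?U"
    by (rule finite_subset[of _ "{..Suc n} \<times> {..n}"]; auto)+
  have "(\<Sum>j\<le>Suc n. \<Sum>i\<le>n. (-1) ^ j * ((-1) ^ i * F j i)) = sum ?f ({..Suc n} \<times> {..n})"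
    by (rule sum.cartesian_product)
  also have "{..Suc n} \<times> {..n} = ?L \<union> ?U"
    by auto
  also have "sum ?f (?L \<union> ?U) = sum ?f ?L + sum ?f ?U"
    by (intro sum.union_disjoint fin) auto
  also have "sum ?f ?L = (\<Sum>p\<in>?U. - ?f p)"
  proof (rule sum.reindex_bij_witness[where i = "\<lambda>(j, i). (Suc i, j)" and j = "\<lambda>(j, i). (i, j - 1)"])
    fix p assume "p \<in> ?L"
    then obtain i j where p: "p = (j, i)" "i < j" "j \<le> Suc n"
      by auto
    then show "- ?f (case p of (j, i) \<Rightarrow> (i, j - 1)) = ?f p"
      using assms[of i j] by (cases j) auto
  qed auto
  finally show ?thesis
    by (simp add: sum_negf)
qed

text \<open>A monomial in row y picks one row of m' and translates it by its group element, so a row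
  of monomials yields a signed sum of translated rows.\<close>

lemma mat_mult_monomial_left:
  assumes "group G" "finite (carrier G)" "finite Z"
    and "\<And>i. i \<in> I \<Longrightarrow> s i \<in> Z" "\<And>i. i \<in> I \<Longrightarrow> \<gamma> i \<in> carrier G"
    and m: "\<And>z h. m y z h = (\<Sum>i\<in>I. if s i = z \<and> \<gamma> i = h then \<epsilon> i else 0)"
  shows "mat_mult G Z m m' y x g = (\<Sum>i\<in>I. \<epsilon> i * m' (s i) x (inv\<^bsub>G\<^esub> \<gamma> i \<otimes>\<^bsub>G\<^esub> g))"
proof -
  have "mat_mult G Z m m' y x g = (\<Sum>z\<in>Z. \<Sum>h\<in>carrier G. \<Sum>i\<in>I.
    if s i = z \<and> \<gamma> i = h then \<epsilon> i * m' z x (inv\<^bsub>G\<^esub> h \<otimes>\<^bsub>G\<^esub> g) else 0)"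
    unfolding mat_mult_def m sum_distrib_right by (intro sum.cong) auto
  also have "\<dots> = (\<Sum>z\<in>Z. \<Sum>i\<in>I. \<Sum>h\<in>carrier G.
    if s i = z \<and> \<gamma> i = h then \<epsilon> i * m' z x (inv\<^bsub>G\<^esub> h \<otimes>\<^bsub>G\<^esub> g) else 0)"
    by (intro sum.cong[OF refl] sum.swap)
  also have "\<dots> = (\<Sum>i\<in>I. \<Sum>z\<in>Z. \<Sum>h\<in>carrier G.
    if s i = z \<and> \<gamma> i = h then \<epsilon> i * m' z x (inv\<^bsub>G\<^esub> h \<otimes>\<^bsub>G\<^esub> g) else 0)"
    by (rule sum.swap)
  also have "\<dots> = (\<Sum>i\<in>I. \<epsilon> i * m' (s i) x (inv\<^bsub>G\<^esub> \<gamma> i \<otimes>\<^bsub>G\<^esub> g))"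
  proof (rule sum.cong[OF refl])
    fix i assume i: "i \<in> I"
    have "(\<Sum>z\<in>Z. \<Sum>h\<in>carrier G.
      if s i = z \<and> \<gamma> i = h then \<epsilon> i * m' z x (inv\<^bsub>G\<^esub> h \<otimes>\<^bsub>G\<^esub> g) else 0) =
      (\<Sum>z\<in>Z. if s i = z then \<Sum>h\<in>carrier G.
        if \<gamma> i = h then \<epsilon> i * m' z x (inv\<^bsub>G\<^esub> h \<otimes>\<^bsub>G\<^esub> g) else 0 else 0)"
      by (intro sum.cong) auto
    then show "(\<Sum>z\<in>Z. \<Sum>h\<in>carrier G.
      if s i = z \<and> \<gamma> i = h then \<epsilon> i * m' z x (inv\<^bsub>G\<^esub> h \<otimes>\<^bsub>G\<^esub> g) else 0) =
      \<epsilon> i * m' (s i) x (inv\<^bsub>G\<^esub> \<gamma> i \<otimes>\<^bsub>G\<^esub> g)"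
      using assms(2-5) i by simp
  qed
  finally show ?thesis .
qed

text \<open>The entry counts, with signs, the double faces of y that equal x and have total
  coefficient g. These cancel in pairs by the simplicial identities.\<close>

lemma bar_matrix_mult_bar_matrix:
  assumes "group G" "finite (carrier G)" "y \<in> tuples G (Suc (Suc k))" "g \<in> carrier G"
  shows "mat_mult G (tuples G (Suc k)) (bar_matrix G (Suc k)) (bar_matrix G k) y x g = 0"
proof -
  interpret group G by fact
  define F :: "nat \<Rightarrow> nat \<Rightarrow> int" where "F j i = (if bar_face G i (bar_face G j y) = x \<and>
    bar_coefficient G j y \<otimes>\<^bsub>G\<^esub> bar_coefficient G i (bar_face G j y) = g then 1 else 0)" for j i
  have \<gamma>: "bar_coefficient G j y \<in> carrier G" for j
    using bar_coefficient_closed[OF assms(1,3)] .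
  have face: "bar_face G j y \<in> tuples G (Suc k)" if "j \<le> Suc (Suc k)" for j
    using bar_face_tuples[OF assms(1,3) that] .
  have "mat_mult G (tuples G (Suc k)) (bar_matrix G (Suc k)) (bar_matrix G k) y x g =
    (\<Sum>j\<le>Suc (Suc k). (-1) ^ j *
      bar_matrix G k (bar_face G j y) x (inv\<^bsub>G\<^esub> bar_coefficient G j y \<otimes>\<^bsub>G\<^esub> g))"
    by (rule mat_mult_monomial_left)
      (use assms face \<gamma> in \<open>auto simp: finite_tuples bar_matrix_def\<close>)
  also have "\<dots> = (\<Sum>j\<le>Suc (Suc k). \<Sum>i\<le>Suc k. (-1) ^ j * ((-1) ^ i * F j i))"
  proof (rule sum.cong[OF refl])
    fix j assume "j \<in> {..Suc (Suc k)}"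
    then have j: "j \<le> Suc (Suc k)"
      by simp
    have "\<gamma> = inv\<^bsub>G\<^esub> bar_coefficient G j y \<otimes>\<^bsub>G\<^esub> g \<longleftrightarrow> bar_coefficient G j y \<otimes>\<^bsub>G\<^esub> \<gamma> = g"
      if "\<gamma> \<in> carrier G" for \<gamma>
      using that \<gamma>[of j] assms(4) inv_solve_left by metis
    then show "(-1) ^ j * bar_matrix G k (bar_face G j y) x (inv\<^bsub>G\<^esub> bar_coefficient G j y \<otimes>\<^bsub>G\<^esub> g) =
      (\<Sum>i\<le>Suc k. (-1) ^ j * ((-1) ^ i * F j i))"
      using bar_coefficient_closed[OF assms(1) face[OF j]]
      unfolding bar_matrix_def sum_distrib_left by (intro sum.cong) (auto simp: F_def)
  qed
  also have "\<dots> = 0"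
  proof (rule alternating_double_sum_eq_0)
    fix i j assume ij: "i < j" "j \<le> Suc (Suc k)"
    have y: "set y \<subseteq> carrier G" "length y = Suc (Suc k)"
      using assms(3) by (auto simp: tuples_def)
    show "F j i = F i (j - 1)"
      using bar_face_bar_face[OF assms(1) y(1) ij(1)] bar_coefficient_bar_face[OF assms(1,3) ij] ij y
      by (simp add: F_def)
  qed
  finally show ?thesis .
qed

text \<open>The homotopy inserts a last entry: \<open>(hf)(g\<^sub>1,\<dots>,g\<^sub>k) = \<Sum>\<^sub>g f(g\<^sub>1,\<dots>,g\<^sub>k,g)\<close>.\<close>

definition last_matrix :: "('g, 'b) monoid_scheme \<Rightarrow> 'g list \<Rightarrow> 'g list \<Rightarrow> 'g \<Rightarrow> int" where
  "last_matrix G hs gs g = (if butlast gs = hs \<and> g = \<one>\<^bsub>G\<^esub> then 1 else 0)"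

lemma last_matrix_mult:
  assumes "group G" "finite (carrier G)" "y \<in> tuples G k" "g \<in> carrier G"
  shows "mat_mult G (tuples G (Suc k)) (last_matrix G) m y x g = (\<Sum>a\<in>carrier G. m (y @ [a]) x g)"
proof -
  interpret group G by fact
  \<comment> \<open>A tuple z of length k + 1 with \<open>butlast z = y\<close> is
    \<open>y @ [a]\<close> for exactly one a, so the row is a sum of monomials with coefficient
    1.\<close>
  have "last_matrix G y z h = (\<Sum>a\<in>carrier G. if y @ [a] = z \<and> \<one>\<^bsub>G\<^esub> = h then 1 else 0)"
    if z: "z \<in> tuples G (Suc k)" for z h
  proof (cases "butlast z = y")
    case True
    have "z \<noteq> []" "set z \<subseteq> carrier G"
      using z by (auto simp: tuples_def)
    then have "last z \<in> carrier G"
      using last_in_set by blast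
    have "z = y @ [last z]"
      using append_butlast_last_id[OF \<open>z \<noteq> []\<close>] True by simp
    then have "y @ [a] = z \<longleftrightarrow> a = last z" for a
      by (metis last_snoc)
    with True \<open>last z \<in> carrier G\<close> assms(2) show ?thesis
      by (auto simp: last_matrix_def)
  next
    case False
    then have "y @ [a] \<noteq> z" for a
      by auto
    with False show ?thesis
      by (simp add: last_matrix_def)
  qed
  then have "mat_mult G (tuples G (Suc k)) (last_matrix G) m y x g =
    mat_mult G (tuples G (Suc k)) (\<lambda>y z h. \<Sum>a\<in>carrier G. if y @ [a] = z \<and> \<one>\<^bsub>G\<^esub> = h then 1 else 0) m y x g"
    unfolding mat_mult_def by (intro sum.cong) auto
  also have "\<dots> = (\<Sum>a\<in>carrier G. 1 * m (y @ [a]) x (inv\<^bsub>G\<^esub> \<one>\<^bsub>G\<^esub> \<otimes>\<^bsub>G\<^esub> g))"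
    by (rule mat_mult_monomial_left)
      (use assms finite_tuples[OF assms(2), of "Suc k"] in \<open>auto simp: tuples_def\<close>)
  finally show ?thesis
    using assms(4) by simp
qed

text \<open>Column x of \<open>last_matrix\<close> has a single nonzero entry: the unit, in row
  \<open>butlast x\<close>.\<close>

lemma mult_last_matrix:
  assumes "group G" "finite (carrier G)" "x \<in> tuples G (Suc k)" "g \<in> carrier G"
  shows "mat_mult G (tuples G k) m (last_matrix G) y x g = m y (butlast x) g"
proof -
  interpret group G by fact
  have b: "butlast x \<in> tuples G k"
    using assms(3) by (auto simp: tuples_def dest: in_set_butlastD)
  have eq: "inv\<^bsub>G\<^esub> h \<otimes>\<^bsub>G\<^esub> g = \<one>\<^bsub>G\<^esub> \<longleftrightarrow> h = g" if "h \<in> carrier G" for h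
    using that assms(4) by (metis inv_closed inv_equality inv_inv l_inv)
  have "mat_mult G (tuples G k) m (last_matrix G) y x g =
    (\<Sum>z\<in>tuples G k. if butlast x = z then \<Sum>h\<in>carrier G. if h = g then m y z h else 0 else 0)"
    unfolding mat_mult_def by (intro sum.cong) (auto simp: last_matrix_def eq intro!: sum.cong)
  also have "\<dots> = m y (butlast x) g"
    using assms(2,4) b finite_tuples[OF assms(2)] by simp
  finally show ?thesis .
qed

text \<open>Append a to y and sum over a. A face of \<open>y @ [a]\<close> that keeps or absorbs a
  equals x for at most one a, and gives the same term as the corresponding face of y compared with
  \<open>butlast x\<close>. The last face returns y itself for each of the |G| values of a; its sign
  (-1)^(k+2) is (-1)^k.\<close>

lemma last_matrix_homotopy:
  assumes "group G" "finite (carrier G)" "y \<in> tuples G (Suc k)" "x \<in> tuples G (Suc k)" "g \<in> carrier G"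
  shows "mat_mult G (tuples G (Suc (Suc k))) (last_matrix G) (bar_matrix G (Suc k)) y x g =
    mat_mult G (tuples G k) (bar_matrix G k) (last_matrix G) y x g +
    (-1) ^ k * mat_scalar G (int (card (carrier G))) y x g"
proof -
  interpret group G by fact
  have y: "length y = Suc k" "y \<noteq> []" and "set y \<subseteq> carrier G"
    using assms(3) by (auto simp: tuples_def)
  then have last_y: "last y \<in> carrier G"
    using last_in_set by blast
  have x: "length x = Suc k" "x \<noteq> []" and "set x \<subseteq> carrier G"
    using assms(4) by (auto simp: tuples_def)
  then have last_x: "last x \<in> carrier G"
    using last_in_set by blast
  let ?t = "\<lambda>i gs hs. if bar_face G i gs = hs \<and> bar_coefficient G i gs = g then (-1) ^ i else 0 :: int"
  let ?n = "int (card (carrier G))"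
  have coeff: "bar_coefficient G i (y @ [a]) = bar_coefficient G i y" for i a
    using y by (simp add: bar_coefficient_def)
  have "(\<Sum>a\<in>carrier G. ?t i (y @ [a]) x) = ?t i y (butlast x)" if i: "i \<le> Suc k" for i
  proof (cases "i = Suc k")
    case True
    obtain u b where yu: "y = u @ [b]"
      using y by (metis append_butlast_last_id)
    have "bar_face G i (y @ [a]) = u @ [b \<otimes>\<^bsub>G\<^esub> a]" for a
      using bar_face_penultimate[of G u b a] True y yu by simp
    moreover have "bar_face G i y = u"
      using bar_face_last[OF y(2), of G] True y yu by simp
    \<comment> \<open>The next to last face turns a into b a. As a runs through G this hits the last
      entry of x exactly once, which uses that left multiplication by b is a bijection.\<close>
    moreover have "u @ [b \<otimes>\<^bsub>G\<^esub> a] = x \<longleftrightarrow> u = butlast x \<and> a = inv\<^bsub>G\<^esub> b \<otimes>\<^bsub>G\<^esub> last x"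
      if "a \<in> carrier G" for a
    proof -
      have "u @ [b \<otimes>\<^bsub>G\<^esub> a] = x \<longleftrightarrow> u = butlast x \<and> b \<otimes>\<^bsub>G\<^esub> a = last x"
        using x(2) by (metis append_butlast_last_id butlast_snoc last_snoc)
      then show ?thesis
        using that last_x last_y yu inv_solve_left[of a b "last x"] by auto
    qed
    ultimately have "(\<Sum>a\<in>carrier G. ?t i (y @ [a]) x) = (\<Sum>a\<in>carrier G.
      if a = inv\<^bsub>G\<^esub> b \<otimes>\<^bsub>G\<^esub> last x then ?t i y (butlast x) else 0)"
      by (intro sum.cong) (auto simp: coeff)
    then show ?thesis
      using assms(2) last_x last_y yu by simp
  next
    case False
    then have "bar_face G i (y @ [a]) = x \<longleftrightarrow> bar_face G i y = butlast x \<and> a = last x" for a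
      using x(2) bar_face_append[of i y G a] i y(1)
      by (metis append_butlast_last_id butlast_snoc last_snoc le_SucE le_imp_less_Suc)
    then have "(\<Sum>a\<in>carrier G. ?t i (y @ [a]) x) =
      (\<Sum>a\<in>carrier G. if a = last x then ?t i y (butlast x) else 0)"
      by (intro sum.cong) (auto simp: coeff)
    then show ?thesis
      using assms(2) last_x by simp
  qed
  note main = this
  \<comment> \<open>The dropped entry a no longer matters, so the summation contributes the order of
    G.\<close>
  have top: "(\<Sum>a\<in>carrier G. ?t (Suc (Suc k)) (y @ [a]) x) = (-1) ^ k * mat_scalar G ?n y x g"
  proof -
    have "bar_face G (Suc (Suc k)) (y @ [a]) = y" for a
      using bar_face_last[of "y @ [a]" G] y(1) by simp
    then show ?thesis
      by (auto simp: mat_scalar_def bar_coefficient_def)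
  qed
  have "mat_mult G (tuples G (Suc (Suc k))) (last_matrix G) (bar_matrix G (Suc k)) y x g =
    (\<Sum>i\<le>Suc (Suc k). \<Sum>a\<in>carrier G. ?t i (y @ [a]) x)"
    by (simp only: last_matrix_mult[OF assms(1-3,5)] bar_matrix_def) (rule sum.swap)
  also have "\<dots> = (\<Sum>i\<le>Suc k. ?t i y (butlast x)) + (-1) ^ k * mat_scalar G ?n y x g"
    unfolding sum.atMost_Suc[of _ "Suc k"] top
    by (intro arg_cong2[where f = "(+)"] sum.cong refl main) simp
  finally show ?thesis
    by (simp only: mult_last_matrix[OF assms(1,2,4,5)] bar_matrix_def)
qed

section \<open>The norm element and the augmentation ideal at the splice\<close>

lemma tuples_0 [simp]: "tuples G 0 = {[]}"
  by (auto simp: tuples_def)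

lemma bar_matrix_0:
  "bar_matrix G 0 [a] [] g = (if a = g then 1 else 0) - (if g = \<one>\<^bsub>G\<^esub> then 1 else 0)"
  by (auto simp: bar_matrix_def bar_coefficient_def)

text \<open>Row [a] of the zeroth bar matrix is a - 1, and a - 1 annihilates the norm
  element.\<close>

lemma bar_matrix_mult_norm:
  assumes "group G" "finite (carrier G)" "y \<in> tuples G (Suc 0)"
  shows "mat_mult G (tuples G 0) (bar_matrix G 0) (\<lambda>_ _ _. 1) y x g = 0"
proof -
  interpret group G by fact
  obtain a where "y = [a]" "a \<in> carrier G"
    using assms(3) by (auto simp: tuples_def length_Suc_conv)
  then show ?thesis
    using assms(2) by (simp add: mat_mult_def bar_matrix_0 sum_subtractf)
qed

text \<open>Summing a - 1 over all a gives the norm element, whose coefficients are all 1, minus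
  |G|.\<close>

lemma last_matrix_homotopy_0:
  fixes G :: "('g, 'b) monoid_scheme"
  assumes "group G" "finite (carrier G)" "g \<in> carrier G"
  shows "mat_mult G (tuples G (Suc 0)) (last_matrix G) (bar_matrix G 0) [] [] g =
    1 - mat_scalar G (int (card (carrier G))) ([] :: 'g list) [] g"
proof -
  have "[] \<in> tuples G 0"
    by simp
  from last_matrix_mult[OF assms(1,2) this assms(3), of "bar_matrix G 0" "[]"] show ?thesis
    using assms(2,3) by (simp add: bar_matrix_0 sum_subtractf mat_scalar_def)
qed

section \<open>The complete complex\<close>

definition tate_tuples :: "('g, 'b) monoid_scheme \<Rightarrow> int \<Rightarrow> 'g list set" where
  "tate_tuples G n = tuples G (if n \<ge> 0 then nat n else nat (- n - 1))"

text \<open>The constant 1 in degree -1 is the norm element as a 1 by 1 matrix. It is its own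
  transpose, which makes the whole family self-dual.\<close>

definition tate_matrix :: "('g, 'b) monoid_scheme \<Rightarrow> int \<Rightarrow> 'g list \<Rightarrow> 'g list \<Rightarrow> 'g \<Rightarrow> int" where
  "tate_matrix G n =
     (if n \<ge> 0 then bar_matrix G (nat n)
      else if n = -1 then (\<lambda>_ _ _. 1)
      else mat_transpose G (bar_matrix G (nat (- n - 2))))"

text \<open>Indexed by the target degree, like the differential of the same index run backwards. The
  sign (-1)^(k+1) absorbs the (-1)^k of \<open>last_matrix_homotopy\<close>, so that d s + s d = |G|
  holds uniformly. In degree -1 the identity matrix supplies the norm element that
  \<open>last_matrix_homotopy_0\<close> leaves over.\<close>

definition tate_homotopy :: "('g, 'b) monoid_scheme \<Rightarrow> int \<Rightarrow> 'g list \<Rightarrow> 'g list \<Rightarrow> 'g \<Rightarrow> int" where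
  "tate_homotopy G n =
     (if n \<ge> 0 then (\<lambda>y x g. (-1) ^ (nat n + 1) * last_matrix G y x g)
      else if n = -1 then mat_scalar G 1
      else mat_transpose G (\<lambda>y x g. (-1) ^ (nat (- n - 2) + 1) * last_matrix G y x g))"

lemma tate_tuples_dual: "tate_tuples G (- n - 1) = tate_tuples G n"
  by (auto simp: tate_tuples_def)

lemma finite_tate_tuples: "finite (carrier G) \<Longrightarrow> finite (tate_tuples G n)"
  by (simp add: tate_tuples_def finite_tuples)

text \<open>The degrees dual to n and n + 1 are -n-1 and -n-2, so the transpose of the n-th matrix
  leads from degree -n-2 to -n-1.\<close>

lemma tate_matrix_dual:
  assumes "group G" "g \<in> carrier G"
  shows "tate_matrix G (- n - 2) x y g = mat_transpose G (tate_matrix G n) x y g"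
proof -
  consider "n \<ge> 0" | "n = -1" | "n \<le> -2"
    by linarith
  then show ?thesis
    by cases (auto simp: tate_matrix_def mat_transpose_transpose[OF assms] mat_transpose_def[of _ "\<lambda>_ _ _. 1"])
qed

lemma tate_homotopy_dual:
  assumes "group G" "g \<in> carrier G"
  shows "tate_homotopy G (- n - 2) x y g = mat_transpose G (tate_homotopy G n) x y g"
proof -
  consider "n \<ge> 0" | "n = -1" | "n \<le> -2"
    by linarith
  then show ?thesis
    by cases (auto simp: tate_homotopy_def mat_transpose_transpose[OF assms] mat_transpose_scalar[OF assms])
qed

text \<open>Transfers an identity between products of matrices to the transposed ones; negative
  degrees are settled this way.\<close>

lemma mat_mult_dual:
  assumes "group G" "g \<in> carrier G"
    and m: "\<And>y z h. h \<in> carrier G \<Longrightarrow> m y z h = mat_transpose G n y z h"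
    and m': "\<And>y z h. h \<in> carrier G \<Longrightarrow> m' y z h = mat_transpose G n' y z h"
  shows "mat_mult G Z m m' y x g = mat_mult G Z n' n x y (inv\<^bsub>G\<^esub> g)"
proof -
  have "mat_mult G Z m m' y x g = mat_mult G Z (mat_transpose G n) (mat_transpose G n') y x g"
    by (intro mat_mult_cong assms)
  also have "\<dots> = mat_transpose G (mat_mult G Z n' n) y x g"
    by (rule mat_mult_transpose[symmetric, OF assms(1,2)])
  finally show ?thesis
    by (simp add: mat_transpose_def)
qed

text \<open>For n \<ge> 0 this is the bar complex, and for n = -1 the relation between a - 1 and the
  norm.\<close>

lemma tate_matrix_mult_tate_matrix:
  assumes "group G" "finite (carrier G)" "y \<in> tate_tuples G (n + 2)" "x \<in> tate_tuples G n" "g \<in> carrier G"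
  shows "mat_mult G (tate_tuples G (n + 1)) (tate_matrix G (n + 1)) (tate_matrix G n) y x g = 0"
proof -
  have pos: "mat_mult G (tate_tuples G (n + 1)) (tate_matrix G (n + 1)) (tate_matrix G n) y x g = 0"
    if "n \<ge> -1" "y \<in> tate_tuples G (n + 2)" "g \<in> carrier G" for n y x g
  proof (cases "n = -1")
    case True
    then show ?thesis
      using bar_matrix_mult_norm[OF assms(1,2), of y x g] that
      by (simp add: tate_tuples_def tate_matrix_def)
  next
    case False
    then have n: "n \<ge> 0"
      using that by simp
    then have "nat (n + 1) = Suc (nat n)" "nat (n + 2) = Suc (Suc (nat n))"
      by (simp_all add: nat_add_distrib)
    then show ?thesis
      using n that bar_matrix_mult_bar_matrix[OF assms(1,2), of y "nat n" g x]
      by (simp add: tate_tuples_def tate_matrix_def)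
  qed
  show ?thesis
  proof (cases "n \<ge> -1")
    case True
    then show ?thesis
      using pos assms by blast
  next
    \<comment> \<open>For n \<le> -2 the product is the transpose of the one for -n-3, which is at
      least -1.\<close>
    case False
    have arith: "- n - 3 + 1 = - n - 2" "- n - 3 + 2 = - n - 1" "- (n + 1) - 1 = - n - 2"
      by simp_all
    have "mat_mult G (tate_tuples G (n + 1)) (tate_matrix G (n + 1)) (tate_matrix G n) y x g =
      mat_mult G (tate_tuples G (n + 1)) (tate_matrix G (- n - 2)) (tate_matrix G (- n - 3)) x y (inv\<^bsub>G\<^esub> g)"
    proof (rule mat_mult_dual[OF assms(1,5)])
      fix h y z assume h: "h \<in> carrier G"
      show "tate_matrix G (n + 1) y z h = mat_transpose G (tate_matrix G (- n - 3)) y z h"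
        using tate_matrix_dual[OF assms(1) h, of "- n - 3"] by (simp add: algebra_simps)
      show "tate_matrix G n y z h = mat_transpose G (tate_matrix G (- n - 2)) y z h"
        using tate_matrix_dual[OF assms(1) h, of "- n - 2"] by simp
    qed
    also have "\<dots> = 0"
      using pos[of "- n - 3" x "inv\<^bsub>G\<^esub> g" y, unfolded arith] False assms
        tate_tuples_dual[of G n] tate_tuples_dual[of G "n + 1", unfolded arith]
      by (simp add: group.inv_closed)
    finally show ?thesis .
  qed
qed

text \<open>Positive degrees come from \<open>last_matrix_homotopy\<close>. In degree 0 the first
  summand is the norm element, and the second is minus (norm element minus |G|).\<close>

lemma tate_homotopy_identity:
  assumes "group G" "finite (carrier G)" "y \<in> tate_tuples G n" "x \<in> tate_tuples G n" "g \<in> carrier G"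
  shows "mat_mult G (tate_tuples G (n - 1)) (tate_matrix G (n - 1)) (tate_homotopy G (n - 1)) y x g +
    mat_mult G (tate_tuples G (n + 1)) (tate_homotopy G n) (tate_matrix G n) y x g =
    mat_scalar G (int (card (carrier G))) y x g"
proof -
  have scale_l: "mat_mult G Z (\<lambda>y x g. a * m y x g) m' y x g = a * mat_mult G Z m m' y x g" for Z a m m' y x g
    by (simp add: mat_mult_def sum_distrib_left mult.assoc)
  have scale_r: "mat_mult G Z m (\<lambda>y x g. a * m' y x g) y x g = a * mat_mult G Z m m' y x g" for Z a m m' y x g
    by (simp add: mat_mult_def sum_distrib_left mult.left_commute)
  have pos: "mat_mult G (tate_tuples G (n - 1)) (tate_matrix G (n - 1)) (tate_homotopy G (n - 1)) y x g +
    mat_mult G (tate_tuples G (n + 1)) (tate_homotopy G n) (tate_matrix G n) y x g =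
    mat_scalar G (int (card (carrier G))) y x g"
    if "n \<ge> 0" "y \<in> tate_tuples G n" "x \<in> tate_tuples G n" "g \<in> carrier G" for n y x g
  proof (cases "n = 0")
    case True
    interpret group G by fact
    have [simp]: "y = []" "x = []"
      using True that by (auto simp: tate_tuples_def)
    have eq: "inv\<^bsub>G\<^esub> h \<otimes>\<^bsub>G\<^esub> g = \<one>\<^bsub>G\<^esub> \<longleftrightarrow> h = g" if "h \<in> carrier G" for h
      using that \<open>g \<in> carrier G\<close> by (metis inv_closed inv_equality inv_inv l_inv)
    have "mat_mult G (tuples G 0) (\<lambda>_ _ _. 1) (mat_scalar G 1) y x g =
      (\<Sum>h\<in>carrier G. if h = g then 1 else 0)"
      by (auto simp: mat_mult_def mat_scalar_def eq intro!: sum.cong)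
    also have "\<dots> = 1"
      using assms(2) that(4) by simp
    finally show ?thesis
      using True last_matrix_homotopy_0[OF assms(1,2) that(4)]
      by (simp add: tate_tuples_def tate_matrix_def tate_homotopy_def scale_l[of _ "-1", simplified])
  next
    case False
    define k where "k = nat (n - 1)"
    have n: "n = int k + 1"
      using False that(1) by (simp add: k_def)
    have *: "nat (int k + 1) = Suc k" "nat (int k + 2) = Suc (Suc k)" "nat (2 + int k) = Suc (Suc k)" "nat (1 + int k) = Suc k"
      by auto
    have "y \<in> tuples G (Suc k)" "x \<in> tuples G (Suc k)"
      using that n by (auto simp: tate_tuples_def *)
    from last_matrix_homotopy[OF assms(1,2) this that(4)] show ?thesis
      by (simp add: n tate_tuples_def tate_matrix_def tate_homotopy_def scale_l
          scale_r[of _ _ "- ((-1) ^ k)", simplified] *)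
        (simp add: algebra_simps flip: mult.assoc power_add)
  qed
  show ?thesis
  proof (cases "n \<ge> 0")
    case True
    then show ?thesis
      using pos assms by blast
  next
    case False
    \<comment> \<open>The dual degree is nonnegative. Transposition exchanges the two summands, d s
      in degree n becoming s d in degree -n-1.\<close>
    let ?m = "- n - 1"
    have eq: "tate_tuples G (n - 1) = tate_tuples G (?m + 1)" "tate_tuples G (n + 1) = tate_tuples G (?m - 1)"
      using tate_tuples_dual[of G "n - 1"] tate_tuples_dual[of G "n + 1"] by (simp_all add: algebra_simps)
    have "mat_mult G (tate_tuples G (n - 1)) (tate_matrix G (n - 1)) (tate_homotopy G (n - 1)) y x g =
      mat_mult G (tate_tuples G (?m + 1)) (tate_homotopy G ?m) (tate_matrix G ?m) x y (inv\<^bsub>G\<^esub> g)"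
      unfolding eq(1)
    proof (rule mat_mult_dual[OF assms(1,5)])
      fix h y z assume h: "h \<in> carrier G"
      show "tate_matrix G (n - 1) y z h = mat_transpose G (tate_matrix G ?m) y z h"
        using tate_matrix_dual[OF assms(1) h, of ?m] by (simp add: algebra_simps)
      show "tate_homotopy G (n - 1) y z h = mat_transpose G (tate_homotopy G ?m) y z h"
        using tate_homotopy_dual[OF assms(1) h, of ?m] by (simp add: algebra_simps)
    qed
    moreover have "mat_mult G (tate_tuples G (n + 1)) (tate_homotopy G n) (tate_matrix G n) y x g =
      mat_mult G (tate_tuples G (?m - 1)) (tate_matrix G (?m - 1)) (tate_homotopy G (?m - 1)) x y (inv\<^bsub>G\<^esub> g)"
      unfolding eq(2)
    proof (rule mat_mult_dual[OF assms(1,5)])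
      fix h y z assume h: "h \<in> carrier G"
      show "tate_homotopy G n y z h = mat_transpose G (tate_homotopy G (?m - 1)) y z h"
        using tate_homotopy_dual[OF assms(1) h, of "?m - 1"] by (simp add: algebra_simps)
      show "tate_matrix G n y z h = mat_transpose G (tate_matrix G (?m - 1)) y z h"
        using tate_matrix_dual[OF assms(1) h, of "?m - 1"] by (simp add: algebra_simps)
    qed
    moreover have "mat_scalar G (int (card (carrier G))) x y (inv\<^bsub>G\<^esub> g) =
      mat_scalar G (int (card (carrier G))) y x g"
      using mat_transpose_scalar[OF assms(1,5)] by (simp add: mat_transpose_def)
    ultimately show ?thesis
      using pos[of ?m x y "inv\<^bsub>G\<^esub> g"] False assms tate_tuples_dual[of G n]
      by (simp add: group.inv_closed)
  qed
qed

section \<open>The Tate differentials and the homotopy as actions of matrices\<close>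

context finite_G_module
begin

lemma bar_coboundary_eq_mat_map:
  assumes "c \<in> tuples G k \<rightarrow> carrier A"
  shows "bar_coboundary G A \<phi> k c =
    mat_map G A \<phi> (tuples G k) (tuples G (Suc k)) (bar_matrix G k) c" (is "?l = ?r")
proof
  fix y
  show "?l y = ?r y"
  proof (cases "y \<in> tuples G (Suc k)")
    case True
    have face: "bar_face G i y \<in> tuples G k" if "i \<in> {..Suc k}" for i
      using bar_face_tuples[OF G.group_axioms True] that by simp
    have coeff: "bar_coefficient G i y \<in> carrier G" for i
      by (rule bar_coefficient_closed[OF G.group_axioms True])
    have c: "c (bar_face G i y) \<in> carrier A" if "i \<in> {..Suc k}" for i
      using assms face[OF that] by auto
    have "?r y = (\<Otimes>\<^bsub>A\<^esub>i\<in>{..Suc k}.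
      \<phi> (bar_coefficient G i y) (c (bar_face G i y)) [^]\<^bsub>A\<^esub> ((-1) ^ i :: int))"
      using face coeff by (intro mat_map_monomials finite_tuples finite_G assms True) (auto simp: bar_matrix_def)
    also have "\<dots> = ?l y"
      using True c coeff[of 0]
      by (auto simp: bar_coboundary_def bar_coefficient_def action_one simp del: bar_face_0 intro!: A.finprod_cong')
    finally show ?thesis ..
  qed (auto simp: bar_coboundary_def mat_map_def)
qed

text \<open>Transposing replaces the coefficient g of the zeroth face by its inverse, which is the
  right action used for chains, and turns the faces of a row into the fibres of the face
  maps.\<close>

lemma bar_boundary_eq_mat_map:
  assumes "c \<in> tuples G (Suc k) \<rightarrow> carrier A"
  shows "bar_boundary G A \<phi> k c =
    mat_map G A \<phi> (tuples G (Suc k)) (tuples G k) (mat_transpose G (bar_matrix G k)) c" (is "?l = ?r")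
proof
  fix y
  show "?l y = ?r y"
  proof (cases "y \<in> tuples G k")
    case True
    let ?X = "\<lambda>i. {x \<in> tuples G (Suc k). bar_face G i x = y}"
    have coeff: "bar_coefficient G i x \<in> carrier G" if "x \<in> tuples G (Suc k)" for i x
      by (rule bar_coefficient_closed[OF G.group_axioms that])
    have inv_eq: "bar_coefficient G i x = inv g \<longleftrightarrow> inv (bar_coefficient G i x) = g"
      if "x \<in> tuples G (Suc k)" "g \<in> carrier G" for i x g
      using coeff[OF that(1)] that(2) by auto
    have "?r y = (\<Otimes>\<^bsub>A\<^esub>i\<in>{..Suc k}. \<Otimes>\<^bsub>A\<^esub>x\<in>?X i.
      \<phi> (inv (bar_coefficient G i x)) (c x) [^]\<^bsub>A\<^esub> ((-1) ^ i :: int))"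
      using coeff
      by (intro mat_map_transpose_monomials finite_tuples finite_G assms True)
        (auto simp: bar_matrix_def mat_transpose_def inv_eq cong: if_cong)
    also have "\<dots> = (\<Otimes>\<^bsub>A\<^esub>i\<in>{..Suc k}. \<Otimes>\<^bsub>A\<^esub>x\<in>?X i.
      (if i = 0 then \<phi> (inv (hd x)) (c x) else c x) [^]\<^bsub>A\<^esub> ((-1) ^ i :: int))"
    proof (intro A.finprod_cong'[OF refl])
      fix i x assume x: "x \<in> ?X i"
      then show "\<phi> (inv (bar_coefficient G i x)) (c x) [^]\<^bsub>A\<^esub> ((-1) ^ i :: int) =
        (if i = 0 then \<phi> (inv (hd x)) (c x) else c x) [^]\<^bsub>A\<^esub> ((-1) ^ i :: int)"
        using assms by (auto simp: bar_coefficient_def action_one Pi_iff)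
    next
      show closed: "(\<lambda>x. (if i = 0 then \<phi> (inv (hd x)) (c x) else c x) [^]\<^bsub>A\<^esub> ((-1) ^ i :: int)) \<in> ?X i \<rightarrow> carrier A" for i
        using assms coeff[of _ 0] by (auto simp: bar_coefficient_def Pi_iff)
      show "(\<lambda>i. \<Otimes>\<^bsub>A\<^esub>x\<in>?X i. (if i = 0 then \<phi> (inv (hd x)) (c x) else c x) [^]\<^bsub>A\<^esub> ((-1) ^ i :: int))
        \<in> {..Suc k} \<rightarrow> carrier A"
        by (rule Pi_I) (rule A.finprod_closed[OF closed])
    qed
    also have "\<dots> = ?l y"
      using True by (simp add: bar_boundary_def)
    finally show ?thesis ..
  qed (auto simp: bar_boundary_def mat_map_def)
qed

lemma norm_map_eq_mat_map:
  assumes "c \<in> tuples G 0 \<rightarrow> carrier A"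
  shows "norm_map G A \<phi> c = mat_map G A \<phi> (tuples G 0) (tuples G 0) (\<lambda>_ _ _. 1) c"
proof -
  have "(\<Otimes>\<^bsub>A\<^esub>g\<in>carrier G. \<phi> g (c []) [^]\<^bsub>A\<^esub> (1::int)) = (\<Otimes>\<^bsub>A\<^esub>g\<in>carrier G. \<phi> g (c []))"
    using assms by (intro A.finprod_cong') auto
  then show ?thesis
    using assms by (auto simp: norm_map_def mat_map_def intro!: restrict_ext A.finprod_closed)
qed

lemma tate_cochains_eq: "tate_cochains G A n = product_group (tate_tuples G n) (\<lambda>_. A)"
  by (simp add: tate_cochains_def tate_tuples_def)

lemma tate_cochains_comm_group: "comm_group (tate_cochains G A n)"
  by (simp add: tate_cochains_eq comm_group_product_group A.comm_group_axioms)

lemma tate_differential_eq_mat_map: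
  assumes "c \<in> carrier (tate_cochains G A n)"
  shows "tate_differential G A \<phi> n c =
    mat_map G A \<phi> (tate_tuples G n) (tate_tuples G (n + 1)) (tate_matrix G n) c"
proof -
  have c: "c \<in> tate_tuples G n \<rightarrow> carrier A"
    using assms by (auto simp: tate_cochains_eq)
  consider "n \<ge> 0" | "n = -1" | "n \<le> -2"
    by linarith
  then show ?thesis
  proof cases
    case 1
    then have "nat (n + 1) = Suc (nat n)"
      by simp
    with 1 c bar_coboundary_eq_mat_map[of c "nat n"] show ?thesis
      by (simp add: tate_differential_def tate_tuples_def tate_matrix_def)
  next
    case 2
    with c norm_map_eq_mat_map[of c] show ?thesis
      by (simp add: tate_differential_def tate_tuples_def tate_matrix_def)
  next
    case 3
    then have "tate_tuples G n = tuples G (Suc (nat (- n - 2)))" "tate_tuples G (n + 1) = tuples G (nat (- n - 2))"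
      by (auto simp: tate_tuples_def intro!: arg_cong[where f = "tuples G"])
    with 3 c bar_boundary_eq_mat_map[of c "nat (- n - 2)"] show ?thesis
      by (simp add: tate_differential_def tate_matrix_def)
  qed
qed

lemma tate_differential_hom:
  "tate_differential G A \<phi> n \<in> hom (tate_cochains G A n) (tate_cochains G A (n + 1))"
proof -
  interpret T: comm_group "tate_cochains G A n"
    by (rule tate_cochains_comm_group)
  have "mat_map G A \<phi> (tate_tuples G n) (tate_tuples G (n + 1)) (tate_matrix G n)
    \<in> hom (tate_cochains G A n) (tate_cochains G A (n + 1))"
    unfolding tate_cochains_eq by (rule mat_map_hom[OF finite_tate_tuples[OF finite_G]])
  then show ?thesis
    by (simp add: hom_def Pi_iff tate_differential_eq_mat_map)
qed

lemma tate_differential_closed: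
  assumes "c \<in> carrier (tate_cochains G A n)" "m = n + 1"
  shows "tate_differential G A \<phi> n c \<in> carrier (tate_cochains G A m)"
  using hom_in_carrier[OF tate_differential_hom assms(1)] assms(2) by simp

lemma tate_differential_tate_differential:
  assumes "c \<in> carrier (tate_cochains G A n)"
  shows "tate_differential G A \<phi> (n + 1) (tate_differential G A \<phi> n c) = \<one>\<^bsub>tate_cochains G A (n + 2)\<^esub>"
proof -
  have c: "c \<in> tate_tuples G n \<rightarrow> carrier A"
    using assms by (auto simp: tate_cochains_eq)
  have "tate_differential G A \<phi> (n + 1) (tate_differential G A \<phi> n c) =
    mat_map G A \<phi> (tate_tuples G (n + 1)) (tate_tuples G (n + 2)) (tate_matrix G (n + 1))
      (mat_map G A \<phi> (tate_tuples G n) (tate_tuples G (n + 1)) (tate_matrix G n) c)"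
    using tate_differential_eq_mat_map[OF tate_differential_closed[OF assms refl]]
      tate_differential_eq_mat_map[OF assms] by (simp add: add.assoc)
  also have "\<dots> = mat_map G A \<phi> (tate_tuples G n) (tate_tuples G (n + 2))
      (mat_mult G (tate_tuples G (n + 1)) (tate_matrix G (n + 1)) (tate_matrix G n)) c"
    by (intro mat_map_mult finite_tate_tuples finite_G c)
  also have "\<dots> = mat_map G A \<phi> (tate_tuples G n) (tate_tuples G (n + 2)) (\<lambda>_ _ _. 0) c"
    by (intro mat_map_cong c tate_matrix_mult_tate_matrix G.group_axioms finite_G)
  finally show ?thesis
    by (simp add: mat_map_zero tate_cochains_eq)
qed

definition homotopy where
  "homotopy (n :: int) = mat_map G A \<phi> (tate_tuples G (n + 1)) (tate_tuples G n) (tate_homotopy G n)"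

lemma homotopy_hom: "homotopy n \<in> hom (tate_cochains G A (n + 1)) (tate_cochains G A n)"
  unfolding tate_cochains_eq homotopy_def by (rule mat_map_hom[OF finite_tate_tuples[OF finite_G]])

lemma int_pow_product_group_apply:
  assumes "c \<in> carrier (product_group X (\<lambda>_. A))" "x \<in> X"
  shows "(c [^]\<^bsub>product_group X (\<lambda>_. A)\<^esub> (k::int)) x = c x [^]\<^bsub>A\<^esub> k"
proof -
  interpret P: comm_group "product_group X (\<lambda>_. A)"
    by (simp add: comm_group_product_group A.comm_group_axioms)
  interpret p: group_hom "product_group X (\<lambda>_. A)" A "\<lambda>c. c x"
    using assms(2) by unfold_locales (auto intro!: homI)
  show ?thesis
    by (rule p.hom_int_pow[OF assms(1)])
qed

lemma homotopy_identity:
  assumes "c \<in> carrier (tate_cochains G A n)"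
  shows "tate_differential G A \<phi> (n - 1) (homotopy (n - 1) c) \<otimes>\<^bsub>tate_cochains G A n\<^esub>
    homotopy n (tate_differential G A \<phi> n c) = c [^]\<^bsub>tate_cochains G A n\<^esub> int (card (carrier G))"
proof -
  let ?X = "tate_tuples G"
  interpret P: comm_group "tate_cochains G A n"
    by (rule tate_cochains_comm_group)
  have c: "c \<in> ?X n \<rightarrow> carrier A"
    using assms by (auto simp: tate_cochains_eq)
  have fin: "finite (?X k)" for k
    by (rule finite_tate_tuples[OF finite_G])
  have "homotopy (n - 1) c \<in> carrier (tate_cochains G A (n - 1))"
    using hom_in_carrier[OF homotopy_hom[of "n - 1"], of c] assms by simp
  then have "tate_differential G A \<phi> (n - 1) (homotopy (n - 1) c) =
    mat_map G A \<phi> (?X (n - 1)) (?X n) (tate_matrix G (n - 1))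
      (mat_map G A \<phi> (?X n) (?X (n - 1)) (tate_homotopy G (n - 1)) c)"
    by (simp add: tate_differential_eq_mat_map homotopy_def)
  also have "\<dots> = mat_map G A \<phi> (?X n) (?X n)
    (mat_mult G (?X (n - 1)) (tate_matrix G (n - 1)) (tate_homotopy G (n - 1))) c"
    by (intro mat_map_mult fin c)
  finally have 1: "tate_differential G A \<phi> (n - 1) (homotopy (n - 1) c) = \<dots>" .
  have "homotopy n (tate_differential G A \<phi> n c) = mat_map G A \<phi> (?X (n + 1)) (?X n) (tate_homotopy G n)
    (mat_map G A \<phi> (?X n) (?X (n + 1)) (tate_matrix G n) c)"
    using assms by (simp add: tate_differential_eq_mat_map homotopy_def)
  also have "\<dots> = mat_map G A \<phi> (?X n) (?X n)
    (mat_mult G (?X (n + 1)) (tate_homotopy G n) (tate_matrix G n)) c"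
    by (intro mat_map_mult fin c)
  finally have 2: "homotopy n (tate_differential G A \<phi> n c) = \<dots>" .
  have "tate_differential G A \<phi> (n - 1) (homotopy (n - 1) c) \<otimes>\<^bsub>tate_cochains G A n\<^esub>
    homotopy n (tate_differential G A \<phi> n c) =
    mat_map G A \<phi> (?X n) (?X n) (\<lambda>y x g.
      mat_mult G (?X (n - 1)) (tate_matrix G (n - 1)) (tate_homotopy G (n - 1)) y x g +
      mat_mult G (?X (n + 1)) (tate_homotopy G n) (tate_matrix G n) y x g) c"
    unfolding 1 2 tate_cochains_eq by (rule mat_map_add[symmetric, OF c])
  also have "\<dots> = mat_map G A \<phi> (?X n) (?X n) (mat_scalar G (int (card (carrier G)))) c"
    by (intro mat_map_cong c tate_homotopy_identity G.group_axioms finite_G)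
  also have "\<dots> = (\<lambda>x\<in>?X n. c x [^]\<^bsub>A\<^esub> int (card (carrier G)))"
    by (rule mat_map_scalar[OF fin c])
  also have "\<dots> = c [^]\<^bsub>tate_cochains G A n\<^esub> int (card (carrier G))"
  proof (rule extensionalityI)
    show "c [^]\<^bsub>tate_cochains G A n\<^esub> int (card (carrier G)) \<in> extensional (?X n)"
      using P.int_pow_closed[OF assms, of "int (card (carrier G))"] by (auto simp: tate_cochains_eq PiE_def)
    show "(\<lambda>x\<in>?X n. c x [^]\<^bsub>A\<^esub> int (card (carrier G))) x = (c [^]\<^bsub>tate_cochains G A n\<^esub> int (card (carrier G))) x"
      if "x \<in> ?X n" for x
      using assms that int_pow_product_group_apply[of c "?X n" x] by (simp add: tate_cochains_eq)
  qed simp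
  finally show ?thesis .
qed

section \<open>The contragredient module and the evaluation pairing\<close>

lemma contragredient_apply:
  assumes "f \<in> carrier (hom_group A B)" "u \<in> carrier A"
  shows "contragredient G A B \<phi> g f u = f (\<phi> (inv g) u)"
  using assms by (simp add: contragredient_def)

lemma contragredient_closed:
  assumes "g \<in> carrier G" "f \<in> carrier (hom_group A B)"
  shows "contragredient G A B \<phi> g f \<in> carrier (hom_group A B)"
proof -
  have "f \<circ> \<phi> (inv g) \<in> hom A B"
    using assms by (intro Group.hom_compose[OF action_hom hom_groupD(1)]) auto
  from restrict_hom_group[OF A.group_axioms this] show ?thesis
    using assms by (simp add: contragredient_def comp_def)
qed

lemma contragredient_mult:
  assumes "g \<in> carrier G" "h \<in> carrier G" "f \<in> carrier (hom_group A B)"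
  shows "contragredient G A B \<phi> (g \<otimes> h) f = contragredient G A B \<phi> g (contragredient G A B \<phi> h f)"
  using assms
  by (intro hom_group_eqI[of _ A B])
    (auto simp: contragredient_closed contragredient_apply G.inv_mult_group action_mult)

lemma contragredient_one:
  assumes "f \<in> carrier (hom_group A B)"
  shows "contragredient G A B \<phi> \<one> f = f"
  using assms
  by (intro hom_group_eqI[of _ A B])
    (auto simp: contragredient_closed contragredient_apply action_one)

text \<open>Makes everything proved about the complex of a finite G-module available for the dual
  Hom(A, B); the action of the inverse of g provides bijectivity.\<close>

lemma finite_G_module_contragredient:
  assumes "comm_group B"
  shows "finite_G_module G (hom_group A B) (contragredient G A B \<phi>)"
proof -
  interpret B: comm_group B by fact
  interpret H: comm_group "hom_group A B"
    by (intro comm_group_hom_group A.group_axioms assms)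
  let ?H = "carrier (hom_group A B)"
  let ?\<psi> = "contragredient G A B \<phi>"
  have cancel: "?\<psi> (inv g) (?\<psi> g f) = f" "?\<psi> g (?\<psi> (inv g) f) = f" if "g \<in> carrier G" "f \<in> ?H" for g f
    using contragredient_mult[of "inv g" g f B] contragredient_mult[of g "inv g" f B] that
    by (simp_all add: contragredient_one)
  have auto: "?\<psi> g \<in> auto (hom_group A B)" if g: "g \<in> carrier G" for g
  proof -
    have "?\<psi> g \<in> hom (hom_group A B) (hom_group A B)"
    proof (rule homI)
      fix f f' assume f: "f \<in> ?H" "f' \<in> ?H"
      have "(f \<otimes>\<^bsub>hom_group A B\<^esub> f') u = f u \<otimes>\<^bsub>B\<^esub> f' u" if "u \<in> carrier A" for f f' u
        using that by (simp add: hom_group_def)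
      then show "?\<psi> g (f \<otimes>\<^bsub>hom_group A B\<^esub> f') = ?\<psi> g f \<otimes>\<^bsub>hom_group A B\<^esub> ?\<psi> g f'"
        using f g by (intro hom_group_eqI[of _ A B]) (auto simp: contragredient_closed contragredient_apply)
    qed (use g in \<open>simp add: contragredient_closed\<close>)
    moreover have "bij_betw (?\<psi> g) ?H ?H"
      using g cancel by (intro bij_betwI[where g = "?\<psi> (inv g)"]) (auto simp: contragredient_closed)
    ultimately show ?thesis
      by (simp add: auto_def Bij_def contragredient_def)
  qed
  have "?\<psi> \<in> hom G (AutoGroup (hom_group A B))"
  proof (rule homI)
    fix g h assume gh: "g \<in> carrier G" "h \<in> carrier G"
    have "?\<psi> (g \<otimes> h) = compose ?H (?\<psi> g) (?\<psi> h)"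
    proof (rule extensionalityI)
      show "?\<psi> (g \<otimes> h) \<in> extensional ?H"
        by (simp add: contragredient_def)
    qed (use gh in \<open>auto simp: contragredient_mult compose_def\<close>)
    then show "?\<psi> (g \<otimes> h) = ?\<psi> g \<otimes>\<^bsub>AutoGroup (hom_group A B)\<^esub> ?\<psi> h"
      using auto gh by (simp add: AutoGroup_def BijGroup_def auto_def)
  qed (simp add: auto AutoGroup_def)
  then show ?thesis
    using H.AutoGroup finite_G
    by (simp add: finite_G_module_def finite_G_module_axioms_def G_module_def group_hom_def
        group_hom_axioms_def H.comm_group_axioms G.group_axioms)
qed

end

text \<open>For finite X this is the pairing that identifies Hom(A, B)^X with Hom(A^X, B).\<close>

definition pairing :: "('b, 'd) monoid_scheme \<Rightarrow> 'x set \<Rightarrow> ('x \<Rightarrow> 'a \<Rightarrow> 'b) \<Rightarrow> ('x \<Rightarrow> 'a) \<Rightarrow> 'b" where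
  "pairing B X f c = (\<Otimes>\<^bsub>B\<^esub>x\<in>X. f x (c x))"

definition single :: "('a, 'c) monoid_scheme \<Rightarrow> 'x set \<Rightarrow> 'x \<Rightarrow> 'a \<Rightarrow> 'x \<Rightarrow> 'a" where
  "single A X x u = (\<lambda>y\<in>X. if y = x then u else \<one>\<^bsub>A\<^esub>)"

locale evaluation_pairing = A: comm_group A + B: comm_group B
  for A :: "('a, 'c) monoid_scheme" and B :: "('b, 'd) monoid_scheme" +
  fixes X :: "'x set"
  assumes finite_X: "finite X"
begin

lemma pairing_hom:
  assumes "f \<in> X \<rightarrow> carrier (hom_group A B)"
  shows "pairing B X f \<in> hom (product_group X (\<lambda>_. A)) B"
proof (rule homI)
  have f: "f x \<in> hom A B" if "x \<in> X" for x
    using assms that hom_groupD(1) by blast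
  have f_closed: "f x u \<in> carrier B" if "x \<in> X" "u \<in> carrier A" for x u
    using hom_in_carrier[OF f that(2)] that(1) by simp
  show "pairing B X f c \<in> carrier B" if "c \<in> carrier (product_group X (\<lambda>_. A))" for c
    using that f_closed by (auto simp: pairing_def intro!: B.finprod_closed)
  show "pairing B X f (c \<otimes>\<^bsub>product_group X (\<lambda>_. A)\<^esub> c') = pairing B X f c \<otimes>\<^bsub>B\<^esub> pairing B X f c'"
    if "c \<in> carrier (product_group X (\<lambda>_. A))" "c' \<in> carrier (product_group X (\<lambda>_. A))" for c c'
  proof -
    have c_closed: "c x \<in> carrier A" "c' x \<in> carrier A" if "x \<in> X" for x
      using that \<open>c \<in> _\<close> \<open>c' \<in> _\<close> by auto
    have "pairing B X f (c \<otimes>\<^bsub>product_group X (\<lambda>_. A)\<^esub> c') = (\<Otimes>\<^bsub>B\<^esub>x\<in>X. f x (c x) \<otimes>\<^bsub>B\<^esub> f x (c' x))"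
      unfolding pairing_def using c_closed f_closed
      by (intro B.finprod_cong') (auto simp: hom_mult[OF f])
    also have "\<dots> = pairing B X f c \<otimes>\<^bsub>B\<^esub> pairing B X f c'"
      unfolding pairing_def using that f_closed by (intro B.finprod_multf) auto
    finally show ?thesis .
  qed
qed

lemma pairing_mult:
  assumes "f \<in> X \<rightarrow> carrier (hom_group A B)" "f' \<in> X \<rightarrow> carrier (hom_group A B)" "c \<in> X \<rightarrow> carrier A"
  shows "pairing B X (f \<otimes>\<^bsub>product_group X (\<lambda>_. hom_group A B)\<^esub> f') c = pairing B X f c \<otimes>\<^bsub>B\<^esub> pairing B X f' c"
proof -
  have closed: "f x (c x) \<in> carrier B" "f' x (c x) \<in> carrier B" if "x \<in> X" for x
    using assms that hom_groupD(2) by (metis PiE Pi_mem)+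
  have "pairing B X (f \<otimes>\<^bsub>product_group X (\<lambda>_. hom_group A B)\<^esub> f') c =
    (\<Otimes>\<^bsub>B\<^esub>x\<in>X. f x (c x) \<otimes>\<^bsub>B\<^esub> f' x (c x))"
    unfolding pairing_def using assms(3) closed
    by (intro B.finprod_cong') (auto simp: hom_group_def Pi_iff)
  also have "\<dots> = pairing B X f c \<otimes>\<^bsub>B\<^esub> pairing B X f' c"
    unfolding pairing_def using closed by (intro B.finprod_multf) auto
  finally show ?thesis .
qed

lemma pairing_single:
  assumes "f \<in> X \<rightarrow> carrier (hom_group A B)" "x \<in> X" "u \<in> carrier A"
  shows "pairing B X f (single A X x u) = f x u"
proof -
  have f: "f y \<in> hom A B" if "y \<in> X" for y
    using assms that hom_groupD(1) by blast
  have "pairing B X f (single A X x u) = (\<Otimes>\<^bsub>B\<^esub>y\<in>X. if y = x then f y u else \<one>\<^bsub>B\<^esub>)"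
    unfolding pairing_def using hom_in_carrier[OF f assms(3)]
    by (intro B.finprod_cong') (auto simp: single_def hom_one[OF f A.group_axioms B.group_axioms])
  also have "\<dots> = f x u"
    using hom_in_carrier[OF f assms(3)] assms by (intro B.finprod_indicator finite_X) auto
  finally show ?thesis .
qed

text \<open>Nondegeneracy: cochains supported at one coordinate recover every value of every
  component of f.\<close>

lemma pairing_eqI:
  assumes "f \<in> carrier (product_group X (\<lambda>_. hom_group A B))" "f' \<in> carrier (product_group X (\<lambda>_. hom_group A B))"
    and "\<And>c. c \<in> carrier (product_group X (\<lambda>_. A)) \<Longrightarrow> pairing B X f c = pairing B X f' c"
  shows "f = f'"
proof (rule PiE_ext)
  show "f \<in> (\<Pi>\<^sub>E x\<in>X. carrier (hom_group A B))" "f' \<in> (\<Pi>\<^sub>E x\<in>X. carrier (hom_group A B))"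
    using assms by auto
  fix x assume x: "x \<in> X"
  show "f x = f' x"
  proof (rule hom_group_eqI)
    show "f x \<in> carrier (hom_group A B)" "f' x \<in> carrier (hom_group A B)"
      using assms x by auto
    fix u assume u: "u \<in> carrier A"
    have "f \<in> X \<rightarrow> carrier (hom_group A B)" "f' \<in> X \<rightarrow> carrier (hom_group A B)"
      using assms by auto
    moreover have "single A X x u \<in> carrier (product_group X (\<lambda>_. A))"
      using u by (auto simp: single_def)
    ultimately show "f x u = f' x u"
      using assms(3) pairing_single x u by metis
  qed
qed

text \<open>The components of f are the restrictions of F to the coordinate copies of A. They
  determine F because a cochain on a finite set is the sum of its coordinates.\<close>

lemma pairing_representation:
  assumes "F \<in> hom (product_group X (\<lambda>_. A)) B"
  obtains f where "f \<in> carrier (product_group X (\<lambda>_. hom_group A B))"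
    "\<And>c. c \<in> carrier (product_group X (\<lambda>_. A)) \<Longrightarrow> pairing B X f c = F c"
proof -
  let ?P = "product_group X (\<lambda>_. A)"
  interpret P: comm_group ?P
    by (simp add: comm_group_product_group A.comm_group_axioms)
  have single_closed: "single A X x u \<in> carrier ?P" if "u \<in> carrier A" for x u
    using that by (auto simp: single_def)
  have "single A X x \<in> hom A ?P" for x
    by (rule homI) (auto simp: single_def fun_eq_iff)
  then have hom: "F \<circ> single A X x \<in> hom A B" for x
    using hom_compose assms by blast
  define f where "f = (\<lambda>x\<in>X. restrict (F \<circ> single A X x) (carrier A))"
  have f: "f \<in> carrier (product_group X (\<lambda>_. hom_group A B))"
    using restrict_hom_group[OF A.group_axioms hom] by (auto simp: f_def)
  moreover have "pairing B X f c = F c" if c: "c \<in> carrier ?P" for c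
  proof -
    have c_closed: "c x \<in> carrier A" if "x \<in> X" for x
      using c that by auto
    have "(\<Otimes>\<^bsub>?P\<^esub>x\<in>X. single A X x (c x)) = c"
    proof (rule PiE_ext)
      have "(\<Otimes>\<^bsub>?P\<^esub>x\<in>X. single A X x (c x)) \<in> carrier ?P"
        using c_closed single_closed by (intro P.finprod_closed) blast
      then show "(\<Otimes>\<^bsub>?P\<^esub>x\<in>X. single A X x (c x)) \<in> (\<Pi>\<^sub>E x\<in>X. carrier A)"
        by simp
      show "c \<in> (\<Pi>\<^sub>E x\<in>X. carrier A)"
        using c by simp
      fix y assume y: "y \<in> X"
      have "(\<lambda>c. c y) \<in> hom ?P A"
        using y by (auto intro!: homI)
      then have "(\<Otimes>\<^bsub>?P\<^esub>x\<in>X. single A X x (c x)) y = (\<Otimes>\<^bsub>A\<^esub>x\<in>X. single A X x (c x) y)"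
        using c_closed single_closed
        by (intro hom_finprod[OF P.comm_group_axioms A.comm_group_axioms, of "\<lambda>c. c y"]) blast+
      also have "\<dots> = (\<Otimes>\<^bsub>A\<^esub>x\<in>X. if x = y then c x else \<one>\<^bsub>A\<^esub>)"
        using y c_closed by (intro A.finprod_cong') (auto simp: single_def)
      also have "\<dots> = c y"
        using y c_closed by (intro A.finprod_indicator finite_X) auto
      finally show "(\<Otimes>\<^bsub>?P\<^esub>x\<in>X. single A X x (c x)) y = c y" .
    qed
    then have "F c = F (\<Otimes>\<^bsub>?P\<^esub>x\<in>X. single A X x (c x))"
      by simp
    also have "\<dots> = (\<Otimes>\<^bsub>B\<^esub>x\<in>X. F (single A X x (c x)))"
      using c_closed single_closed
      by (intro hom_finprod[OF P.comm_group_axioms B.comm_group_axioms assms]) blast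
    also have "\<dots> = pairing B X f c"
      unfolding pairing_def using c_closed hom_in_carrier[OF hom]
      by (intro B.finprod_cong') (auto simp: f_def)
    finally show ?thesis ..
  qed
  ultimately show thesis
    by (rule that)
qed

end

text \<open>The contragredient action moves g to the argument as its inverse, so the adjoint of m is
  its transpose. This is where the two complexes are matched.\<close>

lemma (in finite_G_module) pairing_mat_map:
  assumes "comm_group B" "finite X" "finite Y"
    and f: "f \<in> X \<rightarrow> carrier (hom_group A B)" and c: "c \<in> Y \<rightarrow> carrier A"
  shows "pairing B Y (mat_map G (hom_group A B) (contragredient G A B \<phi>) X Y m f) c =
    pairing B X f (mat_map G A \<phi> Y X (mat_transpose G m) c)"
proof -
  interpret B: comm_group B by fact
  interpret H: finite_G_module G "hom_group A B" "contragredient G A B \<phi>"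
    by (rule finite_G_module_contragredient[OF assms(1)])
  let ?\<psi> = "contragredient G A B \<phi>"
  have c_closed: "c y \<in> carrier A" if "y \<in> Y" for y
    using c that by auto
  have f_closed: "f x \<in> carrier (hom_group A B)" if "x \<in> X" for x
    using f that by auto
  have fc_closed: "f x (\<phi> g (c y)) \<in> carrier B" if "x \<in> X" "y \<in> Y" "g \<in> carrier G" for x y g
    using hom_groupD(2)[OF f_closed] that c_closed by simp
  have "pairing B Y (mat_map G (hom_group A B) ?\<psi> X Y m f) c =
    (\<Otimes>\<^bsub>B\<^esub>y\<in>Y. \<Otimes>\<^bsub>B\<^esub>x\<in>X. \<Otimes>\<^bsub>B\<^esub>g\<in>carrier G. f x (\<phi> (inv g) (c y)) [^]\<^bsub>B\<^esub> m y x g)"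
    unfolding pairing_def
  proof (rule B.finprod_cong'[OF refl])
    show "(\<lambda>y. \<Otimes>\<^bsub>B\<^esub>x\<in>X. \<Otimes>\<^bsub>B\<^esub>g\<in>carrier G. f x (\<phi> (inv g) (c y)) [^]\<^bsub>B\<^esub> m y x g) \<in> Y \<rightarrow> carrier B"
      using fc_closed by (auto intro!: B.finprod_closed)
    fix y assume y: "y \<in> Y"
    have "mat_map G (hom_group A B) ?\<psi> X Y m f y (c y) =
      (\<Otimes>\<^bsub>B\<^esub>x\<in>X. (\<Otimes>\<^bsub>hom_group A B\<^esub>g\<in>carrier G. ?\<psi> g (f x) [^]\<^bsub>hom_group A B\<^esub> m y x g) (c y))"
      using y f_closed c_closed
      by (simp add: mat_map_def)
        (intro finprod_hom_group_apply A.group_axioms assms(1) Pi_I H.A.finprod_closed, auto)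
    also have "\<dots> = (\<Otimes>\<^bsub>B\<^esub>x\<in>X. \<Otimes>\<^bsub>B\<^esub>g\<in>carrier G. f x (\<phi> (inv g) (c y)) [^]\<^bsub>B\<^esub> m y x g)"
    proof (rule B.finprod_cong'[OF refl])
      show "(\<lambda>x. \<Otimes>\<^bsub>B\<^esub>g\<in>carrier G. f x (\<phi> (inv g) (c y)) [^]\<^bsub>B\<^esub> m y x g) \<in> X \<rightarrow> carrier B"
        using fc_closed y by (auto intro!: B.finprod_closed)
      fix x assume x: "x \<in> X"
      have "(\<Otimes>\<^bsub>hom_group A B\<^esub>g\<in>carrier G. ?\<psi> g (f x) [^]\<^bsub>hom_group A B\<^esub> m y x g) (c y) =
        (\<Otimes>\<^bsub>B\<^esub>g\<in>carrier G. (?\<psi> g (f x) [^]\<^bsub>hom_group A B\<^esub> m y x g) (c y))"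
        using x y f_closed c_closed
        by (intro finprod_hom_group_apply A.group_axioms assms(1)) auto
      also have "\<dots> = (\<Otimes>\<^bsub>B\<^esub>g\<in>carrier G. f x (\<phi> (inv g) (c y)) [^]\<^bsub>B\<^esub> m y x g)"
        using x y f_closed c_closed fc_closed
        by (intro B.finprod_cong')
          (auto simp: int_pow_hom_group_apply[OF A.group_axioms assms(1)] contragredient_apply)
      finally show "(\<Otimes>\<^bsub>hom_group A B\<^esub>g\<in>carrier G. ?\<psi> g (f x) [^]\<^bsub>hom_group A B\<^esub> m y x g) (c y) =
        (\<Otimes>\<^bsub>B\<^esub>g\<in>carrier G. f x (\<phi> (inv g) (c y)) [^]\<^bsub>B\<^esub> m y x g)" .
    qed
    finally show "mat_map G (hom_group A B) ?\<psi> X Y m f y (c y) =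
      (\<Otimes>\<^bsub>B\<^esub>x\<in>X. \<Otimes>\<^bsub>B\<^esub>g\<in>carrier G. f x (\<phi> (inv g) (c y)) [^]\<^bsub>B\<^esub> m y x g)" .
  qed
  also have "\<dots> = (\<Otimes>\<^bsub>B\<^esub>x\<in>X. \<Otimes>\<^bsub>B\<^esub>y\<in>Y. \<Otimes>\<^bsub>B\<^esub>g\<in>carrier G. f x (\<phi> (inv g) (c y)) [^]\<^bsub>B\<^esub> m y x g)"
    using fc_closed assms(2,3) by (intro B.finprod_swap B.finprod_closed) auto
  also have "\<dots> = (\<Otimes>\<^bsub>B\<^esub>x\<in>X. f x (mat_map G A \<phi> Y X (mat_transpose G m) c x))"
  proof (rule B.finprod_cong'[OF refl])
    have "mat_map G A \<phi> Y X (mat_transpose G m) c \<in> (\<Pi>\<^sub>E x\<in>X. carrier A)"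
      by (rule mat_map_closed[OF c])
    then show "(\<lambda>x. f x (mat_map G A \<phi> Y X (mat_transpose G m) c x)) \<in> X \<rightarrow> carrier B"
      using hom_groupD(2)[OF f_closed] by auto
    fix x assume x: "x \<in> X"
    have fx: "f x \<in> hom A B"
      using hom_groupD(1)[OF f_closed[OF x]] .
    interpret fx: group_hom A B "f x"
      using fx by unfold_locales
    have "f x (mat_map G A \<phi> Y X (mat_transpose G m) c x) =
      (\<Otimes>\<^bsub>B\<^esub>y\<in>Y. f x (\<Otimes>\<^bsub>A\<^esub>g\<in>carrier G. \<phi> g (c y) [^]\<^bsub>A\<^esub> m y x (inv g)))"
      using x c_closed
      by (simp add: mat_map_def mat_transpose_def)
        (intro hom_finprod[OF A.comm_group_axioms assms(1) fx] Pi_I A.finprod_closed, auto)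
    also have "\<dots> = (\<Otimes>\<^bsub>B\<^esub>y\<in>Y. \<Otimes>\<^bsub>B\<^esub>g\<in>carrier G. f x (\<phi> (inv g) (c y)) [^]\<^bsub>B\<^esub> m y x g)"
    proof (rule B.finprod_cong'[OF refl])
      show "(\<lambda>y. \<Otimes>\<^bsub>B\<^esub>g\<in>carrier G. f x (\<phi> (inv g) (c y)) [^]\<^bsub>B\<^esub> m y x g) \<in> Y \<rightarrow> carrier B"
        using fc_closed x by (auto intro!: B.finprod_closed)
      fix y assume y: "y \<in> Y"
      have "f x (\<Otimes>\<^bsub>A\<^esub>g\<in>carrier G. \<phi> g (c y) [^]\<^bsub>A\<^esub> m y x (inv g)) =
        (\<Otimes>\<^bsub>B\<^esub>g\<in>carrier G. f x (\<phi> g (c y) [^]\<^bsub>A\<^esub> m y x (inv g)))"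
        using y c_closed by (intro hom_finprod[OF A.comm_group_axioms assms(1) fx]) auto
      \<comment> \<open>Reindexing by inversion absorbs the inverse in the transposed coefficient
        and places it on the acting element.\<close>
      also have "\<dots> = (\<Otimes>\<^bsub>B\<^esub>g\<in>carrier G. (\<lambda>g. f x (\<phi> (inv g) (c y)) [^]\<^bsub>B\<^esub> m y x g) (inv g))"
        using x y c_closed fc_closed
        by (intro B.finprod_cong') (auto simp: fx.hom_int_pow)
      also have "\<dots> = (\<Otimes>\<^bsub>B\<^esub>g\<in>m_inv G ` carrier G. f x (\<phi> (inv g) (c y)) [^]\<^bsub>B\<^esub> m y x g)"
        using x y fc_closed by (intro B.finprod_reindex[symmetric] G.inv_inj) auto
      also have "m_inv G ` carrier G = carrier G"
        by (auto simp: image_iff) (metis G.inv_closed G.inv_inv)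
      finally show "f x (\<Otimes>\<^bsub>A\<^esub>g\<in>carrier G. \<phi> g (c y) [^]\<^bsub>A\<^esub> m y x (inv g)) =
        (\<Otimes>\<^bsub>B\<^esub>g\<in>carrier G. f x (\<phi> (inv g) (c y)) [^]\<^bsub>B\<^esub> m y x g)" .
    qed
    finally show "(\<Otimes>\<^bsub>B\<^esub>y\<in>Y. \<Otimes>\<^bsub>B\<^esub>g\<in>carrier G. f x (\<phi> (inv g) (c y)) [^]\<^bsub>B\<^esub> m y x g) =
      f x (mat_map G A \<phi> Y X (mat_transpose G m) c x)" ..
  qed
  finally show ?thesis
    by (simp add: pairing_def)
qed

section \<open>Duality\<close>

text \<open>Pairs degree k of the complex of Hom(A, B) with degree -k-1 of the complex of A. The
  hypothesis k + m = -1 in the lemmas about it records this.\<close>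

abbreviation tate_pairing ::
    "('g, 'b) monoid_scheme \<Rightarrow> ('e, 'd) monoid_scheme \<Rightarrow> int \<Rightarrow> ('g list \<Rightarrow> 'a \<Rightarrow> 'e) \<Rightarrow> ('g list \<Rightarrow> 'a) \<Rightarrow> 'e" where
  "tate_pairing G B k \<equiv> pairing B (tate_tuples G k)"

context finite_G_module
begin

lemma tate_tuples_dual_degree: "k + m = -1 \<Longrightarrow> tate_tuples G k = tate_tuples G m"
  using tate_tuples_dual[of G m] by (metis add_diff_cancel_right' minus_diff_commute)

lemma evaluation_pairing_tate: "comm_group B \<Longrightarrow> evaluation_pairing A B (tate_tuples G k)"
  by (simp add: evaluation_pairing_def evaluation_pairing_axioms_def A.comm_group_axioms
      finite_tate_tuples finite_G)

lemma dual_cochains_eq: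
  "tate_cochains G (hom_group A B) k = product_group (tate_tuples G k) (\<lambda>_. hom_group A B)"
  by (simp add: tate_cochains_def tate_tuples_def)

lemma tate_pairing_hom:
  assumes "comm_group B" "k + m = -1" "f \<in> carrier (tate_cochains G (hom_group A B) k)"
  shows "tate_pairing G B k f \<in> hom (tate_cochains G A m) B"
  using evaluation_pairing.pairing_hom[OF evaluation_pairing_tate[OF assms(1)], of f k] assms(3)
    tate_tuples_dual_degree[OF assms(2)]
  by (auto simp: tate_cochains_eq dual_cochains_eq)

lemma tate_pairing_mult:
  assumes "comm_group B" "k + m = -1" "f \<in> carrier (tate_cochains G (hom_group A B) k)"
    "f' \<in> carrier (tate_cochains G (hom_group A B) k)" "c \<in> carrier (tate_cochains G A m)"
  shows "tate_pairing G B k (f \<otimes>\<^bsub>tate_cochains G (hom_group A B) k\<^esub> f') c =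
    tate_pairing G B k f c \<otimes>\<^bsub>B\<^esub> tate_pairing G B k f' c"
  using evaluation_pairing.pairing_mult[OF evaluation_pairing_tate[OF assms(1)], of f k f' c] assms(3-)
    tate_tuples_dual_degree[OF assms(2)]
  by (auto simp: tate_cochains_eq dual_cochains_eq)

lemma tate_pairing_eqI:
  assumes "comm_group B" "k + m = -1" "f \<in> carrier (tate_cochains G (hom_group A B) k)"
    "f' \<in> carrier (tate_cochains G (hom_group A B) k)"
    and "\<And>c. c \<in> carrier (tate_cochains G A m) \<Longrightarrow> tate_pairing G B k f c = tate_pairing G B k f' c"
  shows "f = f'"
  using evaluation_pairing.pairing_eqI[OF evaluation_pairing_tate[OF assms(1)], of f k f'] assms(3-)
    tate_tuples_dual_degree[OF assms(2)]
  by (simp add: tate_cochains_eq dual_cochains_eq)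

lemma tate_pairing_representation:
  assumes "comm_group B" "k + m = -1" "F \<in> hom (tate_cochains G A m) B"
  obtains f where "f \<in> carrier (tate_cochains G (hom_group A B) k)"
    "\<And>c. c \<in> carrier (tate_cochains G A m) \<Longrightarrow> tate_pairing G B k f c = F c"
  using evaluation_pairing.pairing_representation[OF evaluation_pairing_tate[OF assms(1)], of F k] assms(3)
    tate_tuples_dual_degree[OF assms(2)]
  by (metis tate_cochains_eq dual_cochains_eq)

lemma tate_pairing_one:
  assumes "comm_group B" "k + m = -1" "c \<in> carrier (tate_cochains G A m)"
  shows "tate_pairing G B k \<one>\<^bsub>tate_cochains G (hom_group A B) k\<^esub> c = \<one>\<^bsub>B\<^esub>"
proof -
  interpret B: comm_group B by fact
  have "c x \<in> carrier A" if "x \<in> tate_tuples G k" for x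
    using assms(3) that tate_tuples_dual_degree[OF assms(2)] by (auto simp: tate_cochains_eq)
  moreover have "\<one>\<^bsub>tate_cochains G (hom_group A B) k\<^esub> = (\<lambda>x\<in>tate_tuples G k. \<lambda>u\<in>carrier A. \<one>\<^bsub>B\<^esub>)"
    unfolding dual_cochains_eq by (simp add: hom_group_def)
  ultimately show ?thesis
    by (auto simp: pairing_def intro!: B.finprod_one_eqI)
qed

text \<open>The differential out of degree k of the dual complex is adjoint, without any sign, to
  the one into degree m, as m - 1 = -k-2 is the degree of the transposed matrix.\<close>

lemma tate_pairing_differential:
  assumes "comm_group B" "k + m = -1" "f \<in> carrier (tate_cochains G (hom_group A B) k)"
    "c \<in> carrier (tate_cochains G A (m - 1))"
  shows "tate_pairing G B (k + 1) (tate_differential G (hom_group A B) (contragredient G A B \<phi>) k f) c =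
    tate_pairing G B k f (tate_differential G A \<phi> (m - 1) c)"
proof -
  interpret H: finite_G_module G "hom_group A B" "contragredient G A B \<phi>"
    by (rule finite_G_module_contragredient[OF assms(1)])
  let ?X = "tate_tuples G k" and ?Y = "tate_tuples G (k + 1)"
  have X: "?X = tate_tuples G m" and Y: "?Y = tate_tuples G (m - 1)"
    using assms(2) tate_tuples_dual_degree[of k m] tate_tuples_dual_degree[of "k + 1" "m - 1"] by simp_all
  have c: "c \<in> ?Y \<rightarrow> carrier A"
    using assms(4) Y by (auto simp: tate_cochains_eq)
  have "tate_pairing G B (k + 1) (tate_differential G (hom_group A B) (contragredient G A B \<phi>) k f) c =
    pairing B ?X f (mat_map G A \<phi> ?Y ?X (mat_transpose G (tate_matrix G k)) c)"
    unfolding H.tate_differential_eq_mat_map[OF assms(3)]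
    using assms(3) c
    by (intro pairing_mat_map assms(1) finite_tate_tuples finite_G) (auto simp: dual_cochains_eq)
  also have "mat_map G A \<phi> ?Y ?X (mat_transpose G (tate_matrix G k)) c =
    mat_map G A \<phi> ?Y ?X (tate_matrix G (m - 1)) c"
  proof (rule mat_map_cong[OF c])
    fix y x g assume "g \<in> carrier G"
    have "m - 1 = - k - 2"
      using assms(2) by simp
    then show "mat_transpose G (tate_matrix G k) y x g = tate_matrix G (m - 1) y x g"
      using tate_matrix_dual[OF G.group_axioms \<open>g \<in> carrier G\<close>, of k y x] by (simp only:)
  qed
  finally show ?thesis
    using tate_differential_eq_mat_map[OF assms(4)] X Y by simp
qed

section \<open>Cocycles and coboundaries as groups\<close>

lemma cocycles_subgroup:
  "subgroup (kernel (tate_cochains G A n) (tate_cochains G A (n + 1)) (tate_differential G A \<phi> n))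
    (tate_cochains G A n)"
  using tate_differential_hom tate_cochains_comm_group
  by (intro group_hom.subgroup_kernel) (simp add: group_hom_def group_hom_axioms_def comm_group_def)

lemma cocycles_comm_group:
  "comm_group ((tate_cochains G A n)\<lparr>carrier :=
    kernel (tate_cochains G A n) (tate_cochains G A (n + 1)) (tate_differential G A \<phi> n)\<rparr>)"
proof -
  interpret T: comm_group "tate_cochains G A n"
    by (rule tate_cochains_comm_group)
  show ?thesis
    using T.subgroup_imp_group[OF cocycles_subgroup]
    by (rule group.group_comm_groupI) (simp add: kernel_def T.m_comm)
qed

lemma coboundaries_subgroup:
  "subgroup (tate_differential G A \<phi> (n - 1) ` carrier (tate_cochains G A (n - 1)))
    ((tate_cochains G A n)\<lparr>carrier :=
      kernel (tate_cochains G A n) (tate_cochains G A (n + 1)) (tate_differential G A \<phi> n)\<rparr>)"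
proof -
  interpret T: comm_group "tate_cochains G A n"
    by (rule tate_cochains_comm_group)
  interpret d: group_hom "tate_cochains G A (n - 1)" "tate_cochains G A n" "tate_differential G A \<phi> (n - 1)"
    using tate_differential_hom[of "n - 1"] tate_cochains_comm_group
    by (simp add: group_hom_def group_hom_axioms_def comm_group_def)
  have "tate_differential G A \<phi> (n - 1) ` carrier (tate_cochains G A (n - 1)) \<subseteq>
    kernel (tate_cochains G A n) (tate_cochains G A (n + 1)) (tate_differential G A \<phi> n)"
    using tate_differential_tate_differential[of _ "n - 1"] by (auto simp: kernel_def add.commute)
  then show ?thesis
    using T.subgroup_incl[OF d.img_is_subgroup cocycles_subgroup] by blast
qed

text \<open>Under the pairing the dual cocycles are the annihilator of the coboundaries, and the
  dual coboundaries that of the cocycles. Injectivity of Q/Z enters twice: for the second of these,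
  and to extend characters from cocycles to all cochains.\<close>

lemma tate_cohomology_torsion_dual_iso:
  "tate_cohomology G (torsion_dual A) (contragredient G A rationals_mod_integers \<phi>) (n - 1) \<cong>
    torsion_dual (tate_cohomology G A \<phi> (- n))"
proof -
  let ?B = rationals_mod_integers
  let ?H = "hom_group A ?B" and ?\<psi> = "contragredient G A rationals_mod_integers \<phi>"
  let ?T = "tate_cochains G A" and ?U = "tate_cochains G ?H"
  let ?d = "tate_differential G A \<phi>" and ?dU = "tate_differential G ?H ?\<psi>"
  define m where "m = - n"
  let ?Z = "kernel (?T m) (?T (m + 1)) (?d m)"
  note B = comm_group_rationals_mod_integers
  interpret H: finite_G_module G ?H ?\<psi>
    by (rule finite_G_module_contragredient[OF B])
  have deg: "(n - 1) + m = -1" "(n - 2) + (m + 1) = -1" "n + (m - 1) = -1"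
    by (simp_all add: m_def)
  have adj: "tate_pairing G ?B n (?dU (n - 1) f) b = tate_pairing G ?B (n - 1) f (?d (m - 1) b)"
    if "f \<in> carrier (?U (n - 1))" "b \<in> carrier (?T (m - 1))" for f b
    using tate_pairing_differential[OF B deg(1) that] by simp
  have adj': "tate_pairing G ?B (n - 1) (?dU (n - 2) g) c = tate_pairing G ?B (n - 2) g (?d m c)"
    if "g \<in> carrier (?U (n - 2))" "c \<in> carrier (?T m)" for g c
    using tate_pairing_differential[OF B deg(2), of g c] that by simp
  \<comment> \<open>Adjointness turns the condition d f = 0 into vanishing of f on coboundaries; the
    converse direction uses nondegeneracy.\<close>
  have cocycle_iff: "?dU (n - 1) f = \<one>\<^bsub>?U n\<^esub> \<longleftrightarrow>
      (\<forall>b\<in>carrier (?T (m - 1)). tate_pairing G ?B (n - 1) f (?d (m - 1) b) = \<one>\<^bsub>?B\<^esub>)"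
    if f: "f \<in> carrier (?U (n - 1))" for f
  proof
    assume "?dU (n - 1) f = \<one>\<^bsub>?U n\<^esub>"
    then show "\<forall>b\<in>carrier (?T (m - 1)). tate_pairing G ?B (n - 1) f (?d (m - 1) b) = \<one>\<^bsub>?B\<^esub>"
      using adj[OF f] tate_pairing_one[OF B deg(3)] by metis
  next
    assume *: "\<forall>b\<in>carrier (?T (m - 1)). tate_pairing G ?B (n - 1) f (?d (m - 1) b) = \<one>\<^bsub>?B\<^esub>"
    show "?dU (n - 1) f = \<one>\<^bsub>?U n\<^esub>"
    proof (rule tate_pairing_eqI[OF B deg(3)])
      show "?dU (n - 1) f \<in> carrier (?U n)"
        using H.tate_differential_closed[OF f] by simp
      show "\<one>\<^bsub>?U n\<^esub> \<in> carrier (?U n)"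
        using H.tate_cochains_comm_group[of n] by (simp add: comm_group_def group.is_monoid)
    qed (use * adj[OF f] tate_pairing_one[OF B deg(3)] in metis)
  qed
  let ?X = "(?U (n - 1))\<lparr>carrier := kernel (?U (n - 1)) (?U (n - 1 + 1)) (?dU (n - 1))\<rparr>"
  let ?K = "(?T m)\<lparr>carrier := ?Z\<rparr>"
  have "?X Mod (?dU (n - 1 - 1) ` carrier (?U (n - 1 - 1))) \<cong>
    hom_group (?K Mod (?d (m - 1) ` carrier (?T (m - 1)))) ?B"
  proof (rule quotient_pairing_iso[where \<beta> = "tate_pairing G ?B (n - 1)"])
    show "group ?X"
      by (rule comm_group.axioms(2)[OF H.cocycles_comm_group])
    show "comm_group ?K" "subgroup (?d (m - 1) ` carrier (?T (m - 1))) ?K" "comm_group ?B"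
      by (rule cocycles_comm_group coboundaries_subgroup B)+
    show "tate_pairing G ?B (n - 1) f \<in> hom ?K ?B" if "f \<in> carrier ?X" for f
      using tate_pairing_hom[OF B deg(1), of f] that by (auto simp: kernel_def hom_def)
    show "tate_pairing G ?B (n - 1) (f \<otimes>\<^bsub>?X\<^esub> f') c =
      tate_pairing G ?B (n - 1) f c \<otimes>\<^bsub>?B\<^esub> tate_pairing G ?B (n - 1) f' c"
      if "f \<in> carrier ?X" "f' \<in> carrier ?X" "c \<in> carrier ?K" for f f' c
      using tate_pairing_mult[OF B deg(1), of f f' c] that by (auto simp: kernel_def)
    show "tate_pairing G ?B (n - 1) f c = \<one>\<^bsub>?B\<^esub>"
      if "f \<in> carrier ?X" "c \<in> ?d (m - 1) ` carrier (?T (m - 1))" for f c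
      using that cocycle_iff[of f] by (auto simp: kernel_def)
    show "?dU (n - 1 - 1) ` carrier (?U (n - 1 - 1)) =
      {f \<in> carrier ?X. \<forall>c\<in>carrier ?K. tate_pairing G ?B (n - 1) f c = \<one>\<^bsub>?B\<^esub>}" (is "?L = ?R")
    proof (intro equalityI subsetI)
      fix f assume "f \<in> ?L"
      then obtain g where g: "g \<in> carrier (?U (n - 2))" "f = ?dU (n - 2) g"
        by auto
      have "f \<in> carrier ?X"
        using g H.tate_differential_closed[OF g(1)] H.tate_differential_tate_differential[OF g(1)]
        by (simp add: kernel_def)
      moreover have "tate_pairing G ?B (n - 1) f c = \<one>\<^bsub>?B\<^esub>" if "c \<in> carrier ?K" for c
      proof -
        have "tate_pairing G ?B (n - 1) f c = tate_pairing G ?B (n - 2) g \<one>\<^bsub>?T (m + 1)\<^esub>"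
          using that adj'[OF g(1), of c] g(2) by (simp add: kernel_def)
        also have "\<dots> = \<one>\<^bsub>?B\<^esub>"
          using Group.hom_one[OF tate_pairing_hom[OF B deg(2) g(1)]] tate_cochains_comm_group B
          by (simp add: comm_group_def)
        finally show ?thesis .
      qed
      ultimately show "f \<in> ?R"
        by blast
    next
      fix f assume f: "f \<in> ?R"
      then have f_closed: "f \<in> carrier (?U (n - 1))"
        by (simp add: kernel_def)
      have "tate_pairing G ?B (n - 1) f c = \<one>\<^bsub>?B\<^esub>"
        if "c \<in> carrier (?T m)" "?d m c = \<one>\<^bsub>?T (m + 1)\<^esub>" for c
        using f that by (simp add: kernel_def)
      \<comment> \<open>Since f kills the kernel of d, it factors as F after d. A cochain g
        representing F then has coboundary f, again by adjointness and nondegeneracy.\<close>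
      then obtain F where F: "F \<in> hom (?T (m + 1)) ?B"
        "\<And>c. c \<in> carrier (?T m) \<Longrightarrow> tate_pairing G ?B (n - 1) f c = F (?d m c)"
        using hom_factor_divisible[OF tate_cochains_comm_group tate_cochains_comm_group B
            rationals_mod_integers_divisible tate_differential_hom tate_pairing_hom[OF B deg(1) f_closed]]
        by blast
      obtain g where g: "g \<in> carrier (?U (n - 2))"
        "\<And>c. c \<in> carrier (?T (m + 1)) \<Longrightarrow> tate_pairing G ?B (n - 2) g c = F c"
        using tate_pairing_representation[OF B deg(2) F(1)] by blast
      have "?dU (n - 2) g = f"
      proof (rule tate_pairing_eqI[OF B deg(1)])
        show "?dU (n - 2) g \<in> carrier (?U (n - 1))"
          using H.tate_differential_closed[OF g(1)] by simp
        show "tate_pairing G ?B (n - 1) (?dU (n - 2) g) c = tate_pairing G ?B (n - 1) f c"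
          if "c \<in> carrier (?T m)" for c
          using that adj'[OF g(1)] g(2) F(2) tate_differential_closed by simp
      qed (rule f_closed)
      then show "f \<in> ?L"
        using g(1) by force
    qed
    fix \<chi> assume \<chi>: "\<chi> \<in> hom ?K ?B" "\<And>c. c \<in> ?d (m - 1) ` carrier (?T (m - 1)) \<Longrightarrow> \<chi> c = \<one>\<^bsub>?B\<^esub>"
    \<comment> \<open>The character is defined only on cocycles, whereas a dual cochain is a
      character of all cochains, so it has to be extended.\<close>
    obtain F where F: "F \<in> hom (?T m) ?B" "\<And>c. c \<in> ?Z \<Longrightarrow> F c = \<chi> c"
      using hom_extension_divisible[OF tate_cochains_comm_group B rationals_mod_integers_divisible
          cocycles_subgroup \<chi>(1)] by blast
    obtain f where f: "f \<in> carrier (?U (n - 1))"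
      "\<And>c. c \<in> carrier (?T m) \<Longrightarrow> tate_pairing G ?B (n - 1) f c = F c"
      using tate_pairing_representation[OF B deg(1) F(1)] by blast
    have coboundary: "?d (m - 1) b \<in> ?Z" if "b \<in> carrier (?T (m - 1))" for b
      using subgroup.subset[OF coboundaries_subgroup[of m]] that by auto
    have "?dU (n - 1) f = \<one>\<^bsub>?U n\<^esub>"
      unfolding cocycle_iff[OF f(1)] using f(2) F(2) \<chi>(2) coboundary by (auto simp: kernel_def)
    then have "f \<in> carrier ?X"
      using f(1) by (simp add: kernel_def)
    moreover have "\<forall>c\<in>carrier ?K. tate_pairing G ?B (n - 1) f c = \<chi> c"
      using f(2) F(2) by (simp add: kernel_def)
    ultimately show "\<exists>f\<in>carrier ?X. \<forall>c\<in>carrier ?K. tate_pairing G ?B (n - 1) f c = \<chi> c"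
      by blast
  qed
  then show ?thesis
    by (simp add: tate_cohomology_def torsion_dual_def m_def)
qed

text \<open>The pairing splits F into characters of A, one for each tuple. Each lifts to the
  rationals because A is free, and the lifts reassemble to a homomorphism on cochains.\<close>

lemma tate_cochains_hom_lift:
  assumes "A \<cong> free_Abelian_group S" "F \<in> hom (tate_cochains G A m) rationals_mod_integers"
  obtains F' where "F' \<in> hom (tate_cochains G A m) rational_group"
    "\<And>c. c \<in> carrier (tate_cochains G A m) \<Longrightarrow> fractional_part (F' c) = F c"
proof -
  note B = comm_group_rationals_mod_integers and Q = comm_group_rational_group
  let ?k = "- m - 1"
  have deg: "?k + m = -1"
    by simp
  obtain f where f: "f \<in> carrier (tate_cochains G (hom_group A rationals_mod_integers) ?k)"
    "\<And>c. c \<in> carrier (tate_cochains G A m) \<Longrightarrow> tate_pairing G rationals_mod_integers ?k f c = F c"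
    using tate_pairing_representation[OF B deg assms(2)] by blast
  have "\<exists>f'. f' \<in> hom A rational_group \<and> (\<forall>u\<in>carrier A. fractional_part (f' u) = f x u)"
    if x: "x \<in> tate_tuples G ?k" for x
  proof -
    have "f x \<in> hom A rationals_mod_integers"
      using f(1) x by (auto simp: dual_cochains_eq dest!: PiE_mem hom_groupD(1))
    show ?thesis
      by (rule free_hom_lift[OF A.group_axioms assms(1) Q comm_group.axioms(2)[OF B]
          fractional_part_hom fractional_part_surj \<open>f x \<in> _\<close>]) blast
  qed
  then obtain f' where f': "\<And>x. x \<in> tate_tuples G ?k \<Longrightarrow> f' x \<in> hom A rational_group"
    "\<And>x u. \<lbrakk>x \<in> tate_tuples G ?k; u \<in> carrier A\<rbrakk> \<Longrightarrow> fractional_part (f' x u) = f x u"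
    by metis
  \<comment> \<open>The restrictions make the lifts extensional, as membership in
    \<open>hom_group\<close> and in the product group requires.\<close>
  define f'' where "f'' = (\<lambda>x\<in>tate_tuples G ?k. restrict (f' x) (carrier A))"
  have f'': "f'' \<in> carrier (tate_cochains G (hom_group A rational_group) ?k)"
    using restrict_hom_group[OF A.group_axioms f'(1)] by (auto simp: f''_def dual_cochains_eq)
  show thesis
  proof (rule that[OF tate_pairing_hom[OF Q deg f'']])
    fix c assume c: "c \<in> carrier (tate_cochains G A m)"
    have "c x \<in> carrier A" if "x \<in> tate_tuples G ?k" for x
      using c that tate_tuples_dual_degree[OF deg] by (auto simp: tate_cochains_eq)
    then have "fractional_part (f'' x (c x)) = f x (c x)" if "x \<in> tate_tuples G ?k" for x
      using that f'(2) by (simp add: f''_def)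
    moreover have "f x (c x) \<in> carrier rationals_mod_integers" if "x \<in> tate_tuples G ?k" for x
      using calculation[OF that] fractional_part.hom_closed[of "f'' x (c x)"] by simp
    ultimately have "tate_pairing G rationals_mod_integers ?k (\<lambda>x u. fractional_part (f'' x u)) c =
      tate_pairing G rationals_mod_integers ?k f c"
      unfolding pairing_def
      by (intro comm_monoid.finprod_cong' comm_group.axioms(1)[OF B]) auto
    moreover have "fractional_part (tate_pairing G rational_group ?k f'' c) =
      tate_pairing G rationals_mod_integers ?k (\<lambda>x u. fractional_part (f'' x u)) c"
      unfolding pairing_def by (rule hom_finprod[OF Q B fractional_part_hom]) simp
    ultimately have "fractional_part (tate_pairing G rational_group ?k f'' c) =
      tate_pairing G rationals_mod_integers ?k f c"
      by simp
    then show "fractional_part (tate_pairing G rational_group ?k f'' c) = F c"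
      using f(2)[OF c] by simp
  qed
qed

text \<open>The pairing fed to \<open>quotient_pairing_iso\<close> is \<beta> f c = f(s c) / N
  modulo the integers. In place of injectivity of the integers, which fails, characters are extended
  in Q/Z, lifted to the rationals, and corrected to become integral.\<close>

lemma tate_cohomology_integral_dual_iso:
  assumes "A \<cong> free_Abelian_group S"
  shows "tate_cohomology G (integral_dual A) (contragredient G A integer_group \<phi>) n \<cong>
    torsion_dual (tate_cohomology G A \<phi> (- n))"
proof -
  let ?H = "hom_group A integer_group" and ?\<psi> = "contragredient G A integer_group \<phi>"
  let ?T = "tate_cochains G A" and ?U = "tate_cochains G ?H"
  let ?d = "tate_differential G A \<phi>" and ?dU = "tate_differential G ?H ?\<psi>"
  let ?p = "tate_pairing G integer_group"
  define m where "m = - n"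
  define N where "N = card (carrier G)"
  have N: "N > 0"
    using finite_G by (auto simp: N_def card_gt_0_iff)
  let ?Z = "kernel (?T m) (?T (m + 1)) (?d m)"
  note B = comm_group_rationals_mod_integers and Q = comm_group_rational_group
    and Int = abelian_integer_group
  interpret H: finite_G_module G ?H ?\<psi>
    by (rule finite_G_module_contragredient[OF Int])
  have deg: "n + (m - 1) = -1" "(n - 1) + m = -1" "(n + 1) + (m - 2) = -1"
    by (simp_all add: m_def)
  interpret T: comm_group "?T k" for k
    by (rule tate_cochains_comm_group)
  interpret U: comm_group "?U k" for k
    by (rule H.tate_cochains_comm_group)
  have dd: "?d m (?d (m - 1) b) = \<one>\<^bsub>?T (m + 1)\<^esub>" if "b \<in> carrier (?T (m - 1))" for b
    using tate_differential_tate_differential[OF that] by (simp add: add.commute)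
  have dd': "?d (m - 1) (?d (m - 2) a) = \<one>\<^bsub>?T m\<^esub>" if "a \<in> carrier (?T (m - 2))" for a
    using tate_differential_tate_differential[OF that] by simp
  have d_closed: "?d (m - 1) b \<in> carrier (?T m)" if "b \<in> carrier (?T (m - 1))" for b
    using tate_differential_closed[OF that] by simp
  have d_closed': "?d (m - 2) a \<in> carrier (?T (m - 1))" if "a \<in> carrier (?T (m - 2))" for a
    using tate_differential_closed[OF that] by simp
  \<comment> \<open>The homotopy from degree m = -n to degree m - 1, the one that pairs with degree
    n.\<close>
  define s where "s = homotopy (m - 1)"
  have s_hom: "s \<in> hom (?T m) (?T (m - 1))"
    using homotopy_hom[of "m - 1"] by (simp add: s_def)
  have s_closed: "s c \<in> carrier (?T (m - 1))" if "c \<in> carrier (?T m)" for c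
    using hom_in_carrier[OF s_hom that] .
  have adj: "?p (n + 1) (?dU n f) a = ?p n f (?d (m - 2) a)"
    if "f \<in> carrier (?U n)" "a \<in> carrier (?T (m - 2))" for f a
    using tate_pairing_differential[OF Int deg(1), of f a] that by simp
  have adj': "?p n (?dU (n - 1) g) b = ?p (n - 1) g (?d (m - 1) b)"
    if "g \<in> carrier (?U (n - 1))" "b \<in> carrier (?T (m - 1))" for g b
    using tate_pairing_differential[OF Int deg(2), of g b] that by simp
  have p_hom: "group_hom (?T (m - 1)) integer_group (?p n f)" if "f \<in> carrier (?U n)" for f
    using tate_pairing_hom[OF Int deg(1) that] by (simp add: group_hom_def group_hom_axioms_def T.group_axioms)
  have p_hom': "group_hom (?T m) integer_group (?p (n - 1) g)" if "g \<in> carrier (?U (n - 1))" for g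
    using tate_pairing_hom[OF Int deg(2) that] by (simp add: group_hom_def group_hom_axioms_def T.group_axioms)
  have cocycle_iff: "?dU n f = \<one>\<^bsub>?U (n + 1)\<^esub> \<longleftrightarrow>
      (\<forall>a\<in>carrier (?T (m - 2)). ?p n f (?d (m - 2) a) = 0)"
    if f: "f \<in> carrier (?U n)" for f
  proof
    assume "?dU n f = \<one>\<^bsub>?U (n + 1)\<^esub>"
    then show "\<forall>a\<in>carrier (?T (m - 2)). ?p n f (?d (m - 2) a) = 0"
      using adj[OF f] tate_pairing_one[OF Int deg(3)] by (metis one_integer_group)
  next
    assume *: "\<forall>a\<in>carrier (?T (m - 2)). ?p n f (?d (m - 2) a) = 0"
    show "?dU n f = \<one>\<^bsub>?U (n + 1)\<^esub>"
    proof (rule tate_pairing_eqI[OF Int deg(3)])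
      show "?dU n f \<in> carrier (?U (n + 1))"
        using H.tate_differential_closed[OF f] by simp
      show "\<one>\<^bsub>?U (n + 1)\<^esub> \<in> carrier (?U (n + 1))"
        by simp
    qed (use * adj[OF f] tate_pairing_one[OF Int deg(3)] in \<open>metis one_integer_group\<close>)
  qed
  \<comment> \<open>On cocycles the summand s d of the homotopy identity vanishes.\<close>
  have ds: "?d (m - 1) (s c) = c [^]\<^bsub>?T m\<^esub> int N" if "c \<in> ?Z" for c
  proof -
    have c: "c \<in> carrier (?T m)" "?d m c = \<one>\<^bsub>?T (m + 1)\<^esub>"
      using that by (auto simp: kernel_def)
    have "homotopy m \<one>\<^bsub>?T (m + 1)\<^esub> = \<one>\<^bsub>?T m\<^esub>"
      by (rule Group.hom_one[OF homotopy_hom T.group_axioms T.group_axioms])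
    then show ?thesis
      using homotopy_identity[OF c(1)] c d_closed[OF s_closed[OF c(1)]] by (simp add: s_def N_def)
  qed
  \<comment> \<open>Dually, an integral cocycle f kills the summand d s.\<close>
  have sd: "?p n f (s (?d (m - 1) b)) = int N * ?p n f b"
    if f: "f \<in> carrier (?U n)" "?dU n f = \<one>\<^bsub>?U (n + 1)\<^esub>" and b: "b \<in> carrier (?T (m - 1))" for f b
  proof -
    interpret f: group_hom "?T (m - 1)" integer_group "?p n f"
      by (rule p_hom[OF f(1)])
    have a: "homotopy (m - 2) b \<in> carrier (?T (m - 2))"
      using hom_in_carrier[OF homotopy_hom[of "m - 2"], of b] b by simp
    have "?d (m - 2) (homotopy (m - 2) b) \<otimes>\<^bsub>?T (m - 1)\<^esub> s (?d (m - 1) b) = b [^]\<^bsub>?T (m - 1)\<^esub> int N"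
      using homotopy_identity[OF b] by (simp add: s_def N_def)
    then have "?p n f (?d (m - 2) (homotopy (m - 2) b)) + ?p n f (s (?d (m - 1) b)) = int N * ?p n f b"
      using f.hom_mult[OF d_closed'[OF a] s_closed[OF d_closed[OF b]]] f.hom_int_pow[OF b, of "int N"]
      by simp
    then show ?thesis
      using cocycle_iff[OF f(1)] f(2) a by simp
  qed
  define \<rho> where "\<rho> f c = rat_of_int (?p n f (s c)) / of_nat N" for f c
  have \<rho>_hom: "\<rho> f \<in> hom (?T m) rational_group" if f: "f \<in> carrier (?U n)" for f
  proof -
    interpret f: group_hom "?T (m - 1)" integer_group "?p n f"
      by (rule p_hom[OF f])
    show ?thesis
      using s_closed by (auto intro!: homI simp: \<rho>_def Group.hom_mult[OF s_hom] add_divide_distrib)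
  qed
  define \<beta> where "\<beta> f c = fractional_part (\<rho> f c)" for f c
  have \<beta>_hom: "\<beta> f \<in> hom (?T m) rationals_mod_integers" if "f \<in> carrier (?U n)" for f
    using Group.hom_compose[OF \<rho>_hom[OF that] fractional_part_hom] by (simp add: \<beta>_def[abs_def] comp_def)
  \<comment> \<open>A rational-valued homomorphism with integral values is one into the integers;
    the floor function serves only to change the type of its values.\<close>
  have integral: "\<exists>F. F \<in> hom (?T k) integer_group \<and> (\<forall>c\<in>carrier (?T k). of_int (F c) = X c)"
    if X: "X \<in> hom (?T k) rational_group" "\<And>c. c \<in> carrier (?T k) \<Longrightarrow> X c \<in> \<int>" for X k
  proof (intro exI conjI ballI)
    have "X c = of_int \<lfloor>X c\<rfloor>" if "c \<in> carrier (?T k)" for c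
      using X(2)[OF that] by (metis Ints_cases floor_of_int)
    then show "(\<lambda>c. \<lfloor>X c\<rfloor>) \<in> hom (?T k) integer_group"
      using Group.hom_mult[OF X(1)] by (auto intro!: homI) (metis floor_add_int)
    show "of_int \<lfloor>X c\<rfloor> = X c" if "c \<in> carrier (?T k)" for c
      using X(2)[OF that] by (metis Ints_cases floor_of_int)
  qed
  let ?X = "(?U n)\<lparr>carrier := kernel (?U n) (?U (n + 1)) (?dU n)\<rparr>"
  let ?K = "(?T m)\<lparr>carrier := ?Z\<rparr>"
  have "?X Mod (?dU (n - 1) ` carrier (?U (n - 1))) \<cong>
    hom_group (?K Mod (?d (m - 1) ` carrier (?T (m - 1)))) rationals_mod_integers"
  proof (rule quotient_pairing_iso[where \<beta> = \<beta>])
    show "group ?X"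
      by (rule comm_group.axioms(2)[OF H.cocycles_comm_group])
    show "comm_group ?K" "subgroup (?d (m - 1) ` carrier (?T (m - 1))) ?K" "comm_group rationals_mod_integers"
      by (rule cocycles_comm_group coboundaries_subgroup B)+
    show "\<beta> f \<in> hom ?K rationals_mod_integers" if "f \<in> carrier ?X" for f
      using \<beta>_hom[of f] that by (auto simp: kernel_def hom_def)
    show "\<beta> (f \<otimes>\<^bsub>?X\<^esub> f') c = \<beta> f c \<otimes>\<^bsub>rationals_mod_integers\<^esub> \<beta> f' c"
      if "f \<in> carrier ?X" "f' \<in> carrier ?X" "c \<in> carrier ?K" for f f' c
    proof -
      have "?p n (f \<otimes>\<^bsub>?U n\<^esub> f') (s c) = ?p n f (s c) + ?p n f' (s c)"
        using tate_pairing_mult[OF Int deg(1), of f f' "s c"] that s_closed by (simp add: kernel_def)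
      then have "\<rho> (f \<otimes>\<^bsub>?U n\<^esub> f') c = \<rho> f c + \<rho> f' c"
        by (simp add: \<rho>_def add_divide_distrib)
      then show ?thesis
        using fractional_part.hom_mult[of "\<rho> f c" "\<rho> f' c"] by (simp add: \<beta>_def)
    qed
    show "\<beta> f c = \<one>\<^bsub>rationals_mod_integers\<^esub>"
      if "f \<in> carrier ?X" "c \<in> ?d (m - 1) ` carrier (?T (m - 1))" for f c
      using that sd[of f] N by (auto simp: kernel_def \<beta>_def fractional_part_eq_one_iff \<rho>_def)
    show "?dU (n - 1) ` carrier (?U (n - 1)) =
      {f \<in> carrier ?X. \<forall>c\<in>carrier ?K. \<beta> f c = \<one>\<^bsub>rationals_mod_integers\<^esub>}" (is "?L = ?R")
    proof (intro equalityI subsetI)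
      fix f assume "f \<in> ?L"
      then obtain g where g: "g \<in> carrier (?U (n - 1))" "f = ?dU (n - 1) g"
        by auto
      interpret g: group_hom "?T m" integer_group "?p (n - 1) g"
        by (rule p_hom'[OF g(1)])
      have "f \<in> carrier ?X"
        using g H.tate_differential_closed[OF g(1)] H.tate_differential_tate_differential[OF g(1)]
        by (simp add: kernel_def add.commute)
      moreover have "\<beta> f c = \<one>\<^bsub>rationals_mod_integers\<^esub>" if c: "c \<in> ?Z" for c
      proof -
        have "c \<in> carrier (?T m)"
          using c by (simp add: kernel_def)
        then have "?p n f (s c) = int N * ?p (n - 1) g c"
          using adj'[OF g(1) s_closed] ds[OF c] g(2) g.hom_int_pow[of c "int N"] by simp
        then show ?thesis
          using N by (simp add: \<beta>_def fractional_part_eq_one_iff \<rho>_def)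
      qed
      ultimately show "f \<in> ?R"
        by simp
    next
      fix f assume f: "f \<in> ?R"
      then have f_closed: "f \<in> carrier (?U n)" and f_cocycle: "?dU n f = \<one>\<^bsub>?U (n + 1)\<^esub>"
        by (simp_all add: kernel_def)
      have "\<beta> f c = \<one>\<^bsub>rationals_mod_integers\<^esub>"
        if "c \<in> carrier (?T m)" "?d m c = \<one>\<^bsub>?T (m + 1)\<^esub>" for c
        using f that by (simp add: kernel_def)
      \<comment> \<open>\<beta> f vanishes on cocycles, hence has the form F after d. Lifting F to
        F' gives two rational lifts of the same character, \<rho> f and F' after d, whose difference
        is integral; this difference is the required g.\<close>
      then obtain F where F: "F \<in> hom (?T (m + 1)) rationals_mod_integers"
        "\<And>c. c \<in> carrier (?T m) \<Longrightarrow> \<beta> f c = F (?d m c)"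
        using hom_factor_divisible[OF tate_cochains_comm_group tate_cochains_comm_group B
            rationals_mod_integers_divisible tate_differential_hom \<beta>_hom[OF f_closed]]
        by blast
      obtain F' where F': "F' \<in> hom (?T (m + 1)) rational_group"
        "\<And>c. c \<in> carrier (?T (m + 1)) \<Longrightarrow> fractional_part (F' c) = F c"
        using tate_cochains_hom_lift[OF assms F(1)] by blast
      have diff_hom: "(\<lambda>c. \<rho> f c - F' (?d m c)) \<in> hom (?T m) rational_group"
        using \<rho>_hom[OF f_closed] Group.hom_compose[OF tate_differential_hom F'(1)]
        by (auto simp: hom_def)
      have diff_integral: "\<rho> f c - F' (?d m c) \<in> \<int>" if "c \<in> carrier (?T m)" for c
      proof -
        have "fractional_part (\<rho> f c) = fractional_part (F' (?d m c))"
          using F(2)[OF that] F'(2)[OF tate_differential_closed[OF that refl]] by (simp add: \<beta>_def)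
        then have "fractional_part (\<rho> f c - F' (?d m c)) = \<one>\<^bsub>rationals_mod_integers\<^esub>"
          using fractional_part.hom_mult[of "\<rho> f c" "- F' (?d m c)"] fractional_part.hom_inv[of "F' (?d m c)"]
            fractional_part.hom_closed[of "\<rho> f c"] comm_group.axioms(2)[OF B]
          by (simp add: group.r_inv)
        then show ?thesis
          by (simp add: fractional_part_eq_one_iff)
      qed
      obtain g0 where g0: "g0 \<in> hom (?T m) integer_group"
        "\<And>c. c \<in> carrier (?T m) \<Longrightarrow> of_int (g0 c) = \<rho> f c - F' (?d m c)"
        using integral[OF diff_hom diff_integral] by blast
      obtain g where g: "g \<in> carrier (?U (n - 1))"
        "\<And>c. c \<in> carrier (?T m) \<Longrightarrow> ?p (n - 1) g c = g0 c"
        using tate_pairing_representation[OF Int deg(2) g0(1)] by blast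
      have "?dU (n - 1) g = f"
      proof (rule tate_pairing_eqI[OF Int deg(1)])
        show "?dU (n - 1) g \<in> carrier (?U n)"
          using H.tate_differential_closed[OF g(1)] by simp
        fix b assume b: "b \<in> carrier (?T (m - 1))"
        have "F' \<one>\<^bsub>?T (m + 1)\<^esub> = 0"
          using Group.hom_one[OF F'(1)] T.group_axioms comm_group.axioms(2)[OF Q] by simp
        \<comment> \<open>On a coboundary d b the correction F'(d d b) vanishes, and \<rho> f (d b)
          = f(s d b) / N = f(b).\<close>
        then have "rat_of_int (?p n (?dU (n - 1) g) b) = \<rho> f (?d (m - 1) b)"
          using adj'[OF g(1) b] g(2) g0(2) d_closed[OF b] dd[OF b] by simp
        also have "\<dots> = of_int (?p n f b)"
          using sd[OF f_closed f_cocycle b] N by (simp add: \<rho>_def)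
        finally show "?p n (?dU (n - 1) g) b = ?p n f b"
          by simp
      qed (rule f_closed)
      then show "f \<in> ?L"
        using g(1) by blast
    qed
    fix \<chi> assume \<chi>: "\<chi> \<in> hom ?K rationals_mod_integers"
      "\<And>c. c \<in> ?d (m - 1) ` carrier (?T (m - 1)) \<Longrightarrow> \<chi> c = \<one>\<^bsub>rationals_mod_integers\<^esub>"
    obtain F where F: "F \<in> hom (?T m) rationals_mod_integers" "\<And>c. c \<in> ?Z \<Longrightarrow> F c = \<chi> c"
      using hom_extension_divisible[OF tate_cochains_comm_group B rationals_mod_integers_divisible
          cocycles_subgroup \<chi>(1)] by blast
    obtain F' where F': "F' \<in> hom (?T m) rational_group"
      "\<And>c. c \<in> carrier (?T m) \<Longrightarrow> fractional_part (F' c) = F c"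
      using tate_cochains_hom_lift[OF assms F(1)] by blast
    interpret F': group_hom "?T m" rational_group F'
      using F'(1) comm_group.axioms(2)[OF Q] by (simp add: group_hom_def group_hom_axioms_def T.group_axioms)
    have "(\<lambda>b. F' (?d (m - 1) b)) \<in> hom (?T (m - 1)) rational_group"
      using Group.hom_compose[OF tate_differential_hom[of "m - 1"], of F' rational_group] F'(1) by (simp add: comp_def)
    \<comment> \<open>\<chi> is trivial on coboundaries, so its rational lift is integral there; F'
      after d therefore defines an integral cochain f of degree n, which is a cocycle because d d =
      0.\<close>
    moreover have "F' (?d (m - 1) b) \<in> \<int>" if b: "b \<in> carrier (?T (m - 1))" for b
    proof -
      have "?d (m - 1) b \<in> ?Z"
        using d_closed[OF b] dd[OF b] by (simp add: kernel_def)
      then have "fractional_part (F' (?d (m - 1) b)) = \<one>\<^bsub>rationals_mod_integers\<^esub>"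
        using F'(2)[OF d_closed[OF b]] F(2) \<chi>(2) b by simp
      then show ?thesis
        by (simp add: fractional_part_eq_one_iff)
    qed
    ultimately obtain f0 where f0: "f0 \<in> hom (?T (m - 1)) integer_group"
      "\<And>b. b \<in> carrier (?T (m - 1)) \<Longrightarrow> of_int (f0 b) = F' (?d (m - 1) b)"
      using integral[of "\<lambda>b. F' (?d (m - 1) b)" "m - 1"] by blast
    obtain f where f: "f \<in> carrier (?U n)" "\<And>b. b \<in> carrier (?T (m - 1)) \<Longrightarrow> ?p n f b = f0 b"
      using tate_pairing_representation[OF Int deg(1) f0(1)] by blast
    have "rat_of_int (?p n f (?d (m - 2) a)) = 0" if "a \<in> carrier (?T (m - 2))" for a
      using f(2) f0(2) d_closed'[OF that] dd'[OF that] F'.hom_one by simp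
    then have "?dU n f = \<one>\<^bsub>?U (n + 1)\<^esub>"
      unfolding cocycle_iff[OF f(1)] by simp
    then have "f \<in> carrier ?X"
      using f(1) by (simp add: kernel_def)
    moreover have "\<beta> f c = \<chi> c" if c: "c \<in> ?Z" for c
    proof -
      have c_closed: "c \<in> carrier (?T m)"
        using c by (simp add: kernel_def)
      \<comment> \<open>For a cocycle c, f(s c) = F'(d s c) and d s c = N c, so dividing by N
        returns F'(c), a lift of \<chi> c.\<close>
      have "rat_of_int (?p n f (s c)) = F' (c [^]\<^bsub>?T m\<^esub> int N)"
        using f(2) f0(2) s_closed[OF c_closed] ds[OF c] by simp
      also have "\<dots> = of_nat N * F' c"
        using F'.hom_int_pow[OF c_closed, of "int N"] by simp
      finally show ?thesis
        using N F'(2)[OF c_closed] F(2)[OF c] by (simp add: \<beta>_def \<rho>_def)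
    qed
    ultimately show "\<exists>f\<in>carrier ?X. \<forall>c\<in>carrier ?K. \<beta> f c = \<chi> c"
      by auto
  qed
  then show ?thesis
    by (simp add: tate_cohomology_def torsion_dual_def integral_dual_def m_def)
qed

end

theorem proposition3p2:
  fixes G :: "('g, 'b) monoid_scheme"
    and M :: "('m, 'c) monoid_scheme"
    and \<phi> :: "'g \<Rightarrow> 'm \<Rightarrow> 'm"
    and n :: int
  assumes "finite (carrier G)"
    and "G_lattice G M \<phi>"
  shows "(tate_cohomology G (torsion_dual M) (torsion_dual_action G M \<phi>) (n - 1)
           \<cong> torsion_dual (tate_cohomology G M \<phi> (- n)))
      \<and> (tate_cohomology G (torsion_dual M) (torsion_dual_action G M \<phi>) n
           \<cong> tate_cohomology G (integral_dual M) (integral_dual_action G M \<phi>) (n + 1))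
      \<and> (tate_cohomology G (integral_dual M) (integral_dual_action G M \<phi>) n
           \<cong> torsion_dual (tate_cohomology G M \<phi> (- n)))"
proof -
  interpret G_lattice G M \<phi>
    by fact
  interpret finite_G_module G M \<phi>
    using assms(1) by unfold_locales
  obtain r :: nat where free: "M \<cong> free_Abelian_group {..<r}"
    using free_of_finite_rank by blast
  interpret dual: finite_G_module G "integral_dual M" "integral_dual_action G M \<phi>"
    unfolding integral_dual_def by (rule finite_G_module_contragredient[OF abelian_integer_group])
  \<comment> \<open>Reversing the third isomorphism requires its source to be a group.\<close>
  have "group (tate_cohomology G (integral_dual M) (integral_dual_action G M \<phi>) (n + 1))"
    unfolding tate_cohomology_def
    by (intro comm_group.axioms(2) comm_group.abelian_FactGroup dual.cocycles_comm_group dual.coboundaries_subgroup)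
  then have "torsion_dual (tate_cohomology G M \<phi> (- (n + 1))) \<cong>
    tate_cohomology G (integral_dual M) (integral_dual_action G M \<phi>) (n + 1)"
    using tate_cohomology_integral_dual_iso[OF free, of "n + 1"] by (rule group.iso_sym)
  \<comment> \<open>Both dualities are taken at n + 1: the cohomology of the torsion dual in degree
    n and that of the integral dual in degree n + 1 are each dual to degree -n-1 of M.\<close>
  moreover have "tate_cohomology G (torsion_dual M) (torsion_dual_action G M \<phi>) n \<cong>
    torsion_dual (tate_cohomology G M \<phi> (- (n + 1)))"
    using tate_cohomology_torsion_dual_iso[of "n + 1"] by simp
  ultimately have "tate_cohomology G (torsion_dual M) (torsion_dual_action G M \<phi>) n \<cong>
    tate_cohomology G (integral_dual M) (integral_dual_action G M \<phi>) (n + 1)"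
    using iso_trans by blast
  then show ?thesis
    using tate_cohomology_torsion_dual_iso[of n] tate_cohomology_integral_dual_iso[OF free, of n] by blast
qed

end
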